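(* Let $R$ be a commutative Noetherian ring with $\dim R\leq 1$ and let $\mathfrak{a}$ be an ideal of $R$. Let $M$ be an $R$-module such that $\operatorname{Supp}_R(M)\subseteq V(\mathfrak{a})$ and $(0:_M\mathfrak{a})$ is a minimax $R$-module. Then $M$ is minimax. In this case (that is, when $\dim R\leq 1$), the class of $\mathfrak{a}$-cominimax $R$-modules is a Serre subcategory of the category of $R$-modules.
   Context: All rings are commutative Noetherian with non-zero identity. $V(\mathfrak{a})$ is the set of prime ideals of $R$ containing $\mathfrak{a}$, and $(0:_M\mathfrak{a})=\{m\in M: \mathfrak{a}m=0\}$. An $R$-module $M$ is minimax if it has a finitely generated submodule $N$ such that $M/N$ is Artinian. An $R$-module $M$ is $\mathfrak{a}$-cominimax if $\operatorname{Supp}_R(M)\subseteq V(\mathfrak{a})$ and $\operatorname{Ext}^i_R(R/\mathfrak{a},M)$ is minimax for all $i\geq 0$. A class of $R$-modules is a Serre subcategory of the category of $R$-modules if it is closed under taking submodules, quotients and extensions. *)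

theory Defs
  imports "HOL-Algebra.Module" "HOL-Algebra.Ring_Divisibility" "HOL-Library.Extended_Nat"
begin

text \<open>
  Modules are HOL-Algebra modules: records with a carrier, satisfying the locale
  \<^locale>\<open>module\<close>. This record type extends that of rings; its fields \<^term>\<open>mult\<close> and
  \<^term>\<open>one\<close> play no role for modules and are left \<^term>\<open>undefined\<close> below.
  A submodule \<open>N\<close> of \<open>M\<close>, seen as a module, is \<open>M\<lparr>carrier := N\<rparr>\<close>.
\<close>

section \<open>Modules\<close>

definition regular_module :: "('r, 'z) ring_scheme \<Rightarrow> ('r, 'r) module" where
  "regular_module R =
    \<lparr>carrier = carrier R, mult = undefined, one = undefined, zero = \<zero>\<^bsub>R\<^esub>,
     add = add R, smult = mult R\<rparr>"

definition quot_module :: "('r, 'm) module \<Rightarrow> 'm set \<Rightarrow> ('r, 'm set) module" where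
  "quot_module M N =
    \<lparr>carrier = a_rcosets\<^bsub>M\<^esub> N, mult = undefined, one = undefined, zero = N,
     add = set_add M, smult = (\<lambda>r X. \<Union>x\<in>X. N +>\<^bsub>M\<^esub> (r \<odot>\<^bsub>M\<^esub> x))\<rparr>"

text \<open>Homomorphisms are extensional functions, so that equality in the module
  \<open>hom_module\<close> below is equality on the carrier of the domain.\<close>

definition module_homs ::
  "('r, 'z) ring_scheme \<Rightarrow> ('r, 'm) module \<Rightarrow> ('r, 'n) module \<Rightarrow> ('m \<Rightarrow> 'n) set" where
  "module_homs R M N =
    {f \<in> carrier M \<rightarrow>\<^sub>E carrier N.
      (\<forall>x\<in>carrier M. \<forall>y\<in>carrier M. f (x \<oplus>\<^bsub>M\<^esub> y) = f x \<oplus>\<^bsub>N\<^esub> f y) \<and>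
      (\<forall>r\<in>carrier R. \<forall>x\<in>carrier M. f (r \<odot>\<^bsub>M\<^esub> x) = r \<odot>\<^bsub>N\<^esub> f x)}"

definition module_ker ::
  "('r, 'm) module \<Rightarrow> ('r, 'n) module \<Rightarrow> ('m \<Rightarrow> 'n) \<Rightarrow> 'm set" where
  "module_ker M N f = {x \<in> carrier M. f x = \<zero>\<^bsub>N\<^esub>}"

definition hom_module ::
  "('r, 'z) ring_scheme \<Rightarrow> ('r, 'm) module \<Rightarrow> ('r, 'n) module \<Rightarrow> ('r, 'm \<Rightarrow> 'n) module" where
  "hom_module R M N =
    \<lparr>carrier = module_homs R M N, mult = undefined, one = undefined,
     zero = (\<lambda>x\<in>carrier M. \<zero>\<^bsub>N\<^esub>),
     add = (\<lambda>f g. \<lambda>x\<in>carrier M. f x \<oplus>\<^bsub>N\<^esub> g x),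
     smult = (\<lambda>r f. \<lambda>x\<in>carrier M. r \<odot>\<^bsub>N\<^esub> f x)\<rparr>"

definition free_module ::
  "('r, 'z) ring_scheme \<Rightarrow> 'x set \<Rightarrow> ('r, 'x \<Rightarrow> 'r) module" where
  "free_module R B =
    \<lparr>carrier = {f. range f \<subseteq> carrier R \<and> {x. f x \<noteq> \<zero>\<^bsub>R\<^esub>} \<subseteq> B \<and> finite {x. f x \<noteq> \<zero>\<^bsub>R\<^esub>}},
     mult = undefined, one = undefined, zero = (\<lambda>x. \<zero>\<^bsub>R\<^esub>),
     add = (\<lambda>f g x. f x \<oplus>\<^bsub>R\<^esub> g x), smult = (\<lambda>r f x. r \<otimes>\<^bsub>R\<^esub> f x)\<rparr>"

definition submodule_span ::
  "('r, 'z) ring_scheme \<Rightarrow> ('r, 'm) module \<Rightarrow> 'm set \<Rightarrow> 'm set" where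
  "submodule_span R M S = \<Inter>{N. submodule N R M \<and> S \<subseteq> N}"

definition fin_gen_module :: "('r, 'z) ring_scheme \<Rightarrow> ('r, 'm) module \<Rightarrow> bool" where
  "fin_gen_module R M \<longleftrightarrow>
    (\<exists>S. finite S \<and> S \<subseteq> carrier M \<and> submodule_span R M S = carrier M)"

definition artinian_module :: "('r, 'z) ring_scheme \<Rightarrow> ('r, 'm) module \<Rightarrow> bool" where
  "artinian_module R M \<longleftrightarrow>
    (\<forall>N :: nat \<Rightarrow> 'm set. (\<forall>i. submodule (N i) R M \<and> N (Suc i) \<subseteq> N i) \<longrightarrow>
      (\<exists>k. \<forall>i\<ge>k. N i = N k))"

definition minimax_module :: "('r, 'z) ring_scheme \<Rightarrow> ('r, 'm) module \<Rightarrow> bool" where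
  "minimax_module R M \<longleftrightarrow>
    (\<exists>N. submodule N R M \<and> fin_gen_module R (M\<lparr>carrier := N\<rparr>) \<and>
      artinian_module R (quot_module M N))"

text \<open>The submodule \<open>(0 :\<^sub>M a)\<close> of \<open>M\<close>.\<close>

definition annihilated_by :: "('r, 'm) module \<Rightarrow> 'r set \<Rightarrow> 'm set" where
  "annihilated_by M a = {m \<in> carrier M. \<forall>r\<in>a. r \<odot>\<^bsub>M\<^esub> m = \<zero>\<^bsub>M\<^esub>}"


section \<open>Krull dimension and support\<close>

definition krull_dim :: "('r, 'z) ring_scheme \<Rightarrow> enat" where
  "krull_dim R = Sup {enat n | n. \<exists>P :: nat \<Rightarrow> 'r set.
     (\<forall>i\<le>n. primeideal (P i) R) \<and> (\<forall>i<n. P i \<subset> P (Suc i))}"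

definition prime_locus :: "('r, 'z) ring_scheme \<Rightarrow> 'r set \<Rightarrow> 'r set set" where
  "prime_locus R a = {P. primeideal P R \<and> a \<subseteq> P}"

text \<open>The localization of \<open>M\<close> at a multiplicative set \<open>S\<close>, as an \<open>R\<close>-module: its elements
  are the fractions \<open>m / s\<close>, that is, the classes of the pairs \<open>(m, s)\<close> under
  \<open>(m, s) \<sim> (n, t) \<longleftrightarrow> (\<exists>u\<in>S. u t m = u s n)\<close>.\<close>

definition fraction_rel ::
  "'r set \<Rightarrow> ('r, 'm) module \<Rightarrow> (('m \<times> 'r) \<times> ('m \<times> 'r)) set" where
  "fraction_rel S M =
    {((m, s), (n, t)). m \<in> carrier M \<and> n \<in> carrier M \<and> s \<in> S \<and> t \<in> S \<and>
      (\<exists>u\<in>S. u \<odot>\<^bsub>M\<^esub> (t \<odot>\<^bsub>M\<^esub> m) = u \<odot>\<^bsub>M\<^esub> (s \<odot>\<^bsub>M\<^esub> n))}"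

definition localized_module ::
  "('r, 'z) ring_scheme \<Rightarrow> 'r set \<Rightarrow> ('r, 'm) module \<Rightarrow> ('r, ('m \<times> 'r) set) module" where
  "localized_module R S M =
    \<lparr>carrier = (carrier M \<times> S) // fraction_rel S M,
     mult = undefined, one = undefined,
     zero = fraction_rel S M `` {(\<zero>\<^bsub>M\<^esub>, \<one>\<^bsub>R\<^esub>)},
     add = (\<lambda>X Y. \<Union>(m, s)\<in>X. \<Union>(n, t)\<in>Y.
       fraction_rel S M `` {((t \<odot>\<^bsub>M\<^esub> m) \<oplus>\<^bsub>M\<^esub> (s \<odot>\<^bsub>M\<^esub> n), s \<otimes>\<^bsub>R\<^esub> t)}),
     smult = (\<lambda>r X. \<Union>(m, s)\<in>X. fraction_rel S M `` {(r \<odot>\<^bsub>M\<^esub> m, s)})\<rparr>"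

definition module_supp :: "('r, 'z) ring_scheme \<Rightarrow> ('r, 'm) module \<Rightarrow> 'r set set" where
  "module_supp R M =
    {P. primeideal P R \<and>
      carrier (localized_module R (carrier R - P) M)
        \<noteq> {\<zero>\<^bsub>localized_module R (carrier R - P) M\<^esub>}}"


section \<open>Ext\<close>

text \<open>A free resolution
  \<open>\<dots> \<rightarrow> R\<^bsup>(B 2)\<^esup> \<rightarrow> R\<^bsup>(B 1)\<^esup> \<rightarrow> R\<^bsup>(B 0)\<^esup> \<rightarrow> N \<rightarrow> 0\<close> with differentials
  \<open>d i : R\<^bsup>(B (i + 1))\<^esup> \<rightarrow> R\<^bsup>(B i)\<^esup>\<close> and augmentation \<open>e\<close>.\<close>

definition free_resolution ::
  "('r, 'z) ring_scheme \<Rightarrow> ('r, 'n) module \<Rightarrow> (nat \<Rightarrow> 'x set) \<Rightarrow>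
    (nat \<Rightarrow> ('x \<Rightarrow> 'r) \<Rightarrow> 'x \<Rightarrow> 'r) \<Rightarrow> (('x \<Rightarrow> 'r) \<Rightarrow> 'n) \<Rightarrow> bool" where
  "free_resolution R N B d e \<longleftrightarrow>
    e \<in> module_homs R (free_module R (B 0)) N \<and>
    e ` carrier (free_module R (B 0)) = carrier N \<and>
    (\<forall>i. d i \<in> module_homs R (free_module R (B (Suc i))) (free_module R (B i))) \<and>
    d 0 ` carrier (free_module R (B (Suc 0))) = module_ker (free_module R (B 0)) N e \<and>
    (\<forall>i. d (Suc i) ` carrier (free_module R (B (Suc (Suc i)))) =
      module_ker (free_module R (B (Suc i))) (free_module R (B i)) (d i))"

text \<open>The cohomology of the complex \<open>Hom(R\<^bsup>(B i)\<^esup>, M)\<close> with coboundary maps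
  \<open>f \<mapsto> f \<circ> d i\<close>.\<close>

definition hom_cocycles ::
  "('r, 'z) ring_scheme \<Rightarrow> (nat \<Rightarrow> 'x set) \<Rightarrow> (nat \<Rightarrow> ('x \<Rightarrow> 'r) \<Rightarrow> 'x \<Rightarrow> 'r) \<Rightarrow>
    ('r, 'm) module \<Rightarrow> nat \<Rightarrow> (('x \<Rightarrow> 'r) \<Rightarrow> 'm) set" where
  "hom_cocycles R B d M i =
    {f \<in> module_homs R (free_module R (B i)) M.
      compose (carrier (free_module R (B (Suc i)))) f (d i) =
        \<zero>\<^bsub>hom_module R (free_module R (B (Suc i))) M\<^esub>}"

fun hom_coboundaries ::
  "('r, 'z) ring_scheme \<Rightarrow> (nat \<Rightarrow> 'x set) \<Rightarrow> (nat \<Rightarrow> ('x \<Rightarrow> 'r) \<Rightarrow> 'x \<Rightarrow> 'r) \<Rightarrow>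
    ('r, 'm) module \<Rightarrow> nat \<Rightarrow> (('x \<Rightarrow> 'r) \<Rightarrow> 'm) set" where
  "hom_coboundaries R B d M 0 = {\<zero>\<^bsub>hom_module R (free_module R (B 0)) M\<^esub>}"
| "hom_coboundaries R B d M (Suc i) =
    (\<lambda>f. compose (carrier (free_module R (B (Suc i)))) f (d i)) `
      module_homs R (free_module R (B i)) M"

definition hom_cohomology ::
  "('r, 'z) ring_scheme \<Rightarrow> (nat \<Rightarrow> 'x set) \<Rightarrow> (nat \<Rightarrow> ('x \<Rightarrow> 'r) \<Rightarrow> 'x \<Rightarrow> 'r) \<Rightarrow>
    ('r, 'm) module \<Rightarrow> nat \<Rightarrow> ('r, (('x \<Rightarrow> 'r) \<Rightarrow> 'm) set) module" where
  "hom_cohomology R B d M i =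
    quot_module
      ((hom_module R (free_module R (B i)) M)\<lparr>carrier := hom_cocycles R B d M i\<rparr>)
      (hom_coboundaries R B d M i)"

text \<open>\<open>Ext\<^sup>i(N, M)\<close> is computed from some free resolution of \<open>N\<close>; up to isomorphism it does
  not depend on the choice. The bases are taken as sets of lists over \<open>'r \<times> 'n\<close>. This is no
  restriction: that type of lists, call it \<open>X\<close>, is infinite and at least as large as \<open>'r\<close> and
  \<open>'n\<close>. A free module with basis in \<open>X\<close> therefore has at most as many elements as \<open>X\<close>, so at
  every stage \<open>X\<close> has room for a basis indexed by all elements of \<open>N\<close> or of a kernel, and
  every module \<open>N\<close> has such a resolution.\<close>

definition Ext_module ::
  "('r, 'z) ring_scheme \<Rightarrow> nat \<Rightarrow> ('r, 'n) module \<Rightarrow> ('r, 'm) module \<Rightarrow>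
    ('r, ((('r \<times> 'n) list \<Rightarrow> 'r) \<Rightarrow> 'm) set) module" where
  "Ext_module R i N M =
    (let (B, d) = (SOME (B, d). \<exists>e. free_resolution R N B d e)
     in hom_cohomology R B d M i)"


section \<open>Cominimax modules and Serre subcategories\<close>

definition cominimax_module ::
  "('r, 'z) ring_scheme \<Rightarrow> 'r set \<Rightarrow> ('r, 'm) module \<Rightarrow> bool" where
  "cominimax_module R a M \<longleftrightarrow>
    module_supp R M \<subseteq> prime_locus R a \<and>
    (\<forall>i. minimax_module R (Ext_module R i (quot_module (regular_module R) a) M))"

text \<open>A class of modules is a polymorphic predicate, whose instances at three (arbitrary)
  carrier types are passed as \<open>C\<^sub>1\<close>, \<open>C\<^sub>2\<close> and \<open>C\<^sub>3\<close>. Closure under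
  submodules, quotients and extensions is expressed by injective homomorphisms, surjective
  homomorphisms and short exact sequences \<open>0 \<rightarrow> L \<rightarrow> M \<rightarrow> N \<rightarrow> 0\<close>; in particular it
  includes closure under isomorphism.\<close>

definition serre_subcategory ::
  "('r, 'z) ring_scheme \<Rightarrow> (('r, 'l) module \<Rightarrow> bool) \<Rightarrow> (('r, 'm) module \<Rightarrow> bool) \<Rightarrow>
    (('r, 'n) module \<Rightarrow> bool) \<Rightarrow> bool" where
  "serre_subcategory R C\<^sub>1 C\<^sub>2 C\<^sub>3 \<longleftrightarrow>
    (\<forall>L M f. module R L \<and> module R M \<and> f \<in> module_homs R L M \<and> inj_on f (carrier L) \<and> C\<^sub>2 M
      \<longrightarrow> C\<^sub>1 L) \<and>
    (\<forall>M N g. module R M \<and> module R N \<and> g \<in> module_homs R M N \<and> g ` carrier M = carrier N \<and> C\<^sub>2 M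
      \<longrightarrow> C\<^sub>3 N) \<and>
    (\<forall>L M N f g. module R L \<and> module R M \<and> module R N \<and>
      f \<in> module_homs R L M \<and> inj_on f (carrier L) \<and>
      g \<in> module_homs R M N \<and> g ` carrier M = carrier N \<and>
      f ` carrier L = module_ker M N g \<and> C\<^sub>1 L \<and> C\<^sub>3 N
      \<longrightarrow> C\<^sub>2 M)"

end

theory Submission
  imports Defs
begin

text \<open>
  A module is minimax iff it has a finite subset \<open>S\<close> such that the submodules containing \<open>S\<close> satisfy
  the descending chain condition. Since \<open>R\<close> is Noetherian, this condition passes to submodules,
  quotients and extensions.

  For the first claim it suffices, adding the generators of \<open>a\<close> one at a time, to treat
  an \<open>x\<close>-torsion module \<open>W\<close> with minimax \<open>(0 :\<^sub>W x)\<close>. Let \<open>I = ann (x ^ n)\<close> be the stable value of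
  these annihilators. As \<open>dim R \<le> 1\<close>, all primes over \<open>I + (x)\<close> are maximal, so the minimax
  module \<open>(0 :\<^sub>W I + (x))\<close> is Artinian; hence so is the \<open>x\<close>-torsion module \<open>(0 :\<^sub>W I)\<close>.
  Finally \<open>W / (0 :\<^sub>W I)\<close> embeds into a finite power of the minimax module \<open>(0 :\<^sub>W x ^ n)\<close> by
  multiplication with generators of \<open>I\<close>.

  For the second claim, \<open>(0 :\<^sub>M a)\<close> embeds into \<open>Ext\<^sup>0\<close>, while all \<open>Ext\<^sup>i(R / a, M)\<close> are subquotients
  of finite powers of \<open>M\<close>; so \<open>M\<close> is cominimax iff it is minimax with support in \<open>V(a)\<close>.
\<close>

section \<open>Chain conditions between submodules\<close>

text \<open>The exponent \<open>k\<close> with \<open>x ^ k m = 0\<close> depends on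
  \<open>m\<close>, so \<open>W\<close> need not be killed by any single power of \<open>x\<close>,
  and finitely many multiplications by \<open>x\<close> cannot exhaust it. The ideal
  \<open>I = ann (x ^ n)\<close> gets around this. Since \<open>I x ^ n = 0\<close>, the products
  \<open>I W\<close> do lie in \<open>(0 :_W x ^ n)\<close>, which finitely many multiplications by
  \<open>x\<close> reduce to \<open>(0 :_W x)\<close>. What \<open>I\<close> kills is a module over
  \<open>R / I\<close>, where \<open>x\<close> is a nonzerodivisor because \<open>n\<close> is
  stable; so primes over \<open>I + (x)\<close> are not minimal, and the dimension bound makes them
  maximal. For Ext the obstacle is that the resolution is selected by \<open>SOME\<close> and may
  have infinite bases, so \<open>Hom(F, M)\<close> need not be minimax. A resolution by finite free
  modules exists because \<open>R\<close> is Noetherian, and a homotopy argument transfers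
  minimaxity from it. Chain conditions are phrased for intervals of submodules inside one fixed
  module, so that submodules and quotients need no carrier types of their own.\<close>

locale rmodule = module R M
  for R :: "('r, 'z) ring_scheme" (structure) and M :: "('r, 'm) module" (structure)

locale linear_map = M: rmodule R M + N: rmodule R N
  for R :: "('r, 'z) ring_scheme" (structure)
    and M :: "('r, 'm) module" and N :: "('r, 'n) module" +
  fixes f :: "'m \<Rightarrow> 'n"
  assumes map_closed [simp, intro]: "x \<in> carrier M \<Longrightarrow> f x \<in> carrier N"
    and map_add: "\<lbrakk>x \<in> carrier M; y \<in> carrier M\<rbrakk> \<Longrightarrow> f (x \<oplus>\<^bsub>M\<^esub> y) = f x \<oplus>\<^bsub>N\<^esub> f y"
    and map_smult: "\<lbrakk>r \<in> carrier R; x \<in> carrier M\<rbrakk> \<Longrightarrow> f (r \<odot>\<^bsub>M\<^esub> x) = r \<odot>\<^bsub>N\<^esub> f x"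
begin

lemma map_zero [simp]: "f \<zero>\<^bsub>M\<^esub> = \<zero>\<^bsub>N\<^esub>"
  using map_smult[of \<zero> "\<zero>\<^bsub>M\<^esub>"] by simp

lemma map_minus: "x \<in> carrier M \<Longrightarrow> f (\<ominus>\<^bsub>M\<^esub> x) = \<ominus>\<^bsub>N\<^esub> f x"
  using map_smult[of "\<ominus> \<one>" x] by (simp add: M.smult_l_minus N.smult_l_minus)

lemma map_diff:
  "\<lbrakk>x \<in> carrier M; y \<in> carrier M\<rbrakk> \<Longrightarrow> f (x \<ominus>\<^bsub>M\<^esub> y) = f x \<ominus>\<^bsub>N\<^esub> f y"
  by (simp add: map_add map_minus a_minus_def)

end

context rmodule
begin

lemma submodule_subset: "submodule H R M \<Longrightarrow> H \<subseteq> carrier M"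
  by (rule submoduleE(1))

lemma submodule_carrier: "\<lbrakk>submodule H R M; x \<in> H\<rbrakk> \<Longrightarrow> x \<in> carrier M"
  using submoduleE(1) by blast

lemma submodule_zero: "submodule H R M \<Longrightarrow> \<zero>\<^bsub>M\<^esub> \<in> H"
  by (metis M.l_neg ex_in_conv submoduleE(2,3,5) submodule_carrier)

lemma submodule_diff: "\<lbrakk>submodule H R M; x \<in> H; y \<in> H\<rbrakk> \<Longrightarrow> x \<ominus>\<^bsub>M\<^esub> y \<in> H"
  unfolding a_minus_def by (simp add: submoduleE)

lemma submoduleI':
  assumes "H \<subseteq> carrier M" "\<zero>\<^bsub>M\<^esub> \<in> H"
    and "\<And>a b. \<lbrakk>a \<in> H ; b \<in> H\<rbrakk> \<Longrightarrow> a \<oplus>\<^bsub>M\<^esub> b \<in> H"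
    and "\<And>a x. \<lbrakk>a \<in> carrier R; x \<in> H\<rbrakk> \<Longrightarrow> a \<odot>\<^bsub>M\<^esub> x \<in> H"
  shows "submodule H R M"
proof (rule submoduleI)
  fix a assume a: "a \<in> H"
  have "(\<ominus> \<one>) \<odot>\<^bsub>M\<^esub> a \<in> H" by (rule assms) (auto simp: a)
  then show "\<ominus>\<^bsub>M\<^esub> a \<in> H" using a assms(1) by (simp add: smult_l_minus subset_iff)
qed (use assms in auto)

lemma zero_submodule: "submodule {\<zero>\<^bsub>M\<^esub>} R M"
  by (rule submoduleI') auto

lemma inter_submodule: "\<lbrakk>submodule A R M; submodule B R M\<rbrakk> \<Longrightarrow> submodule (A \<inter> B) R M"
  by (rule submoduleI') (auto simp: submodule_zero submoduleE dest: submodule_carrier)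

lemma mem_set_add: "x \<in> A <+>\<^bsub>M\<^esub> B \<longleftrightarrow> (\<exists>a\<in>A. \<exists>b\<in>B. x = a \<oplus>\<^bsub>M\<^esub> b)"
  by (auto simp: set_add_defs)

lemma set_add_submodule:
  assumes A: "submodule A R M" and B: "submodule B R M"
  shows "submodule (A <+>\<^bsub>M\<^esub> B) R M"
proof (rule submoduleI')
  note c = submodule_carrier[OF A] submodule_carrier[OF B]
  show "A <+>\<^bsub>M\<^esub> B \<subseteq> carrier M" using c by (auto simp: mem_set_add)
  show "\<zero>\<^bsub>M\<^esub> \<in> A <+>\<^bsub>M\<^esub> B"
    using submodule_zero[OF A] submodule_zero[OF B] by (force simp: mem_set_add)
  fix x assume x: "x \<in> A <+>\<^bsub>M\<^esub> B"
  then obtain a b where ab: "a \<in> A" "b \<in> B" "x = a \<oplus>\<^bsub>M\<^esub> b" by (auto simp: mem_set_add)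
  { fix y assume "y \<in> A <+>\<^bsub>M\<^esub> B"
    then obtain a' b' where ab': "a' \<in> A" "b' \<in> B" "y = a' \<oplus>\<^bsub>M\<^esub> b'" by (auto simp: mem_set_add)
    have "x \<oplus>\<^bsub>M\<^esub> y = (a \<oplus>\<^bsub>M\<^esub> a') \<oplus>\<^bsub>M\<^esub> (b \<oplus>\<^bsub>M\<^esub> b')"
      using ab ab' c by (simp add: M.a_ac)
    then show "x \<oplus>\<^bsub>M\<^esub> y \<in> A <+>\<^bsub>M\<^esub> B"
      using ab ab' submoduleE(5)[OF A] submoduleE(5)[OF B] unfolding mem_set_add by metis }
  fix r assume r: "r \<in> carrier R"
  then have "r \<odot>\<^bsub>M\<^esub> x = r \<odot>\<^bsub>M\<^esub> a \<oplus>\<^bsub>M\<^esub> r \<odot>\<^bsub>M\<^esub> b"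
    using ab c by (simp add: smult_r_distr)
  then show "r \<odot>\<^bsub>M\<^esub> x \<in> A <+>\<^bsub>M\<^esub> B"
    using ab r submoduleE(4)[OF A] submoduleE(4)[OF B] unfolding mem_set_add by metis
qed

lemma set_add_upper1:
  assumes "submodule A R M" "submodule B R M" shows "A \<subseteq> A <+>\<^bsub>M\<^esub> B"
proof
  fix x assume "x \<in> A"
  then have "x = x \<oplus>\<^bsub>M\<^esub> \<zero>\<^bsub>M\<^esub>" using submodule_carrier[OF assms(1)] by simp
  then show "x \<in> A <+>\<^bsub>M\<^esub> B" using \<open>x \<in> A\<close> submodule_zero[OF assms(2)] by (auto simp: mem_set_add)
qed

lemma set_add_upper2:
  assumes "submodule A R M" "submodule B R M" shows "B \<subseteq> A <+>\<^bsub>M\<^esub> B"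
proof
  fix x assume "x \<in> B"
  then have "x = \<zero>\<^bsub>M\<^esub> \<oplus>\<^bsub>M\<^esub> x" using submodule_carrier[OF assms(2)] by simp
  then show "x \<in> A <+>\<^bsub>M\<^esub> B" using \<open>x \<in> B\<close> submodule_zero[OF assms(1)] by (auto simp: mem_set_add)
qed

lemma set_add_least:
  assumes "submodule C R M" "A \<subseteq> C" "B \<subseteq> C" shows "A <+>\<^bsub>M\<^esub> B \<subseteq> C"
  using assms submoduleE(5)[OF assms(1)] by (auto simp: mem_set_add subset_iff)

lemma set_add_mono: "\<lbrakk>A \<subseteq> A'; B \<subseteq> B'\<rbrakk> \<Longrightarrow> A <+>\<^bsub>M\<^esub> B \<subseteq> A' <+>\<^bsub>M\<^esub> B'"
  unfolding subset_iff mem_set_add by blast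

text \<open>The modular law: if \<open>y = z + b\<close> with \<open>z\<close> in \<open>K'\<close>,
  then \<open>b = y - z\<close> lies in both \<open>K\<close> and \<open>B\<close>. It closes the
  stabilization arguments below, where a chain is known to be constant on \<open>B\<close> and
  modulo \<open>B\<close>.\<close>

lemma modular_subset:
  assumes K: "submodule K R M" and K': "submodule K' R M" and B: "B \<subseteq> carrier M"
    and "K' \<subseteq> K" "K \<inter> B \<subseteq> K'" "K \<subseteq> K' <+>\<^bsub>M\<^esub> B"
  shows "K \<subseteq> K'"
proof
  fix y assume y: "y \<in> K"
  then obtain z b where zb: "z \<in> K'" "b \<in> B" "y = z \<oplus>\<^bsub>M\<^esub> b"
    using assms(6) mem_set_add by (metis subsetD)
  then have c: "z \<in> carrier M" "b \<in> carrier M" using B submodule_carrier[OF K'] by auto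
  have "b = y \<ominus>\<^bsub>M\<^esub> z"
    using c zb(3) by (metis M.add.m_assoc M.add.m_comm M.minus_closed M.r_neg M.r_zero M.a_inv_closed a_minus_def)
  then have "b \<in> K" using y zb(1) assms(4) submodule_diff[OF K] by auto
  then have "b \<in> K'" using zb(2) assms(5) by auto
  then show "y \<in> K'" using zb submoduleE(5)[OF K'] by auto
qed

end

text \<open>The Artinian property of \<open>B / A\<close> without forming the quotient.
  \<open>A\<close> and \<open>B\<close> may be arbitrary subsets, which lets intervals be shrunk
  freely.\<close>

definition dcc_between ::
  "('r, 'z) ring_scheme \<Rightarrow> ('r, 'm) module \<Rightarrow> 'm set \<Rightarrow> 'm set \<Rightarrow> bool" where
  "dcc_between R M A B \<longleftrightarrow>
    (\<forall>K :: nat \<Rightarrow> 'm set.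
      (\<forall>i. submodule (K i) R M \<and> A \<subseteq> K i \<and> K i \<subseteq> B \<and> K (Suc i) \<subseteq> K i) \<longrightarrow>
      (\<exists>k. \<forall>i\<ge>k. K i = K k))"

lemma dcc_betweenD:
  assumes "dcc_between R M A B"
    and "\<And>i. submodule (K i) R M" "\<And>i. A \<subseteq> K i" "\<And>i. K i \<subseteq> B" "\<And>i. K (Suc i) \<subseteq> K i"
  shows "\<exists>k. \<forall>i\<ge>k. K i = K k"
  using assms unfolding dcc_between_def by blast

lemma dcc_between_mono:
  "\<lbrakk>dcc_between R M A B; A \<subseteq> A'; B' \<subseteq> B\<rbrakk> \<Longrightarrow> dcc_between R M A' B'"
  unfolding dcc_between_def by (meson order_trans)

lemma dcc_between_refl: "dcc_between R M A A"
  unfolding dcc_between_def by blast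

lemma dcc_betweenI:
  assumes "\<And>K :: nat \<Rightarrow> 'm set. \<lbrakk>\<And>i. submodule (K i) R M; \<And>i. A \<subseteq> K i; \<And>i. K i \<subseteq> B;
      \<And>i j. i \<le> j \<Longrightarrow> K j \<subseteq> K i\<rbrakk> \<Longrightarrow> \<exists>k. \<forall>i\<ge>k. K k \<subseteq> K i"
  shows "dcc_between R M A B"
  unfolding dcc_between_def
proof (intro allI impI)
  fix K assume K: "\<forall>i. submodule (K i) R M \<and> A \<subseteq> K i \<and> K i \<subseteq> B \<and> K (Suc i) \<subseteq> K i"
  have mono: "K j \<subseteq> K i" if "i \<le> j" for i j
    using lift_Suc_antimono_le[of K, OF _ that] K by auto
  obtain k where "\<forall>i\<ge>k. K k \<subseteq> K i" using assms[of K] K mono by blast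
  then show "\<exists>k. \<forall>i\<ge>k. K i = K k" using mono by blast
qed

lemma (in linear_map) image_submodule:
  assumes T: "submodule T R M"
  shows "submodule (f ` T) R N"
proof (rule N.submoduleI')
  note c = M.submodule_carrier[OF T]
  show "f ` T \<subseteq> carrier N" using c by auto
  show "\<zero>\<^bsub>N\<^esub> \<in> f ` T" using M.submodule_zero[OF T] map_zero by (metis imageI)
  fix x y r
  assume x: "x \<in> f ` T"
  then show "y \<in> f ` T \<Longrightarrow> x \<oplus>\<^bsub>N\<^esub> y \<in> f ` T"
    using M.submoduleE(5)[OF T] c by (auto simp: map_add[symmetric])
  show "r \<in> carrier R \<Longrightarrow> r \<odot>\<^bsub>N\<^esub> x \<in> f ` T"
    using x M.submoduleE(4)[OF T] c by (auto simp: map_smult[symmetric])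
qed

lemma (in linear_map) vimage_submodule:
  assumes "submodule T R N"
  shows "submodule {x \<in> carrier M. f x \<in> T} R M"
  by (rule M.submoduleI') (auto simp: map_add map_smult N.submodule_zero N.submoduleE assms)

lemma (in linear_map) kernel_submodule: "submodule {x \<in> carrier M. f x = \<zero>\<^bsub>N\<^esub>} R M"
  using vimage_submodule[OF N.zero_submodule] by simp

text \<open>Two nested submodules with the same intersection with the kernel and the same image are
  equal, so a descending chain stops once both derived chains stop. The conditions on
  \<open>A\<close>, \<open>C\<close> and \<open>A'\<close> place these two chains in the intervals
  where the condition is known.\<close>

lemma (in linear_map) dcc_between_extension:
  assumes T: "submodule T R M" and A': "A \<subseteq> A'" "C \<subseteq> f ` A'" "A \<subseteq> {x \<in> carrier M. f x = \<zero>\<^bsub>N\<^esub>}"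
    and ker: "dcc_between R M A (T \<inter> {x \<in> carrier M. f x = \<zero>\<^bsub>N\<^esub>})"
    and im: "dcc_between R N C (f ` T)"
  shows "dcc_between R M A' T"
proof (rule dcc_betweenI)
  fix K :: "nat \<Rightarrow> 'm set"
  assume K: "\<And>i. submodule (K i) R M" "\<And>i. A' \<subseteq> K i" "\<And>i. K i \<subseteq> T"
    and mono: "\<And>i j. i \<le> j \<Longrightarrow> K j \<subseteq> K i"
  let ?Z = "{x \<in> carrier M. f x = \<zero>\<^bsub>N\<^esub>}"
  have Z: "submodule ?Z R M"
    by (rule kernel_submodule)
  have img: "submodule (f ` K i) R N" for i by (rule image_submodule[OF K(1)])
  have "\<exists>k. \<forall>i\<ge>k. K i \<inter> ?Z = K k \<inter> ?Z"
  proof (rule dcc_betweenD[OF ker])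
    fix i
    show "submodule (K i \<inter> ?Z) R M" by (rule M.inter_submodule[OF K(1) Z])
    show "A \<subseteq> K i \<inter> ?Z" using K(2)[of i] A'(1) A'(3) by auto
    show "K i \<inter> ?Z \<subseteq> T \<inter> ?Z" using K(3) by auto
    show "K (Suc i) \<inter> ?Z \<subseteq> K i \<inter> ?Z" using mono[of i "Suc i"] by auto
  qed
  then obtain k1 where k1: "\<And>i. i \<ge> k1 \<Longrightarrow> K i \<inter> ?Z = K k1 \<inter> ?Z" by blast
  have "\<exists>k. \<forall>i\<ge>k. f ` K i = f ` K k"
  proof (rule dcc_betweenD[OF im])
    fix i
    show "submodule (f ` K i) R N" by (rule img)
    show "C \<subseteq> f ` K i" using image_mono[OF K(2)[of i], of f] A'(2) by (rule order_trans[rotated])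
    show "f ` K i \<subseteq> f ` T" using K(3) by auto
    show "f ` K (Suc i) \<subseteq> f ` K i" using mono[of i "Suc i"] by auto
  qed
  then obtain k2 where k2: "\<And>i. i \<ge> k2 \<Longrightarrow> f ` K i = f ` K k2" by blast
  let ?k = "max k1 k2"
  have "K ?k \<subseteq> K i" if i: "i \<ge> ?k" for i
  proof (rule M.modular_subset[of _ _ ?Z])
    show "K i \<subseteq> K ?k" by (rule mono) fact
    show "K ?k \<inter> ?Z \<subseteq> K i" using k1[of i] k1[of ?k] i by auto
    show "K ?k \<subseteq> K i <+>\<^bsub>M\<^esub> ?Z"
    proof
      fix y assume y: "y \<in> K ?k"
      then have "f y \<in> f ` K i" using k2[of i] k2[of ?k] i by auto
      then obtain z where z: "z \<in> K i" "f y = f z" by auto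
      have c: "y \<in> carrier M" "z \<in> carrier M" using y z M.submodule_carrier[OF K(1)] by auto
      have "f (y \<ominus>\<^bsub>M\<^esub> z) = \<zero>\<^bsub>N\<^esub>" 
        using c z(2) by (simp add: map_diff) (simp add: a_minus_def N.r_neg)
      moreover have "y = z \<oplus>\<^bsub>M\<^esub> (y \<ominus>\<^bsub>M\<^esub> z)"
        using c by (simp add: a_minus_def M.a_lcomm M.r_neg)
      ultimately show "y \<in> K i <+>\<^bsub>M\<^esub> ?Z" using z c unfolding M.mem_set_add by blast
    qed
  qed (use K in auto)
  then show "\<exists>k. \<forall>i\<ge>k. K k \<subseteq> K i" by blast
qed

text \<open>Preimages cut down to \<open>B\<close> turn a chain in \<open>N\<close> into one in
  \<open>M\<close>; as all members lie in the image of \<open>B\<close>, they are recovered from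
  these preimages.\<close>

lemma (in linear_map) dcc_between_image:
  assumes B: "submodule B R M" and "A \<subseteq> B" and dcc: "dcc_between R M A B"
  shows "dcc_between R N (f ` A) (f ` B)"
proof (rule dcc_betweenI)
  fix K :: "nat \<Rightarrow> 'n set"
  assume K: "\<And>i. submodule (K i) R N" "\<And>i. f ` A \<subseteq> K i" "\<And>i. K i \<subseteq> f ` B"
    and mono: "\<And>i j. i \<le> j \<Longrightarrow> K j \<subseteq> K i"
  let ?L = "\<lambda>i. {x \<in> carrier M. f x \<in> K i} \<inter> B"
  have "\<exists>k. \<forall>i\<ge>k. ?L i = ?L k"
  proof (rule dcc_betweenD[OF dcc])
    fix i
    show "submodule (?L i) R M" by (rule M.inter_submodule[OF vimage_submodule[OF K(1)] B])
    show "A \<subseteq> ?L i" using K(2)[of i] assms(2) M.submodule_carrier[OF B] by auto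
    show "?L (Suc i) \<subseteq> ?L i" using mono[of i "Suc i"] by auto
  qed auto
  then obtain k where k: "\<And>i. i \<ge> k \<Longrightarrow> ?L i = ?L k" by blast
  have "K k \<subseteq> K i" if "i \<ge> k" for i
  proof
    fix y assume y: "y \<in> K k"
    then obtain b where b: "b \<in> B" "y = f b" using K(3) by blast
    then have "b \<in> ?L k" using y M.submodule_carrier[OF B] by auto
    then have "b \<in> ?L i" using k[OF that] by simp
    then show "y \<in> K i" using b by auto
  qed
  then show "\<exists>k. \<forall>i\<ge>k. K k \<subseteq> K i" by blast
qed

context rmodule
begin

text \<open>The intersections with \<open>B\<close> and the sums with \<open>B\<close> stabilize
  separately, and the modular law combines them.\<close>

lemma dcc_between_trans:
  assumes B: "submodule B R M"
    and AB: "dcc_between R M A B" and BC: "dcc_between R M B C" and sub: "A \<subseteq> B" "B \<subseteq> C"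
    and C: "submodule C R M"
  shows "dcc_between R M A C"
proof (rule dcc_betweenI)
  fix K :: "nat \<Rightarrow> 'm set"
  assume K: "\<And>i. submodule (K i) R M" "\<And>i. A \<subseteq> K i" "\<And>i. K i \<subseteq> C"
    and mono: "\<And>i j. i \<le> j \<Longrightarrow> K j \<subseteq> K i"
  have "\<exists>k. \<forall>i\<ge>k. K i \<inter> B = K k \<inter> B"
  proof (rule dcc_betweenD[OF AB])
    fix i
    show "submodule (K i \<inter> B) R M" by (rule inter_submodule[OF K(1) B])
    show "A \<subseteq> K i \<inter> B" using K(2)[of i] sub by auto
    show "K (Suc i) \<inter> B \<subseteq> K i \<inter> B" using mono[of i "Suc i"] by auto
  qed auto
  then obtain k1 where k1: "\<And>i. i \<ge> k1 \<Longrightarrow> K i \<inter> B = K k1 \<inter> B" by blast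
  have "\<exists>k. \<forall>i\<ge>k. K i <+>\<^bsub>M\<^esub> B = K k <+>\<^bsub>M\<^esub> B"
  proof (rule dcc_betweenD[OF BC])
    fix i
    show "submodule (K i <+>\<^bsub>M\<^esub> B) R M" by (rule set_add_submodule[OF K(1) B])
    show "B \<subseteq> K i <+>\<^bsub>M\<^esub> B" by (rule set_add_upper2[OF K(1) B])
    show "K i <+>\<^bsub>M\<^esub> B \<subseteq> C" by (rule set_add_least[OF C K(3) sub(2)])
    show "K (Suc i) <+>\<^bsub>M\<^esub> B \<subseteq> K i <+>\<^bsub>M\<^esub> B" by (rule set_add_mono[OF mono]) auto
  qed
  then obtain k2 where k2: "\<And>i. i \<ge> k2 \<Longrightarrow> K i <+>\<^bsub>M\<^esub> B = K k2 <+>\<^bsub>M\<^esub> B" by blast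
  let ?k = "max k1 k2"
  have "K ?k \<subseteq> K i" if i: "i \<ge> ?k" for i
  proof (rule modular_subset[of _ _ B])
    show "K ?k \<inter> B \<subseteq> K i" using k1[of i] k1[of ?k] i by auto
    show "K ?k \<subseteq> K i <+>\<^bsub>M\<^esub> B"
      using k2[of i] k2[of ?k] i set_add_upper1[OF K(1)[of ?k] B] by auto
    show "K i \<subseteq> K ?k" by (rule mono) fact
  qed (use K submodule_subset[OF B] in auto)
  then show "\<exists>k. \<forall>i\<ge>k. K k \<subseteq> K i" by blast
qed

text \<open>The quotient of the intersections with \<open>T\<close> embeds into \<open>B / A\<close>
  by \<open>K \<mapsto> K + A\<close>. Nothing is lost, since a member of the chain meets
  \<open>A\<close> only inside \<open>A \<inter> T\<close>, which every member contains.\<close>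

lemma dcc_between_inter:
  assumes A: "submodule A R M" and B: "submodule B R M" and T: "submodule T R M"
    and sub: "A \<subseteq> B" and dcc: "dcc_between R M A B"
  shows "dcc_between R M (A \<inter> T) (B \<inter> T)"
proof (rule dcc_betweenI)
  fix K :: "nat \<Rightarrow> 'm set"
  assume K: "\<And>i. submodule (K i) R M" "\<And>i. A \<inter> T \<subseteq> K i" "\<And>i. K i \<subseteq> B \<inter> T"
    and mono: "\<And>i j. i \<le> j \<Longrightarrow> K j \<subseteq> K i"
  have "\<exists>k. \<forall>i\<ge>k. K i <+>\<^bsub>M\<^esub> A = K k <+>\<^bsub>M\<^esub> A"
  proof (rule dcc_betweenD[OF dcc])
    fix i
    show "submodule (K i <+>\<^bsub>M\<^esub> A) R M" by (rule set_add_submodule[OF K(1) A])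
    show "A \<subseteq> K i <+>\<^bsub>M\<^esub> A" by (rule set_add_upper2[OF K(1) A])
    show "K i <+>\<^bsub>M\<^esub> A \<subseteq> B" using K(3)[of i] by (intro set_add_least B sub) auto
    show "K (Suc i) <+>\<^bsub>M\<^esub> A \<subseteq> K i <+>\<^bsub>M\<^esub> A" by (rule set_add_mono[OF mono]) auto
  qed
  then obtain k where k: "\<And>i. i \<ge> k \<Longrightarrow> K i <+>\<^bsub>M\<^esub> A = K k <+>\<^bsub>M\<^esub> A" by blast
  have "K k \<subseteq> K i" if i: "i \<ge> k" for i
  proof (rule modular_subset[of _ _ A])
    show "K k \<inter> A \<subseteq> K i" using K by blast
    show "K k \<subseteq> K i <+>\<^bsub>M\<^esub> A"
      using k[of i] i set_add_upper1[OF K(1)[of k] A] by auto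
    show "K i \<subseteq> K k" by (rule mono) fact
  qed (use K submodule_subset[OF A] in auto)
  then show "\<exists>k. \<forall>i\<ge>k. K k \<subseteq> K i" by blast
qed

section \<open>Generated submodules\<close>

lemma span_submodule: "S \<subseteq> carrier M \<Longrightarrow> submodule (submodule_span R M S) R M"
  unfolding submodule_span_def using carrier_is_submodule
  by (intro submoduleI') (auto simp: submodule_zero submoduleE dest: submodule_carrier)

lemma span_superset: "S \<subseteq> submodule_span R M S"
  unfolding submodule_span_def by auto

lemma span_least: "\<lbrakk>submodule N R M; S \<subseteq> N\<rbrakk> \<Longrightarrow> submodule_span R M S \<subseteq> N"
  unfolding submodule_span_def by auto

lemma span_mono: "S \<subseteq> T \<Longrightarrow> submodule_span R M S \<subseteq> submodule_span R M T"
  unfolding submodule_span_def by auto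

lemma span_empty: "submodule_span R M {} = {\<zero>\<^bsub>M\<^esub>}"
  using span_least[OF zero_submodule, of "{}"] submodule_zero[OF span_submodule, of "{}"] by auto

lemma cyclic_submodule:
  "x \<in> carrier M \<Longrightarrow> submodule ((\<lambda>r. r \<odot>\<^bsub>M\<^esub> x) ` carrier R) R M"
  by (rule submoduleI')
    (auto simp: smult_l_distr[symmetric] smult_assoc1[symmetric] image_iff intro: bexI[of _ \<zero>])

lemma span_insert:
  assumes "x \<in> carrier M" "S \<subseteq> carrier M"
  shows "submodule_span R M (insert x S) =
    (\<lambda>r. r \<odot>\<^bsub>M\<^esub> x) ` carrier R <+>\<^bsub>M\<^esub> submodule_span R M S" (is "_ = ?C <+>\<^bsub>M\<^esub> ?S")
proof
  note C = cyclic_submodule[OF assms(1)] and S = span_submodule[OF assms(2)]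
  have "x \<in> ?C" using assms(1) by (auto intro!: image_eqI[of _ _ \<one>])
  then show "submodule_span R M (insert x S) \<subseteq> ?C <+>\<^bsub>M\<^esub> ?S"
    using set_add_upper1[OF C S] set_add_upper2[OF C S] span_superset[of S]
    by (intro span_least set_add_submodule C S) auto
  have I: "submodule (submodule_span R M (insert x S)) R M"
    by (rule span_submodule) (use assms in auto)
  show "?C <+>\<^bsub>M\<^esub> ?S \<subseteq> submodule_span R M (insert x S)"
    using span_superset[of "insert x S"] submoduleE(4)[OF I]
    by (intro set_add_least I span_mono) auto
qed

end

lemma (in linear_map) image_span_subset:
  assumes "S \<subseteq> carrier M"
  shows "f ` submodule_span R M S \<subseteq> submodule_span R N (f ` S)"
proof -
  have "submodule (submodule_span R N (f ` S)) R N"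
    by (rule N.span_submodule) (use assms in auto)
  from M.span_least[OF vimage_submodule[OF this], of S] N.span_superset[of "f ` S"] assms
  show ?thesis by auto
qed

section \<open>Minimax submodules\<close>

text \<open>Minimaxity of \<open>T\<close> expressed inside the ambient module;
  \<open>minimax_module_restrict_iff\<close> identifies it with \<open>minimax_module\<close> on the
  restricted carrier.\<close>

definition minimax_submodule ::
  "('r, 'z) ring_scheme \<Rightarrow> ('r, 'm) module \<Rightarrow> 'm set \<Rightarrow> bool" where
  "minimax_submodule R M T \<longleftrightarrow>
    (\<exists>S. finite S \<and> S \<subseteq> T \<and> dcc_between R M (submodule_span R M S) T)"

locale noetherian_cring = cring R + noetherian_ring R for R :: "('r, 'z) ring_scheme" (structure)

locale noetherian_rmodule = rmodule R M + noetherian_cring R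
  for R :: "('r, 'z) ring_scheme" (structure) and M :: "('r, 'm) module" (structure)

text \<open>Finitely generated modules over a Noetherian ring are Noetherian. In the inductive step
  \<open>K\<close> is controlled by its part in the span of \<open>S\<close> and by the ideal of
  coefficients that \<open>s\<close> takes in elements of \<open>K\<close>.\<close>

lemma (in noetherian_rmodule) submodule_of_span:
  assumes "finite S" "S \<subseteq> carrier M" "submodule K R M" "K \<subseteq> submodule_span R M S"
  shows "\<exists>S'. finite S' \<and> S' \<subseteq> carrier M \<and> submodule_span R M S' = K"
  using assms
proof (induction S arbitrary: K)
  case empty
  then have "K = {\<zero>\<^bsub>M\<^esub>}" using submodule_zero[of K] by (auto simp: span_empty)
  then show ?case using span_empty by (intro exI[of _ "{}"]) auto
next
  case (insert s S)
  let ?S = "submodule_span R M S"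
  have s: "s \<in> carrier M" and S: "S \<subseteq> carrier M" and K: "submodule K R M" using insert.prems by auto
  note sS = span_submodule[OF S]
  have Kc: "k \<in> carrier M" if "k \<in> K" for k using submodule_carrier[OF K that] .
  have Sc: "y \<in> carrier M" if "y \<in> ?S" for y using submodule_carrier[OF sS that] .
  obtain S1 where S1: "finite S1" "S1 \<subseteq> carrier M" "submodule_span R M S1 = K \<inter> ?S"
    using insert.IH[OF S inter_submodule[OF K sS]] by auto
  \<comment> \<open>Shown for every \<open>L\<close>, because the coefficient ideals of
    \<open>K\<close> and of the candidate \<open>?L\<close> are compared below.\<close>
  have idealI: "ideal {r \<in> carrier R. \<exists>y\<in>?S. r \<odot>\<^bsub>M\<^esub> s \<oplus>\<^bsub>M\<^esub> y \<in> L} R" (is "ideal ?I R")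
    if L: "submodule L R M" for L
  proof (rule idealI)
    show "ring R" by (rule R.ring_axioms)
    have smul: "x \<otimes> r \<in> ?I" if "r \<in> ?I" "x \<in> carrier R" for r x
    proof -
      obtain y where y: "y \<in> ?S" "r \<odot>\<^bsub>M\<^esub> s \<oplus>\<^bsub>M\<^esub> y \<in> L" and r: "r \<in> carrier R"
        using \<open>r \<in> ?I\<close> by auto
      have "x \<odot>\<^bsub>M\<^esub> (r \<odot>\<^bsub>M\<^esub> s \<oplus>\<^bsub>M\<^esub> y) = (x \<otimes> r) \<odot>\<^bsub>M\<^esub> s \<oplus>\<^bsub>M\<^esub> x \<odot>\<^bsub>M\<^esub> y"
        using s r y Sc that(2) by (simp add: smult_r_distr smult_assoc1)
      then have "(x \<otimes> r) \<odot>\<^bsub>M\<^esub> s \<oplus>\<^bsub>M\<^esub> x \<odot>\<^bsub>M\<^esub> y \<in> L"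
        using submoduleE(4)[OF L that(2) y(2)] by simp
      then show ?thesis using submoduleE(4)[OF sS that(2) y(1)] r that(2) by auto
    qed
    have add: "r \<oplus> r' \<in> ?I" if "r \<in> ?I" "r' \<in> ?I" for r r'
    proof -
      obtain y where y: "y \<in> ?S" "r \<odot>\<^bsub>M\<^esub> s \<oplus>\<^bsub>M\<^esub> y \<in> L" and r: "r \<in> carrier R"
        using \<open>r \<in> ?I\<close> by auto
      obtain y' where y': "y' \<in> ?S" "r' \<odot>\<^bsub>M\<^esub> s \<oplus>\<^bsub>M\<^esub> y' \<in> L" and r': "r' \<in> carrier R"
        using \<open>r' \<in> ?I\<close> by auto
      have "(r \<odot>\<^bsub>M\<^esub> s \<oplus>\<^bsub>M\<^esub> y) \<oplus>\<^bsub>M\<^esub> (r' \<odot>\<^bsub>M\<^esub> s \<oplus>\<^bsub>M\<^esub> y') = (r \<oplus> r') \<odot>\<^bsub>M\<^esub> s \<oplus>\<^bsub>M\<^esub> (y \<oplus>\<^bsub>M\<^esub> y')"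
        using s r r' y y' Sc by (simp add: smult_l_distr M.a_ac)
      then have "(r \<oplus> r') \<odot>\<^bsub>M\<^esub> s \<oplus>\<^bsub>M\<^esub> (y \<oplus>\<^bsub>M\<^esub> y') \<in> L"
        using submoduleE(5)[OF L y(2) y'(2)] by simp
      then show ?thesis using submoduleE(5)[OF sS y(1) y'(1)] r r' by auto
    qed
    have "\<zero> \<in> ?I" using submodule_zero[OF sS] submodule_zero[OF L] s
      by (auto intro!: bexI[of _ "\<zero>\<^bsub>M\<^esub>"])
    moreover have "\<ominus> r \<in> ?I" if "r \<in> ?I" for r
      using smul[OF that, of "\<ominus> \<one>"] that by (simp add: R.l_minus)
    ultimately show "subgroup ?I (add_monoid R)"
      using add by (intro R.add.subgroupI) (auto simp: a_inv_def)
    show "x \<otimes> r \<in> ?I" if "r \<in> ?I" "x \<in> carrier R" for r x by (rule smul) fact+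
    show "r \<otimes> x \<in> ?I" if "r \<in> ?I" "x \<in> carrier R" for r x
      using smul[OF that] that by (simp add: R.m_comm)
  qed
  let ?I = "\<lambda>L. {r \<in> carrier R. \<exists>y\<in>?S. r \<odot>\<^bsub>M\<^esub> s \<oplus>\<^bsub>M\<^esub> y \<in> L}"
  obtain A where A: "A \<subseteq> carrier R" "finite A" "?I K = Idl A"
    using finetely_gen[OF idealI[OF K]] by auto
  have "\<forall>r\<in>A. \<exists>y. y \<in> ?S \<and> r \<odot>\<^bsub>M\<^esub> s \<oplus>\<^bsub>M\<^esub> y \<in> K"
    using A(3) R.genideal_self[OF A(1)] by blast
  then obtain y where y: "\<And>r. r \<in> A \<Longrightarrow> y r \<in> ?S" "\<And>r. r \<in> A \<Longrightarrow> r \<odot>\<^bsub>M\<^esub> s \<oplus>\<^bsub>M\<^esub> y r \<in> K"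
    by metis
  \<comment> \<open>Generators of the coefficient ideal are lifted to elements of \<open>K\<close>
    and joined with generators of the part of \<open>K\<close> in \<open>?S\<close>.\<close>
  let ?S' = "(\<lambda>r. r \<odot>\<^bsub>M\<^esub> s \<oplus>\<^bsub>M\<^esub> y r) ` A \<union> S1"
  let ?L = "submodule_span R M ?S'"
  have S'K: "?S' \<subseteq> K" using y(2) span_superset[of S1] S1(3) by auto
  then have S'c: "?S' \<subseteq> carrier M" using submodule_subset[OF K] by auto
  note L = span_submodule[OF S'c]
  have LK: "?L \<subseteq> K" by (rule span_least[OF K S'K])
  have "A \<subseteq> ?I ?L"
  proof
    fix r assume r: "r \<in> A"
    then have "r \<odot>\<^bsub>M\<^esub> s \<oplus>\<^bsub>M\<^esub> y r \<in> ?L" using span_superset[of ?S'] by blast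
    then show "r \<in> ?I ?L" using y(1)[OF r] r A(1) by blast
  qed
  then have IKL: "?I K \<subseteq> ?I ?L" unfolding A(3) by (rule R.genideal_minimal[OF idealI[OF L]])
  have "K \<subseteq> ?L"
  proof
    fix k assume k: "k \<in> K"
    then obtain r z where rz: "r \<in> carrier R" "z \<in> ?S" "k = r \<odot>\<^bsub>M\<^esub> s \<oplus>\<^bsub>M\<^esub> z"
      using insert.prems(3) unfolding span_insert[OF s S] subset_iff mem_set_add by blast
    then have "r \<in> ?I K" using k by auto
    then have "r \<in> ?I ?L" using IKL by blast
    then obtain z' where z': "z' \<in> ?S" "r \<odot>\<^bsub>M\<^esub> s \<oplus>\<^bsub>M\<^esub> z' \<in> ?L" by auto
    let ?k' = "r \<odot>\<^bsub>M\<^esub> s \<oplus>\<^bsub>M\<^esub> z'"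
    have zc: "z \<in> carrier M" "z' \<in> carrier M" using rz z' Sc by auto
    \<comment> \<open>The multiples of \<open>s\<close> cancel, so the difference falls into
      \<open>K \<inter> ?S\<close>, which \<open>S1\<close> generates.\<close>
    have "k \<ominus>\<^bsub>M\<^esub> ?k' = z \<ominus>\<^bsub>M\<^esub> z'"
    proof -
      have "k \<ominus>\<^bsub>M\<^esub> ?k' = (r \<odot>\<^bsub>M\<^esub> s \<oplus>\<^bsub>M\<^esub> \<ominus>\<^bsub>M\<^esub> (r \<odot>\<^bsub>M\<^esub> s)) \<oplus>\<^bsub>M\<^esub> (z \<oplus>\<^bsub>M\<^esub> \<ominus>\<^bsub>M\<^esub> z')"
        unfolding rz(3) a_minus_def using zc rz(1) s
        by (simp add: M.minus_add M.a_ac del: M.r_neg)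
      then show ?thesis using zc rz(1) s by (simp add: M.r_neg a_minus_def)
    qed
    then have "k \<ominus>\<^bsub>M\<^esub> ?k' \<in> K \<inter> ?S"
      using submodule_diff[OF K k, of ?k'] submodule_diff[OF sS rz(2) z'(1)] subsetD[OF LK z'(2)]
      by simp
    then have d: "k \<ominus>\<^bsub>M\<^esub> ?k' \<in> ?L"
      using span_mono[of S1 ?S'] S1(3) by auto
    have "k = ?k' \<oplus>\<^bsub>M\<^esub> (k \<ominus>\<^bsub>M\<^esub> ?k')"
      using Kc[OF k] zc rz(1) s by (simp add: a_minus_def M.a_lcomm[of _ k] M.r_neg)
    then show "k \<in> ?L" using submoduleE(5)[OF L z'(2) d] by simp
  qed
  then show ?case using LK S'c A(2) S1(1) by (intro exI[of _ ?S']) auto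
qed

text \<open>The span of \<open>S\<close> meets \<open>T'\<close> in a submodule that is again
  finitely generated, because \<open>R\<close> is Noetherian; the interval above it is cut down to
  \<open>T'\<close>.\<close>

lemma (in noetherian_rmodule) minimax_submodule_subset:
  assumes T: "submodule T R M" and T': "submodule T' R M" "T' \<subseteq> T"
    and "minimax_submodule R M T"
  shows "minimax_submodule R M T'"
proof -
  obtain S where S: "finite S" "S \<subseteq> T" and dcc: "dcc_between R M (submodule_span R M S) T"
    using assms unfolding minimax_submodule_def by blast
  have Sc: "S \<subseteq> carrier M" using S(2) submodule_subset[OF T] by simp
  note sS = span_submodule[OF Sc]
  obtain S' where S': "finite S'" "S' \<subseteq> carrier M"
    "submodule_span R M S' = submodule_span R M S \<inter> T'"
    using submodule_of_span[OF S(1) Sc inter_submodule[OF sS T'(1)]] by auto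
  have "dcc_between R M (submodule_span R M S \<inter> T') (T \<inter> T')"
    by (rule dcc_between_inter[OF sS T T'(1) span_least[OF T S(2)] dcc])
  moreover have "T \<inter> T' = T'" using T'(2) by auto
  moreover have "S' \<subseteq> T'" using span_superset[of S'] S'(3) by auto
  ultimately show ?thesis using S' unfolding minimax_submodule_def by auto
qed

lemma (in linear_map) minimax_submodule_image:
  assumes T: "submodule T R M" and "minimax_submodule R M T"
  shows "minimax_submodule R N (f ` T)"
proof -
  obtain S where S: "finite S" "S \<subseteq> T" and dcc: "dcc_between R M (submodule_span R M S) T"
    using assms unfolding minimax_submodule_def by blast
  have Sc: "S \<subseteq> carrier M" using S(2) M.submodule_subset[OF T] by simp
  have "dcc_between R N (f ` submodule_span R M S) (f ` T)"
    by (rule dcc_between_image[OF T M.span_least[OF T S(2)] dcc])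
  then have "dcc_between R N (submodule_span R N (f ` S)) (f ` T)"
    by (rule dcc_between_mono[OF _ image_span_subset[OF Sc]]) simp
  then show ?thesis using S unfolding minimax_submodule_def by blast
qed

text \<open>Generators for the kernel part are joined with preimages of generators for the
  image.\<close>

lemma (in linear_map) minimax_submodule_extension:
  assumes T: "submodule T R M"
    and ker: "minimax_submodule R M (T \<inter> {x \<in> carrier M. f x = \<zero>\<^bsub>N\<^esub>})"
    and im: "minimax_submodule R N (f ` T)"
  shows "minimax_submodule R M T"
proof -
  let ?Z = "{x \<in> carrier M. f x = \<zero>\<^bsub>N\<^esub>}"
  obtain S where S: "finite S" "S \<subseteq> T \<inter> ?Z"
    and dS: "dcc_between R M (submodule_span R M S) (T \<inter> ?Z)"
    using ker unfolding minimax_submodule_def by blast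
  obtain C where C: "finite C" "C \<subseteq> f ` T"
    and dC: "dcc_between R N (submodule_span R N C) (f ` T)"
    using im unfolding minimax_submodule_def by blast
  obtain S' where S': "finite S'" "S' \<subseteq> T" "C = f ` S'"
    using finite_subset_image[OF C] by blast
  have sub: "S \<union> S' \<subseteq> T" using S S' by auto
  then have c: "S \<union> S' \<subseteq> carrier M" using M.submodule_subset[OF T] by auto
  note sp = M.span_submodule[OF c]
  have "dcc_between R M (submodule_span R M (S \<union> S')) T"
  proof (rule dcc_between_extension[OF T _ _ _ dS dC])
    show "submodule_span R M S \<subseteq> submodule_span R M (S \<union> S')" by (rule M.span_mono) simp
    show "submodule_span R N C \<subseteq> f ` submodule_span R M (S \<union> S')"
      using M.span_superset[of "S \<union> S'"] S'(3)
      by (intro N.span_least image_submodule sp) auto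
    show "submodule_span R M S \<subseteq> ?Z"
      by (rule M.span_least[OF kernel_submodule]) (use S(2) in auto)
  qed
  then show ?thesis using sub S S' unfolding minimax_submodule_def
    by (intro exI[of _ "S \<union> S'"]) auto
qed

section \<open>Restricted carriers, coset modules and the agreement of the two notions of
  minimax\<close>

lemma module_restrict: "\<lbrakk>module R M; submodule T R M\<rbrakk> \<Longrightarrow> module R (M\<lparr>carrier := T\<rparr>)"
  by (rule submodule.submodule_is_module)

lemma submodule_restrict_iff:
  fixes M :: "('r, 'm) module"
  assumes "module R M" "submodule T R M"
  shows "submodule K R (M\<lparr>carrier := T\<rparr>) \<longleftrightarrow> submodule K R M \<and> K \<subseteq> T"
proof -
  interpret M: rmodule R M using assms(1) by (simp add: rmodule_def)
  interpret MT: rmodule R "M\<lparr>carrier := T\<rparr>"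
    using module_restrict[OF assms] by (simp add: rmodule_def)
  show ?thesis
  proof
    assume K: "submodule K R (M\<lparr>carrier := T\<rparr>)"
    have "submodule K R M"
      using MT.submodule_subset[OF K] MT.submodule_zero[OF K] MT.submoduleE(4,5)[OF K]
        M.submodule_subset[OF assms(2)]
      by (intro M.submoduleI') auto
    then show "submodule K R M \<and> K \<subseteq> T" using MT.submodule_subset[OF K] by simp
  next
    assume "submodule K R M \<and> K \<subseteq> T"
    then have K: "submodule K R M" "K \<subseteq> T" by auto
    then show "submodule K R (M\<lparr>carrier := T\<rparr>)"
      using M.submodule_zero[OF K(1)] M.submoduleE(4,5)[OF K(1)]
      by (intro MT.submoduleI') auto
  qed
qed

lemma span_restrict:
  fixes M :: "('r, 'm) module"
  assumes "module R M" "submodule T R M" "S \<subseteq> T"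
  shows "submodule_span R (M\<lparr>carrier := T\<rparr>) S = submodule_span R M S"
proof -
  interpret M: rmodule R M using assms(1) by (simp add: rmodule_def)
  have sp: "submodule (submodule_span R M S) R M"
    by (rule M.span_submodule) (use assms M.submodule_subset in blast)
  have "submodule_span R M S \<subseteq> T" by (rule M.span_least[OF assms(2,3)])
  then show ?thesis
    using sp M.span_superset[of S]
    unfolding submodule_span_def submodule_restrict_iff[OF assms(1,2)] by blast
qed

lemma minimax_submodule_restrict:
  fixes M :: "('r, 'm) module"
  assumes "module R M" "submodule T R M"
  shows "minimax_submodule R (M\<lparr>carrier := T\<rparr>) T \<longleftrightarrow> minimax_submodule R M T"
proof -
  have "dcc_between R (M\<lparr>carrier := T\<rparr>) A T \<longleftrightarrow> dcc_between R M A T" for A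
    unfolding dcc_between_def submodule_restrict_iff[OF assms] by auto
  then show ?thesis
    unfolding minimax_submodule_def using span_restrict[OF assms] by auto
qed

lemma (in rmodule) quot_module_linear_map:
  assumes N: "submodule N R M"
  shows "linear_map R M (quot_module M N) (\<lambda>x. N +>\<^bsub>M\<^esub> x)"
    and "module_ker M (quot_module M N) (\<lambda>x. N +>\<^bsub>M\<^esub> x) = N"
    and "(\<lambda>x. N +>\<^bsub>M\<^esub> x) ` carrier M = carrier (quot_module M N)"
proof -
  let ?Q = "quot_module M N"
  interpret N: abelian_subgroup N M
    by (rule abelian_subgroupI3[OF _ M.abelian_group_axioms])
      (rule additive_subgroupI[OF submodule.axioms(1)[OF N]])
  note Nc = submodule_carrier[OF N]
  have car: "carrier ?Q = (\<lambda>x. N +>\<^bsub>M\<^esub> x) ` carrier M"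
    by (auto simp: quot_module_def A_RCOSETS_def')
  have add: "(N +>\<^bsub>M\<^esub> x) \<oplus>\<^bsub>?Q\<^esub> (N +>\<^bsub>M\<^esub> y) = N +>\<^bsub>M\<^esub> (x \<oplus>\<^bsub>M\<^esub> y)"
    if "x \<in> carrier M" "y \<in> carrier M" for x y
    using N.a_rcos_sum[OF that] by (simp add: quot_module_def)
  have coset_eq: "N +>\<^bsub>M\<^esub> x = N +>\<^bsub>M\<^esub> y" if "x \<in> N +>\<^bsub>M\<^esub> y" "y \<in> carrier M" for x y
    using M.a_repr_independence[OF that] submodule.axioms(1)[OF N] by simp
  have self: "x \<in> N +>\<^bsub>M\<^esub> x" if "x \<in> carrier M" for x by (rule N.a_rcos_self[OF that])
  have smul: "r \<odot>\<^bsub>?Q\<^esub> (N +>\<^bsub>M\<^esub> x) = N +>\<^bsub>M\<^esub> (r \<odot>\<^bsub>M\<^esub> x)"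
    if "r \<in> carrier R" "x \<in> carrier M" for r x
  proof -
    \<comment> \<open>Scalar multiplication of cosets is a union over all representatives
      \<open>y\<close>; every term of that union is the same coset.\<close>
    have "N +>\<^bsub>M\<^esub> (r \<odot>\<^bsub>M\<^esub> y) = N +>\<^bsub>M\<^esub> (r \<odot>\<^bsub>M\<^esub> x)" if y: "y \<in> N +>\<^bsub>M\<^esub> x" for y
    proof (rule coset_eq)
      obtain n where "n \<in> N" "y = n \<oplus>\<^bsub>M\<^esub> x" using y by (auto simp: a_r_coset_def')
      then have "r \<odot>\<^bsub>M\<^esub> y = r \<odot>\<^bsub>M\<^esub> n \<oplus>\<^bsub>M\<^esub> r \<odot>\<^bsub>M\<^esub> x" "r \<odot>\<^bsub>M\<^esub> n \<in> N"
        using \<open>r \<in> carrier R\<close> \<open>x \<in> carrier M\<close> Nc submoduleE(4)[OF N]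
        by (auto simp: smult_r_distr)
      then show "r \<odot>\<^bsub>M\<^esub> y \<in> N +>\<^bsub>M\<^esub> (r \<odot>\<^bsub>M\<^esub> x)" by (auto simp: a_r_coset_def')
    qed (use \<open>r \<in> carrier R\<close> \<open>x \<in> carrier M\<close> in auto)
    then have "(\<lambda>y. N +>\<^bsub>M\<^esub> (r \<odot>\<^bsub>M\<^esub> y)) ` (N +>\<^bsub>M\<^esub> x) = {N +>\<^bsub>M\<^esub> (r \<odot>\<^bsub>M\<^esub> x)}"
      using self[OF that(2)] by blast
    then show ?thesis by (simp add: quot_module_def)
  qed
  have zero: "\<zero>\<^bsub>?Q\<^esub> = N +>\<^bsub>M\<^esub> \<zero>\<^bsub>M\<^esub>"
    using submodule_subset[OF N] by (simp add: quot_module_def)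
  have "abelian_group ?Q"
  proof (rule abelian_groupI)
    fix X assume "X \<in> carrier ?Q"
    then obtain x where "x \<in> carrier M" "X = N +>\<^bsub>M\<^esub> x" using car by auto
    then show "\<exists>Y\<in>carrier ?Q. Y \<oplus>\<^bsub>?Q\<^esub> X = \<zero>\<^bsub>?Q\<^esub>"
      using car zero by (auto intro!: bexI[of _ "\<ominus>\<^bsub>M\<^esub> x"] simp: add M.l_neg)
  qed (auto simp: car zero add M.a_ac)
  then have Q: "module R ?Q"
    by (intro moduleI R.cring_axioms)
      (auto simp: car add smul smult_l_distr smult_r_distr smult_assoc1)
  show "linear_map R M ?Q (\<lambda>x. N +>\<^bsub>M\<^esub> x)"
    using Q rmodule_axioms
    by (intro linear_map.intro linear_map_axioms.intro) (auto simp: rmodule_def car add smul)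
  have N0: "N +>\<^bsub>M\<^esub> \<zero>\<^bsub>M\<^esub> = N" by (rule M.a_coset_add_zero[OF submodule_subset[OF N]])
  have iff: "N +>\<^bsub>M\<^esub> x = N \<longleftrightarrow> x \<in> N" if "x \<in> carrier M" for x
    using self[OF that] coset_eq[of x "\<zero>\<^bsub>M\<^esub>"] unfolding N0 by auto
  have "module_ker M ?Q (\<lambda>x. N +>\<^bsub>M\<^esub> x) = {x \<in> carrier M. N +>\<^bsub>M\<^esub> x = N}"
    by (simp add: module_ker_def quot_module_def)
  also have "\<dots> = {x \<in> carrier M. x \<in> N}"
    using iff by (intro Collect_cong conj_cong refl)
  also have "\<dots> = N" using Nc by blast
  finally show "module_ker M ?Q (\<lambda>x. N +>\<^bsub>M\<^esub> x) = N" .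
  show "(\<lambda>x. N +>\<^bsub>M\<^esub> x) ` carrier M = carrier ?Q" using car by simp
qed

lemma (in rmodule) artinian_quot_module_iff:
  assumes N: "submodule N R M"
  shows "artinian_module R (quot_module M N) \<longleftrightarrow> dcc_between R M N (carrier M)"
proof -
  let ?Q = "quot_module M N"
  let ?p = "\<lambda>x. N +>\<^bsub>M\<^esub> x"
  interpret p: linear_map R M ?Q ?p by (rule quot_module_linear_map[OF N])
  have ker: "{x \<in> carrier M. ?p x = \<zero>\<^bsub>?Q\<^esub>} = N"
    using quot_module_linear_map(2)[OF N] by (simp add: module_ker_def)
  have im: "?p ` carrier M = carrier ?Q" by (rule quot_module_linear_map(3)[OF N])
  have art: "artinian_module R ?Q \<longleftrightarrow> dcc_between R ?Q {\<zero>\<^bsub>?Q\<^esub>} (carrier ?Q)"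
    unfolding artinian_module_def dcc_between_def
    using p.N.submodule_zero p.N.submodule_subset by (metis empty_subsetI insert_subset)
  have pN: "?p ` N = {\<zero>\<^bsub>?Q\<^esub>}"
    using ker submodule_zero[OF N] by (auto simp: image_iff)
  show ?thesis
  proof
    assume "artinian_module R ?Q"
    then have Q: "dcc_between R ?Q {\<zero>\<^bsub>?Q\<^esub>} (?p ` carrier M)" unfolding art im .
    \<comment> \<open>The part of the interval inside the kernel is the single point
      \<open>N\<close>, so everything comes from the chain condition in the quotient.\<close>
    have "carrier M \<inter> {x \<in> carrier M. ?p x = \<zero>\<^bsub>?Q\<^esub>} = N"
      using ker submodule_subset[OF N] by blast
    then have "dcc_between R M N (carrier M \<inter> {x \<in> carrier M. ?p x = \<zero>\<^bsub>?Q\<^esub>})"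
      using dcc_between_refl[of R M N] by simp
    from p.dcc_between_extension[OF carrier_is_submodule order_refl _ _ this Q]
    show "dcc_between R M N (carrier M)" by (simp add: pN ker)
  next
    assume "dcc_between R M N (carrier M)"
    from p.dcc_between_image[OF carrier_is_submodule submodule_subset[OF N] this]
    show "artinian_module R ?Q" unfolding art pN im .
  qed
qed

lemma (in rmodule) minimax_module_iff: "minimax_module R M \<longleftrightarrow> minimax_submodule R M (carrier M)"
proof
  assume "minimax_module R M"
  then obtain N S where N: "submodule N R M" "dcc_between R M N (carrier M)"
    and S: "finite S" "S \<subseteq> N" "submodule_span R (M\<lparr>carrier := N\<rparr>) S = N"
    unfolding minimax_module_def fin_gen_module_def using artinian_quot_module_iff by auto
  have "submodule_span R M S = N" using S span_restrict[OF module_axioms N(1) S(2)] by simp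
  then show "minimax_submodule R M (carrier M)"
    using N S submodule_subset[OF N(1)] unfolding minimax_submodule_def by blast
next
  assume "minimax_submodule R M (carrier M)"
  then obtain S where S: "finite S" "S \<subseteq> carrier M" "dcc_between R M (submodule_span R M S) (carrier M)"
    unfolding minimax_submodule_def by auto
  let ?N = "submodule_span R M S"
  note N = span_submodule[OF S(2)]
  show "minimax_module R M"
    unfolding minimax_module_def fin_gen_module_def
    using N S artinian_quot_module_iff[OF N] span_restrict[OF module_axioms N span_superset] span_superset
    by (intro exI[of _ ?N]) (auto intro!: exI[of _ S])
qed

lemma (in rmodule) minimax_module_restrict_iff:
  assumes T: "submodule T R M"
  shows "minimax_module R (M\<lparr>carrier := T\<rparr>) \<longleftrightarrow> minimax_submodule R M T"
proof -
  interpret T: rmodule R "M\<lparr>carrier := T\<rparr>"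
    using module_restrict[OF module_axioms T] by (simp add: rmodule_def)
  show ?thesis using T.minimax_module_iff minimax_submodule_restrict[OF module_axioms T] by simp
qed

section \<open>Dimension one\<close>

context noetherian_cring
begin

text \<open>Zorn's lemma: in a Noetherian ring the union of a nonempty chain of ideals belongs to
  the chain and hence to \<open>F\<close>.\<close>

lemma exists_maximal_ideal_in:
  assumes "F \<noteq> {}" "\<And>I. I \<in> F \<Longrightarrow> ideal I R"
  shows "\<exists>I\<in>F. \<forall>J\<in>F. I \<subseteq> J \<longrightarrow> J = I"
proof (rule subset_Zorn)
  fix C assume C: "subset.chain F C"
  show "\<exists>U\<in>F. \<forall>X\<in>C. X \<subseteq> U"
  proof (cases "C = {}")
    case False
    have "subset.chain {I. ideal I R} C" using C assms(2) by (auto simp: subset.chain_def)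
    then have "\<Union>C \<in> C" by (rule ideal_chain_is_trivial[OF False])
    then show ?thesis using C by (auto simp: subset.chain_def)
  qed (use assms(1) in auto)
qed

lemma add_ideal_subset:
  assumes "ideal I R" "u \<in> carrier R"
  shows "ideal (I <+>\<^bsub>R\<^esub> PIdl u) R" "I \<subseteq> I <+>\<^bsub>R\<^esub> PIdl u" "u \<in> I <+>\<^bsub>R\<^esub> PIdl u"
proof -
  note J = cgenideal_ideal[OF assms(2)]
  have z: "\<zero> \<in> I" "\<zero> \<in> PIdl u"
    using additive_subgroup.zero_closed ideal.axioms(1) assms(1) J by blast+
  have c: "I \<subseteq> carrier R" using assms(1) by (simp add: ideal.axioms(1) additive_subgroup.a_subset)
  show "ideal (I <+>\<^bsub>R\<^esub> PIdl u) R" by (rule add_ideals[OF assms(1) J])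
  show "I \<subseteq> I <+>\<^bsub>R\<^esub> PIdl u"
  proof
    fix i assume "i \<in> I"
    then have "i = i \<oplus> \<zero>" using c by auto
    then show "i \<in> I <+>\<^bsub>R\<^esub> PIdl u" using \<open>i \<in> I\<close> z(2) unfolding set_add_def' by auto
  qed
  have "u = \<zero> \<oplus> u" using assms(2) by simp
  then show "u \<in> I <+>\<^bsub>R\<^esub> PIdl u"
    using z(1) cgenideal_self[OF assms(2)] unfolding set_add_def' by auto
qed

lemma mem_add_PIdl: "x \<in> I <+>\<^bsub>R\<^esub> PIdl u \<longleftrightarrow> (\<exists>i\<in>I. \<exists>r\<in>carrier R. x = i \<oplus> r \<otimes> u)"
  unfolding set_add_def' cgenideal_def by blast

text \<open>An ideal maximal among those over \<open>J\<close> and disjoint from \<open>S\<close> is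
  prime: if \<open>a\<close> and \<open>b\<close> lie outside it, the enlargements by
  \<open>a\<close> and by \<open>b\<close> both meet \<open>S\<close>, and for \<open>a b\<close> in
  the ideal the product of the two common elements would lie in the ideal and in
  \<open>S\<close>.\<close>

lemma exists_prime_avoiding:
  assumes J: "ideal J R" and S: "S \<subseteq> carrier R" "\<one> \<in> S" "\<And>s t. \<lbrakk>s \<in> S; t \<in> S\<rbrakk> \<Longrightarrow> s \<otimes> t \<in> S"
    and "J \<inter> S = {}"
  shows "\<exists>Q. primeideal Q R \<and> J \<subseteq> Q \<and> Q \<inter> S = {}"
proof -
  let ?F = "{I. ideal I R \<and> J \<subseteq> I \<and> I \<inter> S = {}}"
  have "?F \<noteq> {}" using J assms(5) by blast
  then obtain I where IF: "I \<in> ?F" and IFmax: "\<forall>I'\<in>?F. I \<subseteq> I' \<longrightarrow> I' = I"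
    using exists_maximal_ideal_in[of ?F] by blast
  have I: "ideal I R" "J \<subseteq> I" "I \<inter> S = {}" using IF by auto
  have max: "I' = I" if "ideal I' R" "I \<subseteq> I'" "I' \<inter> S = {}" for I'
    using IFmax that I(2) by simp
  interpret I: ideal I R by (rule I(1))
  have "primeideal I R"
  proof (rule primeidealI[OF I(1) cring_axioms])
    show "carrier R \<noteq> I" using I(3) S(2) one_closed by blast
    fix a b assume ab: "a \<in> carrier R" "b \<in> carrier R" "a \<otimes> b \<in> I"
    show "a \<in> I \<or> b \<in> I"
    proof (rule ccontr)
      assume neg: "\<not> (a \<in> I \<or> b \<in> I)"
      have "(I <+>\<^bsub>R\<^esub> PIdl u) \<inter> S \<noteq> {}" if "u \<in> {a, b}" for u
      proof (rule notI)
        assume "(I <+>\<^bsub>R\<^esub> PIdl u) \<inter> S = {}"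
        moreover have u: "u \<in> carrier R" "u \<notin> I" using that ab neg by auto
        ultimately have "I <+>\<^bsub>R\<^esub> PIdl u = I" by (intro max add_ideal_subset[OF I(1)])
        then show False using add_ideal_subset(3)[OF I(1) u(1)] u(2) by simp
      qed
      then obtain s t where "s \<in> S" "s \<in> I <+>\<^bsub>R\<^esub> PIdl a" "t \<in> S" "t \<in> I <+>\<^bsub>R\<^esub> PIdl b"
        by blast
      then obtain i r j q where st: "s \<in> S" "t \<in> S" "i \<in> I" "j \<in> I" "r \<in> carrier R" "q \<in> carrier R"
        "s = i \<oplus> r \<otimes> a" "t = j \<oplus> q \<otimes> b" unfolding mem_add_PIdl by blast
      have c: "i \<in> carrier R" "j \<in> carrier R" "t \<in> carrier R" using st S by auto
      have "s \<otimes> t = i \<otimes> t \<oplus> (r \<otimes> a) \<otimes> t" using st c ab by (simp add: l_distr)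
      also have "(r \<otimes> a) \<otimes> t = (r \<otimes> a) \<otimes> j \<oplus> (r \<otimes> q) \<otimes> (a \<otimes> b)"
        using st c ab by (simp add: r_distr m_ac)
      finally have "s \<otimes> t = i \<otimes> t \<oplus> ((r \<otimes> a) \<otimes> j \<oplus> (r \<otimes> q) \<otimes> (a \<otimes> b))" .
      then have "s \<otimes> t \<in> I"
        using st c ab I.I_l_closed I.I_r_closed I.a_closed by simp
      then show False using I(3) S(3)[OF st(1,2)] by auto
    qed
  qed
  then show ?thesis using I by blast
qed

lemma annihilator_ideal: "y \<in> carrier R \<Longrightarrow> ideal {r \<in> carrier R. r \<otimes> y = \<zero>} R"
proof (rule idealI)
  assume y: "y \<in> carrier R"
  have "\<ominus> a \<otimes> y = \<zero>" if "a \<in> carrier R" "a \<otimes> y = \<zero>" for a using that y by (simp add: l_minus)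
  then show "subgroup {r \<in> carrier R. r \<otimes> y = \<zero>} (add_monoid R)"
    using y by (intro add.subgroupI) (auto simp: l_distr a_inv_def[symmetric])
  fix a x assume a: "a \<in> {r \<in> carrier R. r \<otimes> y = \<zero>}" "x \<in> carrier R"
  then show "x \<otimes> a \<in> {r \<in> carrier R. r \<otimes> y = \<zero>}" using y by (simp add: m_assoc)
  then show "a \<otimes> x \<in> {r \<in> carrier R. r \<otimes> y = \<zero>}" using a by (simp add: m_comm)
qed (rule ring_axioms)

lemma primeideal_one_notin: "primeideal P R \<Longrightarrow> \<one> \<notin> P"
  using ideal.one_imp_carrier primeideal.I_notcarr primeideal.axioms(1) by blast

text \<open>Here \<open>n\<close> is so large that \<open>ann (x ^ n)\<close> is the kernel of \<open>R \<rightarrow> R\<^sub>x\<close>. A prime containing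
  it and \<open>x\<close> is not minimal, since its localization has a prime avoiding \<open>x\<close>.\<close>

lemma prime_over_annihilator_maximal:
  assumes dim: "krull_dim R \<le> 1" and x: "x \<in> carrier R"
    and stable: "\<And>k r. \<lbrakk>r \<in> carrier R; r \<otimes> x [^] (k::nat) = \<zero>\<rbrakk> \<Longrightarrow> r \<otimes> x [^] (n::nat) = \<zero>"
    and P: "primeideal P R" "x \<in> P" "{r \<in> carrier R. r \<otimes> x [^] n = \<zero>} \<subseteq> P"
    and J: "ideal J R" "P \<subseteq> J" "J \<noteq> P"
  shows "J = carrier R"
proof (rule ccontr)
  assume ne: "J \<noteq> carrier R"
  interpret P: primeideal P R by (rule P(1))
  have "J \<inter> {\<one>} = {}" using ne ideal.one_imp_carrier[OF J(1)] by auto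
  then obtain Q where Q: "primeideal Q R" "J \<subseteq> Q"
    using exists_prime_avoiding[OF J(1), of "{\<one>}"] by auto
  \<comment> \<open>A prime avoiding this set lies inside \<open>P\<close> and misses
    \<open>x\<close>: the elements with \<open>k = 0\<close> form the complement of
    \<open>P\<close>, and \<open>x\<close> itself arises from \<open>s = 1\<close>,
    \<open>k = 1\<close>.\<close>
  let ?S = "{s \<otimes> x [^] (k::nat) | s k. s \<in> carrier R - P}"
  have "\<exists>P'. primeideal P' R \<and> {\<zero>} \<subseteq> P' \<and> P' \<inter> ?S = {}"
  proof (rule exists_prime_avoiding)
    show "ideal {\<zero>} R" by (rule zeroideal)
    show "?S \<subseteq> carrier R" using x by auto
    have one: "\<one> \<notin> P" by (rule primeideal_one_notin[OF P(1)])
    then show "\<one> \<in> ?S" using x by (auto intro!: exI[of _ \<one>] exI[of _ 0])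
    fix s t assume "s \<in> ?S" "t \<in> ?S"
    then obtain u k v l where uv: "u \<in> carrier R - P" "v \<in> carrier R - P"
      "s = u \<otimes> x [^] (k::nat)" "t = v \<otimes> x [^] (l::nat)" by blast
    then have "u \<otimes> v \<in> carrier R - P" using P.I_prime by auto
    moreover have "s \<otimes> t = (u \<otimes> v) \<otimes> x [^] (k + l)"
      using uv x by (simp add: nat_pow_mult[symmetric] m_ac)
    ultimately show "s \<otimes> t \<in> ?S" by blast
  next
    \<comment> \<open>If \<open>s x ^ k = 0\<close>, stability gives \<open>s x ^ n = 0\<close>,
      which forces \<open>s\<close> into \<open>P\<close>.\<close>
    show "{\<zero>} \<inter> ?S = {}" using stable P(3) by force
  qed
  then obtain P' where P': "primeideal P' R" "P' \<inter> ?S = {}" by blast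
  have P'c: "P' \<subseteq> carrier R"
    using P'(1) by (simp add: primeideal.axioms(1) ideal.axioms(1) additive_subgroup.a_subset)
  have "s \<in> ?S" if "s \<in> carrier R" "s \<notin> P" for s
    using that by (auto intro!: exI[of _ s] exI[of _ 0])
  then have "P' \<subseteq> P" using P'(2) P'c by blast
  moreover have "x \<in> ?S"
    using x primeideal_one_notin[OF P(1)] by (auto intro!: exI[of _ \<one>] exI[of _ 1])
  then have "x \<notin> P'" using P'(2) by blast
  ultimately have P'P: "P' \<subset> P" using P(2) by blast
  have PQ: "P \<subset> Q" using J Q by blast
  \<comment> \<open>Three primes, two strict inclusions: a chain of length 2 in the sense of
    \<open>krull_dim\<close>.\<close>
  let ?C = "\<lambda>i::nat. if i = 0 then P' else if i = 1 then P else Q"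
  have "\<forall>i\<le>2. primeideal (?C i) R" "\<forall>i<2. ?C i \<subset> ?C (Suc i)"
    using P(1) P'(1) Q(1) P'P PQ by (auto simp: less_2_cases_iff)
  then have "enat 2 \<le> krull_dim R" 
    unfolding krull_dim_def by (intro Sup_upper CollectI exI[of _ 2] exI[of _ ?C] conjI refl)
  then have "enat 2 \<le> 1" using dim by (rule order_trans)
  then show False by (simp add: one_enat_def)
qed

end

section \<open>Supports, annihilated submodules and principal torsion\<close>

context rmodule
begin

lemma smult_linear_map: "r \<in> carrier R \<Longrightarrow> linear_map R M M (\<lambda>m. r \<odot>\<^bsub>M\<^esub> m)"
  by (intro linear_map.intro linear_map_axioms.intro rmodule_axioms)
    (auto simp: smult_r_distr smult_assoc1[symmetric] m_comm)

lemma annihilator_of_element_ideal: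
  "m \<in> carrier M \<Longrightarrow> ideal {r \<in> carrier R. r \<odot>\<^bsub>M\<^esub> m = \<zero>\<^bsub>M\<^esub>} R"
proof (rule idealI)
  assume m: "m \<in> carrier M"
  show "subgroup {r \<in> carrier R. r \<odot>\<^bsub>M\<^esub> m = \<zero>\<^bsub>M\<^esub>} (add_monoid R)"
    using m by (intro R.add.subgroupI)
      (auto simp: smult_l_distr smult_l_minus a_inv_def[symmetric] intro!: exI[of _ \<zero>])
  fix a x assume a: "a \<in> {r \<in> carrier R. r \<odot>\<^bsub>M\<^esub> m = \<zero>\<^bsub>M\<^esub>}" "x \<in> carrier R"
  then show "x \<otimes> a \<in> {r \<in> carrier R. r \<odot>\<^bsub>M\<^esub> m = \<zero>\<^bsub>M\<^esub>}" using m by (simp add: smult_assoc1)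
  then show "a \<otimes> x \<in> {r \<in> carrier R. r \<odot>\<^bsub>M\<^esub> m = \<zero>\<^bsub>M\<^esub>}" using a by (simp add: m_comm)
qed (rule R.ring_axioms)

text \<open>A localization vanishes iff all fractions \<open>m / 1\<close> do. With this criterion
  no later argument on supports has to handle classes of fractions.\<close>

lemma module_supp_iff:
  "P \<in> module_supp R M \<longleftrightarrow>
    primeideal P R \<and> (\<exists>m\<in>carrier M. \<forall>s\<in>carrier R - P. s \<odot>\<^bsub>M\<^esub> m \<noteq> \<zero>\<^bsub>M\<^esub>)"
proof (cases "primeideal P R")
  case True
  interpret P: primeideal P R by (rule True)
  let ?S = "carrier R - P"
  let ?r = "fraction_rel ?S M"
  let ?L = "localized_module R ?S M"
  have one: "\<one> \<in> ?S" using P.I_notcarr P.one_imp_carrier by auto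
  have mult: "s \<otimes> t \<in> ?S" if "s \<in> ?S" "t \<in> ?S" for s t using that P.I_prime by auto
  have carL: "carrier ?L = (carrier M \<times> ?S) // ?r" and zL: "\<zero>\<^bsub>?L\<^esub> = ?r `` {(\<zero>\<^bsub>M\<^esub>, \<one>)}"
    by (auto simp: localized_module_def)
  have "carrier ?L = {\<zero>\<^bsub>?L\<^esub>} \<longleftrightarrow> (\<forall>m\<in>carrier M. \<exists>s\<in>?S. s \<odot>\<^bsub>M\<^esub> m = \<zero>\<^bsub>M\<^esub>)"
  proof
    assume eq: "carrier ?L = {\<zero>\<^bsub>?L\<^esub>}"
    show "\<forall>m\<in>carrier M. \<exists>s\<in>?S. s \<odot>\<^bsub>M\<^esub> m = \<zero>\<^bsub>M\<^esub>"
    proof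
      fix m assume m: "m \<in> carrier M"
      then have "?r `` {(m, \<one>)} \<in> carrier ?L" unfolding carL using one by (auto intro: quotientI)
      then have "?r `` {(m, \<one>)} = ?r `` {(\<zero>\<^bsub>M\<^esub>, \<one>)}" using eq zL by simp
      moreover have "(m, \<one>) \<in> ?r `` {(m, \<one>)}" using m one unfolding fraction_rel_def by auto
      ultimately have "((\<zero>\<^bsub>M\<^esub>, \<one>), (m, \<one>)) \<in> ?r" by auto
      then obtain u where "u \<in> ?S" "u \<odot>\<^bsub>M\<^esub> (\<one> \<odot>\<^bsub>M\<^esub> \<zero>\<^bsub>M\<^esub>) = u \<odot>\<^bsub>M\<^esub> (\<one> \<odot>\<^bsub>M\<^esub> m)"
        unfolding fraction_rel_def by auto
      then show "\<exists>s\<in>?S. s \<odot>\<^bsub>M\<^esub> m = \<zero>\<^bsub>M\<^esub>" using m by (auto intro!: bexI[of _ u])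
    qed
  next
    assume tor: "\<forall>m\<in>carrier M. \<exists>s\<in>?S. s \<odot>\<^bsub>M\<^esub> m = \<zero>\<^bsub>M\<^esub>"
    \<comment> \<open>Every numerator is killed by some element outside \<open>P\<close>, so any two
      fractions are equivalent and only one class remains.\<close>
    have rel: "((m, s), (n, t)) \<in> ?r" if "m \<in> carrier M" "n \<in> carrier M" "s \<in> ?S" "t \<in> ?S" for m n s t
    proof -
      obtain u where u: "u \<in> ?S" "u \<odot>\<^bsub>M\<^esub> (t \<odot>\<^bsub>M\<^esub> m) = \<zero>\<^bsub>M\<^esub>" using tor \<open>t \<in> ?S\<close> \<open>m \<in> carrier M\<close> by auto
      obtain v where v: "v \<in> ?S" "v \<odot>\<^bsub>M\<^esub> (s \<odot>\<^bsub>M\<^esub> n) = \<zero>\<^bsub>M\<^esub>" using tor \<open>s \<in> ?S\<close> \<open>n \<in> carrier M\<close> by auto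
      have "(u \<otimes> v) \<odot>\<^bsub>M\<^esub> (s \<odot>\<^bsub>M\<^esub> n) = \<zero>\<^bsub>M\<^esub>"
        using u v that by (simp add: smult_assoc1)
      moreover have "(v \<otimes> u) \<odot>\<^bsub>M\<^esub> (t \<odot>\<^bsub>M\<^esub> m) = \<zero>\<^bsub>M\<^esub>"
        using u v that by (simp add: smult_assoc1)
      then have "(u \<otimes> v) \<odot>\<^bsub>M\<^esub> (t \<odot>\<^bsub>M\<^esub> m) = \<zero>\<^bsub>M\<^esub>"
        using u v by (simp add: m_comm)
      ultimately show ?thesis
        using that mult[OF u(1) v(1)] unfolding fraction_rel_def by (auto intro!: bexI[of _ "u \<otimes> v"])
    qed
    have "?r `` {(m, s)} = carrier M \<times> ?S" if "m \<in> carrier M" "s \<in> ?S" for m s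
      using rel[OF that(1) _ that(2)] unfolding fraction_rel_def by auto
    then have "(\<Union>p\<in>carrier M \<times> ?S. {?r `` {p}}) = {carrier M \<times> ?S}"
      "?r `` {(\<zero>\<^bsub>M\<^esub>, \<one>)} = carrier M \<times> ?S"
      using one by blast+
    then show "carrier ?L = {\<zero>\<^bsub>?L\<^esub>}" unfolding carL zL quotient_def by simp
  qed
  then show ?thesis using True by (auto simp: module_supp_def)
qed (auto simp: module_supp_def)

lemma annihilated_by_submodule:
  "X \<subseteq> carrier R \<Longrightarrow> submodule (annihilated_by M X) R M"
proof (rule submoduleI')
  fix a x assume X: "X \<subseteq> carrier R" and a: "a \<in> carrier R" "x \<in> annihilated_by M X"
  have "r \<odot>\<^bsub>M\<^esub> (a \<odot>\<^bsub>M\<^esub> x) = a \<odot>\<^bsub>M\<^esub> (r \<odot>\<^bsub>M\<^esub> x)" if "r \<in> X" for r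
  proof -
    have r: "r \<in> carrier R" "x \<in> carrier M" "r \<odot>\<^bsub>M\<^esub> x = \<zero>\<^bsub>M\<^esub>"
      using that X a by (auto simp: annihilated_by_def)
    then have "r \<odot>\<^bsub>M\<^esub> (a \<odot>\<^bsub>M\<^esub> x) = (a \<otimes> r) \<odot>\<^bsub>M\<^esub> x"
      using a by (simp add: smult_assoc1[symmetric] m_comm)
    then show ?thesis using r a by (simp add: smult_assoc1)
  qed
  then show "a \<odot>\<^bsub>M\<^esub> x \<in> annihilated_by M X" using a by (auto simp: annihilated_by_def)
qed (auto simp: annihilated_by_def smult_r_distr subset_iff)

text \<open>The ring elements that kill a fixed \<open>m\<close> form an ideal, which contains
  \<open>Idl X\<close> as soon as it contains \<open>X\<close>.\<close>

lemma annihilated_by_genideal: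
  assumes "X \<subseteq> carrier R"
  shows "annihilated_by M (Idl X) = annihilated_by M X"
proof
  show "annihilated_by M (Idl X) \<subseteq> annihilated_by M X"
    using R.genideal_self[OF assms] by (auto simp: annihilated_by_def)
  show "annihilated_by M X \<subseteq> annihilated_by M (Idl X)"
  proof
    fix m assume m: "m \<in> annihilated_by M X"
    then have "Idl X \<subseteq> {r \<in> carrier R. r \<odot>\<^bsub>M\<^esub> m = \<zero>\<^bsub>M\<^esub>}"
      using assms by (intro R.genideal_minimal annihilator_of_element_ideal) (auto simp: annihilated_by_def)
    then show "m \<in> annihilated_by M (Idl X)" using m by (auto simp: annihilated_by_def)
  qed
qed

lemma annihilated_by_insert:
  "annihilated_by M (insert x X) = annihilated_by M X \<inter> annihilated_by M {x}"
  by (auto simp: annihilated_by_def)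

text \<open>A descending chain \<open>K i\<close> is recovered from the doubly descending family
  \<open>x ^ n K i \<inter> (0 :\<^sub>M x)\<close>, which stabilizes in both indices.\<close>

lemma dcc_of_principal_torsion:
  assumes W: "submodule W R M" and x: "x \<in> carrier R"
    and tor: "\<And>m. m \<in> W \<Longrightarrow> \<exists>k::nat. x [^] k \<odot>\<^bsub>M\<^esub> m = \<zero>\<^bsub>M\<^esub>"
    and dcc: "dcc_between R M {\<zero>\<^bsub>M\<^esub>} (W \<inter> annihilated_by M {x})"
  shows "dcc_between R M {\<zero>\<^bsub>M\<^esub>} W"
proof (rule dcc_betweenI)
  fix K :: "nat \<Rightarrow> 'm set"
  assume K: "\<And>i. submodule (K i) R M" "\<And>i. {\<zero>\<^bsub>M\<^esub>} \<subseteq> K i" "\<And>i. K i \<subseteq> W"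
    and mono: "\<And>i j. i \<le> j \<Longrightarrow> K j \<subseteq> K i"
  \<comment> \<open>Multiplication by \<open>x ^ n\<close> carries elements of \<open>K i\<close>
    killed by \<open>x ^ (n + 1)\<close> into \<open>(0 : x)\<close>, where the chain condition is
    available.\<close>
  define L where "L i n = (\<lambda>m. x [^] (n::nat) \<odot>\<^bsub>M\<^esub> m) ` K i \<inter> annihilated_by M {x}" for i n
  have pw: "x [^] (n::nat) \<in> carrier R" for n using x by simp
  have Kc: "m \<in> carrier M" if "m \<in> K i" for m i using submodule_carrier[OF K(1) that] .
  have subL: "submodule (L i n) R M" for i n
    unfolding L_def
    by (intro inter_submodule linear_map.image_submodule[OF smult_linear_map[OF pw]]
        annihilated_by_submodule K(1)) (use x in auto)
  have LW: "L i n \<subseteq> W \<inter> annihilated_by M {x}" for i n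
    using K(3)[of i] submoduleE(4)[OF W pw] by (auto simp: L_def)
  have Lmono: "L j n' \<subseteq> L i n" if "i \<le> j" "n \<le> n'" for i j n n'
  proof
    fix y assume "y \<in> L j n'"
    then obtain m where m: "m \<in> K j" "y = x [^] n' \<odot>\<^bsub>M\<^esub> m" "y \<in> annihilated_by M {x}"
      by (auto simp: L_def)
    have "y = x [^] n \<odot>\<^bsub>M\<^esub> (x [^] (n' - n) \<odot>\<^bsub>M\<^esub> m)"
      using m(2) pw Kc[OF m(1)] that(2) x by (simp add: smult_assoc1[symmetric] R.nat_pow_mult)
    moreover have "x [^] (n' - n) \<odot>\<^bsub>M\<^esub> m \<in> K i"
      using mono[OF that(1)] m(1) submoduleE(4)[OF K(1) pw] by blast
    ultimately show "y \<in> L i n" using m(3) by (auto simp: L_def)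
  qed
  \<comment> \<open>Along a nondecreasing \<open>g\<close> the doubly indexed family yields one
    descending chain; below, \<open>g\<close> is the identity or a constant.\<close>
  have stab: "\<exists>k. \<forall>i\<ge>k. L i (g i) = L k (g k)" if "mono g" for g :: "nat \<Rightarrow> nat"
    using submodule_zero[OF subL] LW Lmono that
    by (intro dcc_betweenD[OF dcc] subL) (auto simp: mono_def)
  obtain k0 where k0: "\<And>i. i \<ge> k0 \<Longrightarrow> L i i = L k0 k0"
    using stab[of "\<lambda>i. i"] by (auto simp: mono_def)
  have "\<forall>n. \<exists>k. \<forall>i\<ge>k. L i n = L k n"
    using stab[of "\<lambda>_. _"] by (auto simp: mono_def)
  then obtain k1 where k1: "\<And>n i. i \<ge> k1 n \<Longrightarrow> L i n = L (k1 n) n" by metis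
  \<comment> \<open>The finitely many exponents \<open>n \<le> k0\<close> are stable from
    \<open>k1 n\<close> on. For \<open>n > k0\<close> the stable diagonal value is contained in
    every \<open>L i n\<close>, so one bound serves all exponents.\<close>
  define k where "k = Max (insert k0 (k1 ` {..k0}))"
  have kge: "k \<ge> k0" "\<And>n. n \<le> k0 \<Longrightarrow> k \<ge> k1 n" unfolding k_def by (rule Max_ge; simp)+
  have Lk: "L k n \<subseteq> L i n" if "i \<ge> k" for i n
  proof (cases "n \<le> k0")
    case True
    then show ?thesis using k1[of n i] k1[of n k] kge(2)[of n] that by auto
  next
    case False
    have "L k n \<subseteq> L k0 k0" by (rule Lmono) (use kge False in auto)
    also have "\<dots> = L (max i n) (max i n)" using k0[of "max i n"] False by auto
    also have "\<dots> \<subseteq> L i n" by (rule Lmono) auto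
    finally show ?thesis .
  qed
  \<comment> \<open>Induction on the power of \<open>x\<close> that kills \<open>y\<close>:
    \<open>x ^ n y\<close> equals \<open>x ^ n z\<close> for some \<open>z\<close> in
    \<open>K i\<close>, and \<open>y - z\<close> is killed by the smaller power
    \<open>x ^ n\<close>.\<close>
  have "y \<in> K i" if "i \<ge> k" "y \<in> K k" "x [^] (n::nat) \<odot>\<^bsub>M\<^esub> y = \<zero>\<^bsub>M\<^esub>" for i n y
    using that(2,3)
  proof (induction n arbitrary: y)
    case 0
    then show ?case using Kc submodule_zero[OF K(1)] by auto
  next
    case (Suc n)
    have yc: "y \<in> carrier M" by (rule Kc[OF Suc.prems(1)])
    have "x \<odot>\<^bsub>M\<^esub> (x [^] n \<odot>\<^bsub>M\<^esub> y) = \<zero>\<^bsub>M\<^esub>"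
      using Suc.prems(2) yc x by (simp add: smult_assoc1[symmetric] m_comm)
    then have "x [^] n \<odot>\<^bsub>M\<^esub> y \<in> L k n"
      using Suc.prems(1) yc pw by (auto simp: L_def annihilated_by_def)
    then have "x [^] n \<odot>\<^bsub>M\<^esub> y \<in> L i n" using Lk[OF that(1)] by blast
    then obtain z where z: "z \<in> K i" "x [^] n \<odot>\<^bsub>M\<^esub> y = x [^] n \<odot>\<^bsub>M\<^esub> z" by (auto simp: L_def)
    have zc: "z \<in> carrier M" by (rule Kc[OF z(1)])
    have "x [^] n \<odot>\<^bsub>M\<^esub> (y \<ominus>\<^bsub>M\<^esub> z) = \<zero>\<^bsub>M\<^esub>"
      using z(2) yc zc pw by (simp add: a_minus_def smult_r_distr smult_r_minus M.r_neg)
    moreover have "y \<ominus>\<^bsub>M\<^esub> z \<in> K k"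
      using submodule_diff[OF K(1) Suc.prems(1)] mono[OF that(1)] z(1) by blast
    ultimately have d: "y \<ominus>\<^bsub>M\<^esub> z \<in> K i" by (rule Suc.IH[rotated])
    have "y = z \<oplus>\<^bsub>M\<^esub> (y \<ominus>\<^bsub>M\<^esub> z)" using yc zc by (simp add: a_minus_def M.a_lcomm[of _ y] M.r_neg)
    then show ?case using submoduleE(5)[OF K(1) z(1) d] by simp
  qed
  then have "K k \<subseteq> K i" if "i \<ge> k" for i using that tor K(3) by blast
  then show "\<exists>k. \<forall>i\<ge>k. K k \<subseteq> K i" by blast
qed

end

section \<open>Minimaxity of torsion modules in dimension at most one\<close>

context noetherian_rmodule
begin

text \<open>If no power of \<open>x\<close> kills \<open>m\<close>, some prime over the annihilator
  of \<open>m\<close> avoids all powers of \<open>x\<close>; it belongs to the support but does not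
  contain \<open>x\<close>.\<close>

lemma torsion_of_supp:
  assumes supp: "module_supp R M \<subseteq> prime_locus R a" and x: "x \<in> a" "x \<in> carrier R" and m: "m \<in> carrier M"
  shows "\<exists>k::nat. x [^] k \<odot>\<^bsub>M\<^esub> m = \<zero>\<^bsub>M\<^esub>"
proof (rule ccontr)
  assume neg: "\<not> ?thesis"
  let ?J = "{r \<in> carrier R. r \<odot>\<^bsub>M\<^esub> m = \<zero>\<^bsub>M\<^esub>}"
  have "\<exists>Q. primeideal Q R \<and> ?J \<subseteq> Q \<and> Q \<inter> range (\<lambda>k::nat. x [^] k) = {}"
  proof (rule exists_prime_avoiding)
    show "ideal ?J R" by (rule annihilator_of_element_ideal[OF m])
    show "\<one> \<in> range (\<lambda>k::nat. x [^] k)" by (auto intro!: image_eqI[of _ _ 0])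
    fix s t assume "s \<in> range (\<lambda>k::nat. x [^] k)" "t \<in> range (\<lambda>k::nat. x [^] k)"
    then obtain k l :: nat where "s = x [^] k" "t = x [^] l" by auto
    then have "s \<otimes> t = x [^] (k + l)" using x by (simp add: R.nat_pow_mult)
    then show "s \<otimes> t \<in> range (\<lambda>k::nat. x [^] k)" by simp
  qed (use neg x in auto)
  then obtain Q where Q: "primeideal Q R" "?J \<subseteq> Q" "Q \<inter> range (\<lambda>k::nat. x [^] k) = {}" by blast
  have "x = x [^] (1::nat)" using x by simp
  then have "x \<notin> Q" using Q(3) by (metis IntI empty_iff rangeI)
  then have "Q \<notin> module_supp R M" using supp x by (auto simp: prime_locus_def)
  then obtain s where "s \<in> carrier R - Q" "s \<odot>\<^bsub>M\<^esub> m = \<zero>\<^bsub>M\<^esub>"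
    using Q(1) m by (auto simp: module_supp_iff)
  then show False using Q(2) by blast
qed

text \<open>Noetherian induction on \<open>b\<close>: if \<open>u v \<in> b\<close>, then the chain \<open>A \<le> A + R u m \<le> A + R m\<close> has
  cyclic factors annihilated by the larger ideals \<open>b + (v)\<close> and \<open>b + (u)\<close>.\<close>

lemma dcc_of_maximal_primes:
  assumes c: "\<And>P J. \<lbrakk>primeideal P R; c \<subseteq> P; ideal J R; P \<subseteq> J; J \<noteq> P\<rbrakk> \<Longrightarrow> J = carrier R"
    and "ideal b R" "c \<subseteq> b" "submodule A R M" "m \<in> carrier M" "\<And>r. r \<in> b \<Longrightarrow> r \<odot>\<^bsub>M\<^esub> m \<in> A"
  shows "dcc_between R M A ((\<lambda>r. r \<odot>\<^bsub>M\<^esub> m) ` carrier R <+>\<^bsub>M\<^esub> A)"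
proof (rule ccontr)
  assume neg: "\<not> ?thesis"
  let ?C = "\<lambda>m. (\<lambda>r. r \<odot>\<^bsub>M\<^esub> m) ` carrier R"
  let ?P = "\<lambda>b A m. submodule A R M \<and> m \<in> carrier M \<and> (\<forall>r\<in>b. r \<odot>\<^bsub>M\<^esub> m \<in> A)"
  \<comment> \<open>The counterexample ranges over all \<open>A\<close> and \<open>m\<close> at
    once, since the step from \<open>d\<close> to a larger ideal changes both.\<close>
  let ?F = "{b. ideal b R \<and> c \<subseteq> b \<and> (\<exists>A m. ?P b A m \<and> \<not> dcc_between R M A (?C m <+>\<^bsub>M\<^esub> A))}"
  have "b \<in> ?F" using assms neg by blast
  then have "?F \<noteq> {}" by blast
  then have "\<exists>d\<in>?F. \<forall>b\<in>?F. d \<subseteq> b \<longrightarrow> b = d" by (rule exists_maximal_ideal_in) blast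
  then obtain d where d: "d \<in> ?F" and dmax: "\<forall>b\<in>?F. d \<subseteq> b \<longrightarrow> b = d" by (rule bexE)
  have dI: "ideal d R" "c \<subseteq> d" using d by auto
  interpret d: ideal d R by (rule dI(1))
  obtain B y where By: "?P d B y" and nd: "\<not> dcc_between R M B (?C y <+>\<^bsub>M\<^esub> B)"
    using d by blast
  have B: "submodule B R M" and y: "y \<in> carrier M" and dy: "\<And>r. r \<in> d \<Longrightarrow> r \<odot>\<^bsub>M\<^esub> y \<in> B"
    using By by auto
  have larger: "dcc_between R M A (?C m <+>\<^bsub>M\<^esub> A)"
    if "ideal e R" "d \<subseteq> e" "e \<noteq> d" "?P e A m" for e A m
  proof (rule ccontr)
    assume "\<not> ?thesis"
    then have "e \<in> ?F" using that(1,2,4) dI(2) by blast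
    then show False using dmax that(2,3) by blast
  qed
  note Cs = cyclic_submodule
  have Cy: "y \<in> ?C y" if "y \<in> carrier M" for y using that by (auto intro!: image_eqI[of _ _ \<one>])
  have sumB: "submodule (?C y <+>\<^bsub>M\<^esub> B) R M" by (rule set_add_submodule[OF Cs[OF y] B])
  have one: "carrier R \<noteq> d"
  proof
    assume "carrier R = d"
    then have "?C y \<subseteq> B" using dy by auto
    then have "?C y <+>\<^bsub>M\<^esub> B \<subseteq> B" by (rule set_add_least[OF B]) simp
    then show False using nd dcc_between_mono[OF dcc_between_refl] by blast
  qed
  show False
  proof (cases "primeideal d R")
    case True
    have "dcc_between R M B (?C y <+>\<^bsub>M\<^esub> B)"
    proof (rule dcc_betweenI)
      fix K :: "nat \<Rightarrow> 'm set"
      assume K: "\<And>i. submodule (K i) R M" "\<And>i. B \<subseteq> K i" "\<And>i. K i \<subseteq> ?C y <+>\<^bsub>M\<^esub> B"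
        and mono: "\<And>i j. i \<le> j \<Longrightarrow> K j \<subseteq> K i"
      \<comment> \<open>\<open>d\<close> is a maximal ideal here, so the cyclic factor is simple or
        zero and the interval contains only its endpoints.\<close>
      have all: "K i = B \<or> ?C y <+>\<^bsub>M\<^esub> B \<subseteq> K i" for i
      proof (rule disjCI)
        assume "\<not> ?C y <+>\<^bsub>M\<^esub> B \<subseteq> K i"
        show "K i = B"
        proof (rule ccontr)
          assume "K i \<noteq> B"
          then obtain k where k: "k \<in> K i" "k \<notin> B" using K(2) by blast
          then obtain r z where rz: "r \<in> carrier R" "z \<in> B" "k = r \<odot>\<^bsub>M\<^esub> y \<oplus>\<^bsub>M\<^esub> z"
            using subsetD[OF K(3) k(1)] unfolding mem_set_add by blast
          have "r \<notin> d" using k(2) rz dy submoduleE(5)[OF B] by blast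
          \<comment> \<open>\<open>r\<close> is invertible modulo the maximal ideal
            \<open>d\<close>, which allows \<open>y\<close> to be recovered from
            \<open>r y\<close>.\<close>
          then have "d <+>\<^bsub>R\<^esub> PIdl r = carrier R"
            using add_ideal_subset[OF dI(1) rz(1)] by (intro c[OF True dI(2)]) auto
          then obtain i' q where iq: "i' \<in> d" "q \<in> carrier R" "\<one> = i' \<oplus> q \<otimes> r"
            using mem_add_PIdl[of \<one> d r] by auto
          have zc: "z \<in> carrier M" "i' \<in> carrier R" using rz(2) submodule_carrier[OF B] iq(1) by auto
          have "k \<ominus>\<^bsub>M\<^esub> z \<in> K i" using submodule_diff[OF K(1) k(1)] rz(2) K(2) by blast
          moreover have "k \<ominus>\<^bsub>M\<^esub> z = r \<odot>\<^bsub>M\<^esub> y"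
            using rz zc y by (simp add: a_minus_def M.a_assoc M.r_neg)
          ultimately have ry: "r \<odot>\<^bsub>M\<^esub> y \<in> K i" by simp
          have "y = (i' \<oplus> q \<otimes> r) \<odot>\<^bsub>M\<^esub> y" using iq(3) y by (metis smult_one)
          also have "\<dots> = i' \<odot>\<^bsub>M\<^esub> y \<oplus>\<^bsub>M\<^esub> q \<odot>\<^bsub>M\<^esub> (r \<odot>\<^bsub>M\<^esub> y)"
            using iq rz y zc by (simp add: smult_l_distr smult_assoc1)
          also have "\<dots> \<in> K i"
            using submoduleE(4)[OF K(1) iq(2) ry] dy[OF iq(1)] K(2)[of i] submoduleE(5)[OF K(1)] by blast
          finally have "y \<in> K i" .
          then have "?C y \<subseteq> K i" using submoduleE(4)[OF K(1)] by blast
          then have "?C y <+>\<^bsub>M\<^esub> B \<subseteq> K i" by (rule set_add_least[OF K(1) _ K(2)])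
          then show False using \<open>\<not> ?C y <+>\<^bsub>M\<^esub> B \<subseteq> K i\<close> by blast
        qed
      qed
      show "\<exists>k. \<forall>i\<ge>k. K k \<subseteq> K i"
      proof (cases "\<exists>k. K k = B")
        case True
        then show ?thesis using K(2) by auto
      next
        case False
        then have "K 0 \<subseteq> K i" for i using all[of i] K(3)[of 0] by blast
        then show ?thesis by blast
      qed
    qed
    then show False using nd by blast
  next
    case False
    then obtain u v where uv: "u \<in> carrier R" "v \<in> carrier R" "u \<otimes> v \<in> d" "u \<notin> d" "v \<notin> d"
      using primeidealI[OF dI(1) R.cring_axioms one] by blast
    have uy: "u \<odot>\<^bsub>M\<^esub> y \<in> carrier M" using uv y by simp
    let ?A = "?C (u \<odot>\<^bsub>M\<^esub> y) <+>\<^bsub>M\<^esub> B"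
    have A: "submodule ?A R M" by (rule set_add_submodule[OF Cs[OF uy] B])
    have BA: "B \<subseteq> ?A" by (rule set_add_upper2[OF Cs[OF uy] B])
    have CA: "?C (u \<odot>\<^bsub>M\<^esub> y) \<subseteq> ?A" by (rule set_add_upper1[OF Cs[OF uy] B])
    have 1: "dcc_between R M B ?A"
    proof (rule larger)
      show "ideal (d <+>\<^bsub>R\<^esub> PIdl v) R" "d \<subseteq> d <+>\<^bsub>R\<^esub> PIdl v" "d <+>\<^bsub>R\<^esub> PIdl v \<noteq> d"
        using add_ideal_subset[OF dI(1) uv(2)] uv(5) by auto
      have "r \<odot>\<^bsub>M\<^esub> (u \<odot>\<^bsub>M\<^esub> y) \<in> B" if r: "r \<in> d <+>\<^bsub>R\<^esub> PIdl v" for r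
      proof -
        obtain i q where iq: "i \<in> d" "q \<in> carrier R" "r = i \<oplus> q \<otimes> v" using r mem_add_PIdl by blast
        then have i: "i \<in> carrier R" by auto
        have "r \<otimes> u = u \<otimes> i \<oplus> q \<otimes> (u \<otimes> v)"
        proof -
          have "r \<otimes> u = i \<otimes> u \<oplus> (q \<otimes> v) \<otimes> u" using iq i uv by (simp add: R.l_distr)
          also have "(q \<otimes> v) \<otimes> u = q \<otimes> (u \<otimes> v)"
            using iq uv by (simp add: R.m_assoc R.m_comm[of v u])
          finally show ?thesis using i uv by (simp add: R.m_comm[of i u])
        qed
        then have "r \<otimes> u \<in> d" using iq uv d.I_l_closed d.a_closed by simp
        then have "(r \<otimes> u) \<odot>\<^bsub>M\<^esub> y \<in> B" by (rule dy)
        then show ?thesis using iq i uv y by (simp add: smult_assoc1)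
      qed
      then show "?P (d <+>\<^bsub>R\<^esub> PIdl v) B (u \<odot>\<^bsub>M\<^esub> y)" using B uy by blast
    qed
    have 2: "dcc_between R M ?A (?C y <+>\<^bsub>M\<^esub> ?A)"
    proof (rule larger)
      show "ideal (d <+>\<^bsub>R\<^esub> PIdl u) R" "d \<subseteq> d <+>\<^bsub>R\<^esub> PIdl u" "d <+>\<^bsub>R\<^esub> PIdl u \<noteq> d"
        using add_ideal_subset[OF dI(1) uv(1)] uv(4) by auto
      have "r \<odot>\<^bsub>M\<^esub> y \<in> ?A" if r: "r \<in> d <+>\<^bsub>R\<^esub> PIdl u" for r
      proof -
        obtain i q where iq: "i \<in> d" "q \<in> carrier R" "r = i \<oplus> q \<otimes> u" using r mem_add_PIdl by blast
        then have i: "i \<in> carrier R" by auto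
        have "r \<odot>\<^bsub>M\<^esub> y = i \<odot>\<^bsub>M\<^esub> y \<oplus>\<^bsub>M\<^esub> q \<odot>\<^bsub>M\<^esub> (u \<odot>\<^bsub>M\<^esub> y)"
          using iq i uv y by (simp add: smult_l_distr smult_assoc1)
        moreover have "i \<odot>\<^bsub>M\<^esub> y \<in> ?A" using dy[OF iq(1)] BA by blast
        moreover have "q \<odot>\<^bsub>M\<^esub> (u \<odot>\<^bsub>M\<^esub> y) \<in> ?A" using CA iq(2) by blast
        ultimately show ?thesis using submoduleE(5)[OF A] by simp
      qed
      then show "?P (d <+>\<^bsub>R\<^esub> PIdl u) ?A y" using A y by blast
    qed
    have "u \<odot>\<^bsub>M\<^esub> y \<in> ?C y" using uv(1) by blast
    then have "?C (u \<odot>\<^bsub>M\<^esub> y) \<subseteq> ?C y" using submoduleE(4)[OF Cs[OF y]] by blast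
    then have AC: "?A \<subseteq> ?C y <+>\<^bsub>M\<^esub> B" by (rule set_add_mono) simp
    have "?C y <+>\<^bsub>M\<^esub> B \<subseteq> ?C y <+>\<^bsub>M\<^esub> ?A" by (rule set_add_mono[OF order_refl BA])
    then have "dcc_between R M ?A (?C y <+>\<^bsub>M\<^esub> B)" by (rule dcc_between_mono[OF 2 order_refl])
    then have "dcc_between R M B (?C y <+>\<^bsub>M\<^esub> B)" by (rule dcc_between_trans[OF A 1 _ BA AC sumB])
    then show False using nd by blast
  qed
qed

text \<open>Each new generator contributes a cyclic factor killed by \<open>c\<close>, so the
  preceding lemma applies with \<open>b = c\<close>, and finitely many such factors are
  stacked.\<close>

lemma dcc_span_of_maximal_primes:
  assumes "ideal c R"
    and c: "\<And>P J. \<lbrakk>primeideal P R; c \<subseteq> P; ideal J R; P \<subseteq> J; J \<noteq> P\<rbrakk> \<Longrightarrow> J = carrier R"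
    and "finite S" "S \<subseteq> annihilated_by M c"
  shows "dcc_between R M {\<zero>\<^bsub>M\<^esub>} (submodule_span R M S)"
  using assms(3,4)
proof (induction S)
  case empty
  then show ?case by (simp add: span_empty dcc_between_refl)
next
  case (insert s S)
  have s: "s \<in> carrier M" "\<And>r. r \<in> c \<Longrightarrow> r \<odot>\<^bsub>M\<^esub> s = \<zero>\<^bsub>M\<^esub>" and S: "S \<subseteq> carrier M"
    using insert.prems by (auto simp: annihilated_by_def)
  have iS: "insert s S \<subseteq> carrier M" using s S by auto
  note sS = span_submodule[OF S]
  have "dcc_between R M (submodule_span R M S) (submodule_span R M (insert s S))"
    unfolding span_insert[OF s(1) S]
    by (rule dcc_of_maximal_primes[OF c assms(1) order_refl sS s(1)]) (auto simp: s submodule_zero[OF sS])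
  moreover have "dcc_between R M {\<zero>\<^bsub>M\<^esub>} (submodule_span R M S)" using insert by simp
  moreover have "{\<zero>\<^bsub>M\<^esub>} \<subseteq> submodule_span R M S" using submodule_zero[OF sS] by simp
  moreover have "submodule_span R M S \<subseteq> submodule_span R M (insert s S)" by (rule span_mono) auto
  ultimately show ?case using dcc_between_trans[OF sS _ _ _ _ span_submodule[OF iS]] by blast
qed

text \<open>Multiplication by \<open>r\<close> on \<open>W\<close> has kernel
  \<open>(0 :_W r)\<close> and image in \<open>V\<close>. It serves twice below: with
  \<open>r = x\<close> to climb through the powers of \<open>x\<close>, and with \<open>r\<close> a
  generator of the annihilator ideal.\<close>

lemma minimax_of_smult_image:
  assumes "submodule W R M" "r \<in> carrier R" "submodule V R M"
    and "\<And>m. m \<in> W \<Longrightarrow> r \<odot>\<^bsub>M\<^esub> m \<in> V" "minimax_submodule R M V"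
    and "minimax_submodule R M (W \<inter> annihilated_by M {r})"
  shows "minimax_submodule R M W"
proof -
  interpret r: linear_map R M M "\<lambda>m. r \<odot>\<^bsub>M\<^esub> m" by (rule smult_linear_map[OF assms(2)])
  have "minimax_submodule R M ((\<lambda>m. r \<odot>\<^bsub>M\<^esub> m) ` W)"
    by (rule minimax_submodule_subset[OF assms(3) r.image_submodule[OF assms(1)] _ assms(5)]) (use assms(4) in auto)
  moreover have "annihilated_by M {r} = {m \<in> carrier M. r \<odot>\<^bsub>M\<^esub> m = \<zero>\<^bsub>M\<^esub>}"
    by (simp add: annihilated_by_def)
  ultimately show ?thesis using r.minimax_submodule_extension[OF assms(1)] assms(6) by simp
qed

lemma minimax_of_principal_torsion:
  assumes dim: "krull_dim R \<le> 1" and W: "submodule W R M" and x: "x \<in> carrier R"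
    and tor: "\<And>m. m \<in> W \<Longrightarrow> \<exists>k::nat. x [^] k \<odot>\<^bsub>M\<^esub> m = \<zero>\<^bsub>M\<^esub>"
    and mm: "minimax_submodule R M (W \<inter> annihilated_by M {x})"
  shows "minimax_submodule R M W"
proof -
  have pw: "x [^] (n::nat) \<in> carrier R" for n using x by simp
  define ann where "ann n = {r \<in> carrier R. r \<otimes> x [^] n = \<zero>}" for n :: nat
  \<comment> \<open>The annihilators grow with the exponent, so a maximal member of the family is
    their stable value.\<close>
  have "\<exists>I\<in>range ann. \<forall>J\<in>range ann. I \<subseteq> J \<longrightarrow> J = I"
    by (rule exists_maximal_ideal_in) (use annihilator_ideal[OF pw] in \<open>auto simp: ann_def\<close>)
  then obtain I where I: "I \<in> range ann" "\<forall>J\<in>range ann. I \<subseteq> J \<longrightarrow> J = I" by (rule bexE)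
  then obtain n where "I = ann n" by blast
  with I(2) have n: "ann k = ann n" if "ann n \<subseteq> ann k" for k using that by simp
  have stable: "r \<otimes> x [^] n = \<zero>" if r: "r \<in> carrier R" "r \<otimes> x [^] (k::nat) = \<zero>" for k r
  proof -
    have up: "ann i \<subseteq> ann (i + j)" for i j
      using x by (auto simp: ann_def R.nat_pow_mult[symmetric] R.m_assoc[symmetric])
    \<comment> \<open>Passing to the exponent \<open>k + n\<close> avoids comparing \<open>k\<close>
      with \<open>n\<close>.\<close>
    have "r \<in> ann (k + n)" using up[of k n] r by (auto simp: ann_def)
    moreover have "ann (k + n) = ann n" using n[of "n + k"] up[of n k] by (simp add: add.commute)
    ultimately have "r \<in> ann n" by simp
    then show ?thesis by (simp add: ann_def)
  qed
  let ?I = "ann n"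
  have I: "ideal ?I R" unfolding ann_def by (rule annihilator_ideal[OF pw])
  let ?c = "?I <+>\<^bsub>R\<^esub> PIdl x"
  note c = add_ideal_subset[OF I x]
  have cmax: "J = carrier R" if "primeideal P R" "?c \<subseteq> P" "ideal J R" "P \<subseteq> J" "J \<noteq> P" for P J
    by (rule prime_over_annihilator_maximal[OF dim x stable that(1)])
      (use c that in \<open>auto simp: ann_def[symmetric]\<close>)
  have Ann: "submodule (W \<inter> annihilated_by M X) R M" if "X \<subseteq> carrier R" for X
    by (rule inter_submodule[OF W annihilated_by_submodule[OF that]])
  have Ic: "?I \<subseteq> carrier R" by (auto simp: ann_def)
  let ?W1 = "W \<inter> annihilated_by M ?I"
  have W1x: "submodule (?W1 \<inter> annihilated_by M {x}) R M"
    by (rule inter_submodule[OF Ann[OF Ic] annihilated_by_submodule]) (use x in auto)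
  have "minimax_submodule R M (?W1 \<inter> annihilated_by M {x})"
    by (rule minimax_submodule_subset[OF Ann W1x _ mm]) (use x in auto)
  then obtain S where S: "finite S" "S \<subseteq> ?W1 \<inter> annihilated_by M {x}"
    and dS: "dcc_between R M (submodule_span R M S) (?W1 \<inter> annihilated_by M {x})"
    unfolding minimax_submodule_def by blast
  have "s \<in> annihilated_by M ?c" if "s \<in> S" for s
  proof -
    have s: "s \<in> carrier M" "\<And>r. r \<in> ?I \<Longrightarrow> r \<odot>\<^bsub>M\<^esub> s = \<zero>\<^bsub>M\<^esub>" "x \<odot>\<^bsub>M\<^esub> s = \<zero>\<^bsub>M\<^esub>"
      using that S(2) by (auto simp: annihilated_by_def)
    have "r \<odot>\<^bsub>M\<^esub> s = \<zero>\<^bsub>M\<^esub>" if "r \<in> ?c" for r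
    proof -
      obtain i q where iq: "i \<in> ?I" "q \<in> carrier R" "r = i \<oplus> q \<otimes> x"
        using \<open>r \<in> ?c\<close> unfolding mem_add_PIdl by blast
      then have "i \<in> carrier R" using Ic by blast
      then show ?thesis using s x iq by (simp add: smult_l_distr smult_assoc1)
    qed
    then show ?thesis using s(1) by (auto simp: annihilated_by_def)
  qed
  then have "dcc_between R M {\<zero>\<^bsub>M\<^esub>} (submodule_span R M S)"
    by (intro dcc_span_of_maximal_primes[OF c(1) cmax S(1)]) auto
  moreover have Sc: "S \<subseteq> carrier M" using S(2) by (auto simp: annihilated_by_def)
  \<comment> \<open>Both layers satisfy the chain condition: the span of \<open>S\<close> because it
    is killed by \<open>?c\<close>, and the part above it by minimaxity.\<close>
  ultimately have "dcc_between R M {\<zero>\<^bsub>M\<^esub>} (?W1 \<inter> annihilated_by M {x})"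
    using submodule_zero[OF span_submodule[OF Sc]]
      dcc_between_trans[OF span_submodule[OF Sc] _ dS _ span_least[OF W1x S(2)] W1x] by simp
  then have "dcc_between R M {\<zero>\<^bsub>M\<^esub>} ?W1"
    by (intro dcc_of_principal_torsion[OF Ann[OF Ic] x]) (use tor in auto)
  then have mmI: "minimax_submodule R M ?W1"
    unfolding minimax_submodule_def by (intro exI[of _ "{}"]) (auto simp: span_empty)
  \<comment> \<open>Multiplication by \<open>x\<close> lowers the killing exponent by one, and its
    kernel lies in the minimax submodule \<open>(0 :_W x)\<close>.\<close>
  have mmk: "minimax_submodule R M (W \<inter> annihilated_by M {x [^] (k::nat)})" for k
  proof (induction k)
    case 0
    have "W \<inter> annihilated_by M {x [^] (0::nat)} = {\<zero>\<^bsub>M\<^esub>}"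
      using submodule_zero[OF W] by (auto simp: annihilated_by_def)
    then show ?case unfolding minimax_submodule_def
      by (intro exI[of _ "{}"]) (auto simp: span_empty dcc_between_refl)
  next
    case (Suc k)
    let ?V = "W \<inter> annihilated_by M {x [^] (Suc k)}"
    have V: "submodule ?V R M" by (rule Ann) (use pw[of "Suc k"] in blast)
    show ?case
    proof (rule minimax_of_smult_image[OF V x _ _ Suc.IH])
      show "submodule (W \<inter> annihilated_by M {x [^] k}) R M" by (rule Ann) (use pw in auto)
      fix m assume "m \<in> ?V"
      then show "x \<odot>\<^bsub>M\<^esub> m \<in> W \<inter> annihilated_by M {x [^] k}"
        using submoduleE(4)[OF W x] x by (auto simp: annihilated_by_def smult_assoc1)
    next
      have Vx: "submodule (?V \<inter> annihilated_by M {x}) R M"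
        by (rule inter_submodule[OF V annihilated_by_submodule]) (use x in auto)
      show "minimax_submodule R M (?V \<inter> annihilated_by M {x})"
        by (rule minimax_submodule_subset[OF Ann Vx _ mm]) (use x in auto)
    qed
  qed
  \<comment> \<open>Generators \<open>y\<close> of \<open>I\<close> are discarded one at a time;
    \<open>y x ^ n = 0\<close> puts the image of multiplication by \<open>y\<close> inside
    \<open>(0 :_W x ^ n)\<close>.\<close>
  have peel: "minimax_submodule R M (W \<inter> annihilated_by M Z) \<Longrightarrow> minimax_submodule R M W"
    if "finite Z" "Z \<subseteq> ?I" for Z
    using that
  proof (induction Z)
    case empty
    moreover have "W \<inter> annihilated_by M {} = W" using submodule_carrier[OF W] by (auto simp: annihilated_by_def)
    ultimately show ?case by simp
  next
    case (insert y Z)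
    have y: "y \<in> carrier R" "y \<otimes> x [^] n = \<zero>" and Z: "Z \<subseteq> carrier R" using insert.prems by (auto simp: ann_def)
    have "minimax_submodule R M (W \<inter> annihilated_by M Z)"
    proof (rule minimax_of_smult_image[OF Ann[OF Z] y(1) _ _ mmk[of n]])
      show "submodule (W \<inter> annihilated_by M {x [^] n}) R M" by (rule Ann) (use pw in auto)
      fix m assume m: "m \<in> W \<inter> annihilated_by M Z"
      then have mc: "m \<in> carrier M" by (auto simp: annihilated_by_def)
      have "x [^] n \<odot>\<^bsub>M\<^esub> (y \<odot>\<^bsub>M\<^esub> m) = (y \<otimes> x [^] n) \<odot>\<^bsub>M\<^esub> m"
        using y(1) pw mc by (simp add: smult_assoc1[symmetric] R.m_comm)
      then show "y \<odot>\<^bsub>M\<^esub> m \<in> W \<inter> annihilated_by M {x [^] n}"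
        using m mc y submoduleE(4)[OF W y(1)] by (auto simp: annihilated_by_def)
    next
      show "minimax_submodule R M (W \<inter> annihilated_by M Z \<inter> annihilated_by M {y})"
        using insert.prems(1) by (simp add: annihilated_by_insert[of y Z] Int_assoc)
    qed
    then show ?case using insert by simp
  qed
  obtain Y where Y: "Y \<subseteq> carrier R" "finite Y" "?I = Idl Y" using finetely_gen[OF I] by auto
  have "annihilated_by M ?I = annihilated_by M Y" unfolding Y(3) by (rule annihilated_by_genideal[OF Y(1)])
  moreover have "Y \<subseteq> ?I" unfolding Y(3) by (rule R.genideal_self[OF Y(1)])
  ultimately show ?thesis using peel[OF Y(2)] mmI by simp
qed

theorem minimax_of_annihilated_minimax:
  assumes dim: "krull_dim R \<le> 1" and a: "ideal a R" and supp: "module_supp R M \<subseteq> prime_locus R a"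
    and mm: "minimax_submodule R M (annihilated_by M a)"
  shows "minimax_module R M"
proof -
  obtain X where X: "X \<subseteq> carrier R" "finite X" "a = Idl X" using finetely_gen[OF a] by auto
  have Xa: "X \<subseteq> a" unfolding X(3) by (rule R.genideal_self[OF X(1)])
  \<comment> \<open>Read from \<open>Z = X\<close> down to the empty set, which annihilates all of
    \<open>M\<close>; at each stage \<open>(0 : Z)\<close> plays the part of the
    \<open>x\<close>-torsion submodule \<open>W\<close>.\<close>
  have peel: "minimax_submodule R M (annihilated_by M Z) \<Longrightarrow> minimax_submodule R M (carrier M)"
    if "finite Z" "Z \<subseteq> X" for Z
    using that
  proof (induction Z)
    case empty
    then show ?case by (simp add: annihilated_by_def)
  next
    case (insert x Z)
    have x: "x \<in> carrier R" "x \<in> a" and Z: "Z \<subseteq> carrier R" using insert.prems X(1) Xa by auto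
    have "minimax_submodule R M (annihilated_by M Z)"
    proof (rule minimax_of_principal_torsion[OF dim annihilated_by_submodule[OF Z] x(1)])
      show "\<exists>k::nat. x [^] k \<odot>\<^bsub>M\<^esub> m = \<zero>\<^bsub>M\<^esub>" if "m \<in> annihilated_by M Z" for m
        by (rule torsion_of_supp[OF supp x(2,1)]) (use that in \<open>simp add: annihilated_by_def\<close>)
      show "minimax_submodule R M (annihilated_by M Z \<inter> annihilated_by M {x})"
        using insert.prems(1) by (simp add: annihilated_by_insert[of x Z])
    qed
    then show ?case using insert by simp
  qed
  have "annihilated_by M a = annihilated_by M X" unfolding X(3) by (rule annihilated_by_genideal[OF X(1)])
  then show ?thesis using peel[OF X(2)] mm minimax_module_iff by simp
qed

end

section \<open>Free modules and homomorphism modules\<close>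

lemma rmoduleI: "module R M \<Longrightarrow> rmodule R M"
  by (simp add: rmodule_def)

lemma linear_mapI:
  "\<lbrakk>module R M; module R N; f \<in> module_homs R M N\<rbrakk> \<Longrightarrow> linear_map R M N f"
  by (auto simp: module_homs_def linear_map_def linear_map_axioms_def rmodule_def)

lemma module_homsD:
  assumes "f \<in> module_homs R M N"
  shows "x \<in> carrier M \<Longrightarrow> f x \<in> carrier N" "x \<notin> carrier M \<Longrightarrow> f x = undefined"
    "\<lbrakk>x \<in> carrier M; y \<in> carrier M\<rbrakk> \<Longrightarrow> f (x \<oplus>\<^bsub>M\<^esub> y) = f x \<oplus>\<^bsub>N\<^esub> f y"
    "\<lbrakk>r \<in> carrier R; x \<in> carrier M\<rbrakk> \<Longrightarrow> f (r \<odot>\<^bsub>M\<^esub> x) = r \<odot>\<^bsub>N\<^esub> f x"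
  using assms by (auto simp: module_homs_def)

section \<open>Supports along exact sequences\<close>

lemma (in linear_map) supp_of_injective:
  assumes "inj_on f (carrier M)"
  shows "module_supp R M \<subseteq> module_supp R N"
proof
  fix P assume "P \<in> module_supp R M"
  then obtain m where P: "primeideal P R" and m: "m \<in> carrier M" "\<And>s. s \<in> carrier R - P \<Longrightarrow> s \<odot>\<^bsub>M\<^esub> m \<noteq> \<zero>\<^bsub>M\<^esub>"
    by (auto simp: M.module_supp_iff)
  have "s \<odot>\<^bsub>N\<^esub> f m \<noteq> \<zero>\<^bsub>N\<^esub>" if "s \<in> carrier R - P" for s
  proof
    assume "s \<odot>\<^bsub>N\<^esub> f m = \<zero>\<^bsub>N\<^esub>"
    then have "f (s \<odot>\<^bsub>M\<^esub> m) = f \<zero>\<^bsub>M\<^esub>" using that m(1) by (simp add: map_smult)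
    then have "s \<odot>\<^bsub>M\<^esub> m = \<zero>\<^bsub>M\<^esub>" using inj_onD[OF assms] m(1) that by blast
    then show False using m(2)[OF that] by simp
  qed
  then show "P \<in> module_supp R N" using P m(1) by (auto simp: N.module_supp_iff)
qed

lemma (in linear_map) supp_of_surjective:
  assumes "f ` carrier M = carrier N"
  shows "module_supp R N \<subseteq> module_supp R M"
proof
  fix P assume "P \<in> module_supp R N"
  then obtain n where P: "primeideal P R" and n: "n \<in> carrier N" "\<And>s. s \<in> carrier R - P \<Longrightarrow> s \<odot>\<^bsub>N\<^esub> n \<noteq> \<zero>\<^bsub>N\<^esub>"
    by (auto simp: N.module_supp_iff)
  obtain m where m: "m \<in> carrier M" "n = f m" using n(1) assms by auto
  have "s \<odot>\<^bsub>M\<^esub> m \<noteq> \<zero>\<^bsub>M\<^esub>" if "s \<in> carrier R - P" for s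
    using n(2)[OF that] m that map_smult[of s m] map_zero by auto
  then show "P \<in> module_supp R M" using P m(1) by (auto simp: M.module_supp_iff)
qed

text \<open>Exactness of localization, by elements: some \<open>s\<close> outside \<open>P\<close>
  kills \<open>g m\<close>, so \<open>s m\<close> comes from \<open>L\<close>; some \<open>t\<close>
  outside \<open>P\<close> kills that preimage, and then \<open>t s\<close> kills
  \<open>m\<close>.\<close>

lemma supp_of_extension:
  assumes "linear_map R L M f" "linear_map R M N g"
    and ex: "f ` carrier L = module_ker M N g"
  shows "module_supp R M \<subseteq> module_supp R L \<union> module_supp R N"
proof (rule subsetI, rule ccontr)
  interpret f: linear_map R L M f by fact
  interpret g: linear_map R M N g by fact
  fix P assume "P \<in> module_supp R M" and neg: "P \<notin> module_supp R L \<union> module_supp R N"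
  then obtain m where P: "primeideal P R"
    and m: "m \<in> carrier M" "\<And>s. s \<in> carrier R - P \<Longrightarrow> s \<odot>\<^bsub>M\<^esub> m \<noteq> \<zero>\<^bsub>M\<^esub>"
    by (auto simp: f.N.module_supp_iff)
  interpret P: primeideal P R by (rule P)
  obtain s where s: "s \<in> carrier R - P" "s \<odot>\<^bsub>N\<^esub> g m = \<zero>\<^bsub>N\<^esub>"
    using neg P m(1) by (auto simp: g.N.module_supp_iff)
  then have "s \<odot>\<^bsub>M\<^esub> m \<in> module_ker M N g" using m(1) by (simp add: module_ker_def g.map_smult)
  then obtain l where l: "l \<in> carrier L" "s \<odot>\<^bsub>M\<^esub> m = f l" using ex by auto
  obtain t where t: "t \<in> carrier R - P" "t \<odot>\<^bsub>L\<^esub> l = \<zero>\<^bsub>L\<^esub>"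
    using neg P l(1) by (auto simp: f.M.module_supp_iff)
  have "t \<odot>\<^bsub>M\<^esub> (s \<odot>\<^bsub>M\<^esub> m) = f (t \<odot>\<^bsub>L\<^esub> l)" using l t(1) by (simp add: f.map_smult)
  then have "(t \<otimes>\<^bsub>R\<^esub> s) \<odot>\<^bsub>M\<^esub> m = \<zero>\<^bsub>M\<^esub>" using s t m(1) by (simp add: f.N.smult_assoc1)
  moreover have "t \<otimes>\<^bsub>R\<^esub> s \<in> carrier R - P" using s t P.I_prime by auto
  ultimately show False using m(2) by blast
qed

section \<open>Free modules and their universal property\<close>

definition free_unit :: "('r, 'z) ring_scheme \<Rightarrow> 'x \<Rightarrow> 'x \<Rightarrow> 'r" where
  "free_unit R b = (\<lambda>x. if x = b then \<one>\<^bsub>R\<^esub> else \<zero>\<^bsub>R\<^esub>)"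

context cring
begin

lemma mem_free_module:
  "f \<in> carrier (free_module R B) \<longleftrightarrow>
    (\<forall>x. f x \<in> carrier R) \<and> (\<forall>x. x \<notin> B \<longrightarrow> f x = \<zero>) \<and> finite {x. f x \<noteq> \<zero>}"
  by (auto simp: free_module_def)

lemma free_module_ops:
  "\<zero>\<^bsub>free_module R B\<^esub> = (\<lambda>x. \<zero>)"
  "f \<oplus>\<^bsub>free_module R B\<^esub> g = (\<lambda>x. f x \<oplus> g x)"
  "r \<odot>\<^bsub>free_module R B\<^esub> f = (\<lambda>x. r \<otimes> f x)"
  by (auto simp: free_module_def)

lemma module_free_module: "module R (free_module R B)"
proof (rule moduleI)
  note free_module_ops [simp]
  let ?F = "free_module R B"
  show "abelian_group ?F"
  proof (rule abelian_groupI)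
    fix f g assume f: "f \<in> carrier ?F" and g: "g \<in> carrier ?F"
    have "{x. f x \<oplus> g x \<noteq> \<zero>} \<subseteq> {x. f x \<noteq> \<zero>} \<union> {x. g x \<noteq> \<zero>}" by auto
    then have "finite {x. f x \<oplus> g x \<noteq> \<zero>}" using f g by (auto simp: mem_free_module intro: finite_subset)
    then show "f \<oplus>\<^bsub>?F\<^esub> g \<in> carrier ?F" using f g by (auto simp: mem_free_module)
  next
    fix f assume f: "f \<in> carrier ?F"
    have "{x. \<ominus> f x \<noteq> \<zero>} \<subseteq> {x. f x \<noteq> \<zero>}" by auto
    then have "finite {x. \<ominus> f x \<noteq> \<zero>}" using f by (auto simp: mem_free_module intro: finite_subset)
    then show "\<exists>g\<in>carrier ?F. g \<oplus>\<^bsub>?F\<^esub> f = \<zero>\<^bsub>?F\<^esub>"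
      using f by (intro bexI[of _ "\<lambda>x. \<ominus> f x"]) (auto simp: mem_free_module l_neg)
  qed (auto simp: mem_free_module a_ac)
next
  note free_module_ops [simp]
  let ?F = "free_module R B"
  fix r f assume r: "r \<in> carrier R" and f: "f \<in> carrier ?F"
  have "{x. r \<otimes> f x \<noteq> \<zero>} \<subseteq> {x. f x \<noteq> \<zero>}" using r by auto
  then have "finite {x. r \<otimes> f x \<noteq> \<zero>}" using f by (auto simp: mem_free_module intro: finite_subset)
  then show "r \<odot>\<^bsub>?F\<^esub> f \<in> carrier ?F" using f r by (auto simp: mem_free_module)
qed (auto simp: free_module_ops mem_free_module l_distr r_distr m_assoc cring_axioms)

lemma free_unit_closed: "b \<in> B \<Longrightarrow> free_unit R b \<in> carrier (free_module R B)"
proof -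
  assume "b \<in> B"
  moreover have "{x. free_unit R b x \<noteq> \<zero>} \<subseteq> {b}" by (auto simp: free_unit_def)
  then have "finite {x. free_unit R b x \<noteq> \<zero>}" by (rule finite_subset) simp
  ultimately show ?thesis unfolding mem_free_module by (auto simp: free_unit_def)
qed

text \<open>Induction on a finite set containing the support of \<open>f\<close>, clearing one
  coordinate at a time.\<close>

lemma free_module_generated:
  assumes T: "submodule T R (free_module R B)" and u: "\<And>b. b \<in> B \<Longrightarrow> free_unit R b \<in> T"
  shows "carrier (free_module R B) \<subseteq> T"
proof -
  interpret F: rmodule R "free_module R B" by (rule rmoduleI[OF module_free_module])
  have "f \<in> T" if "finite A" "f \<in> carrier (free_module R B)" "{x. f x \<noteq> \<zero>} \<subseteq> A" for A f
    using that
  proof (induction A arbitrary: f)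
    case empty
    then have "f = \<zero>\<^bsub>free_module R B\<^esub>" by (auto simp: free_module_ops)
    then show ?case using F.submodule_zero[OF T] by simp
  next
    case (insert b A)
    show ?case
    proof (cases "f b = \<zero>")
      case True
      then show ?thesis using insert by (intro insert.IH) auto
    next
      case False
      then have b: "b \<in> B" "f b \<in> carrier R" using insert.prems(1) unfolding mem_free_module by auto
      have "{x. (f(b := \<zero>)) x \<noteq> \<zero>} \<subseteq> {x. f x \<noteq> \<zero>}" by auto
      then have "finite {x. (f(b := \<zero>)) x \<noteq> \<zero>}"
        using insert.prems(1) finite_subset unfolding mem_free_module by blast
      then have "f(b := \<zero>) \<in> T"
        using insert.prems unfolding mem_free_module
        by (intro insert.IH) (auto simp: mem_free_module)
      moreover have "f b \<odot>\<^bsub>free_module R B\<^esub> free_unit R b \<in> T"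
        by (rule F.submoduleE(4)[OF T b(2) u[OF b(1)]])
      ultimately have "f b \<odot>\<^bsub>free_module R B\<^esub> free_unit R b \<oplus>\<^bsub>free_module R B\<^esub> f(b := \<zero>) \<in> T"
        by (intro F.submoduleE(5)[OF T])
      moreover have "f b \<odot>\<^bsub>free_module R B\<^esub> free_unit R b \<oplus>\<^bsub>free_module R B\<^esub> f(b := \<zero>) = f"
        using insert.prems(1) b by (auto simp: free_unit_def mem_free_module free_module_ops fun_eq_iff)
      ultimately show ?thesis by simp
    qed
  qed
  then show ?thesis by (auto simp: mem_free_module)
qed

end

lemma eq_on_free_module:
  assumes f: "linear_map R (free_module R B) N f" and g: "linear_map R (free_module R B) N g"
    and "\<And>b. b \<in> B \<Longrightarrow> f (free_unit R b) = g (free_unit R b)"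
    and "x \<in> carrier (free_module R B)"
  shows "f x = g x"
proof -
  let ?F = "free_module R B"
  interpret f: linear_map R ?F N f by fact
  interpret g: linear_map R ?F N g by fact
  have "submodule {x \<in> carrier ?F. f x = g x} R ?F"
    by (rule f.M.submoduleI')
      (auto simp: f.map_add f.map_smult g.map_add g.map_smult)
  then have "carrier ?F \<subseteq> {x \<in> carrier ?F. f x = g x}"
    using assms(3) f.M.R.free_unit_closed by (intro f.M.R.free_module_generated) auto
  then show ?thesis using assms(4) by auto
qed

context rmodule
begin

lemma free_module_extension:
  fixes v :: "'x \<Rightarrow> 'm"
  assumes v: "\<And>b. b \<in> B \<Longrightarrow> v b \<in> carrier M"
  shows "\<exists>\<phi>\<in>module_homs R (free_module R B) M. \<forall>b\<in>B. \<phi> (free_unit R b) = v b"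
proof -
  let ?F = "free_module R B"
  let ?s = "\<lambda>f :: 'x \<Rightarrow> 'r. {x. f x \<noteq> \<zero>}"
  define \<phi> where "\<phi> f = (\<Oplus>\<^bsub>M\<^esub>b\<in>?s f. f b \<odot>\<^bsub>M\<^esub> v b)" for f :: "'x \<Rightarrow> 'r"
  have sB: "?s f \<subseteq> B" "finite (?s f)" "f x \<in> carrier R" if "f \<in> carrier ?F" for f x
    using that unfolding R.mem_free_module by auto
  have fv: "f b \<odot>\<^bsub>M\<^esub> v b \<in> carrier M" if "f \<in> carrier ?F" "b \<in> B" for f b
    using that v sB by auto
  \<comment> \<open>The sum may be taken over any finite set of basis indices containing the
    support, so sums attached to \<open>f\<close>, \<open>g\<close> and \<open>f + g\<close> can be
    compared term by term.\<close>
  have \<phi>: "\<phi> f = (\<Oplus>\<^bsub>M\<^esub>b\<in>A. f b \<odot>\<^bsub>M\<^esub> v b)" if "f \<in> carrier ?F" "finite A" "?s f \<subseteq> A" "A \<subseteq> B" for f A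
    unfolding \<phi>_def using that v sB
    by (intro M.add.finprod_mono_neutral_cong_left) (auto simp: subset_iff)
  have cl: "\<phi> f \<in> carrier M" if "f \<in> carrier ?F" for f
    unfolding \<phi>_def using fv[OF that] sB[OF that] by (intro M.finsum_closed) auto
  interpret F: rmodule R ?F by (rule rmoduleI[OF R.module_free_module])
  have add: "\<phi> (f \<oplus>\<^bsub>?F\<^esub> g) = \<phi> f \<oplus>\<^bsub>M\<^esub> \<phi> g" if f: "f \<in> carrier ?F" and g: "g \<in> carrier ?F" for f g
  proof -
    let ?A = "?s f \<union> ?s g"
    have fg: "f \<oplus>\<^bsub>?F\<^esub> g \<in> carrier ?F" using f g by (rule F.M.a_closed)
    have A: "finite ?A" "?A \<subseteq> B" using sB[OF f] sB[OF g] by auto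
    have "\<phi> (f \<oplus>\<^bsub>?F\<^esub> g) = (\<Oplus>\<^bsub>M\<^esub>b\<in>?A. (f \<oplus>\<^bsub>?F\<^esub> g) b \<odot>\<^bsub>M\<^esub> v b)"
      by (rule \<phi>[OF fg A(1) _ A(2)]) (auto simp: R.free_module_ops)
    also have "\<dots> = (\<Oplus>\<^bsub>M\<^esub>b\<in>?A. f b \<odot>\<^bsub>M\<^esub> v b \<oplus>\<^bsub>M\<^esub> g b \<odot>\<^bsub>M\<^esub> v b)"
      using A(2) v sB(3)[OF f] sB(3)[OF g]
      by (intro M.finsum_cong') (auto simp: R.free_module_ops smult_l_distr subset_iff)
    also have "\<dots> = (\<Oplus>\<^bsub>M\<^esub>b\<in>?A. f b \<odot>\<^bsub>M\<^esub> v b) \<oplus>\<^bsub>M\<^esub> (\<Oplus>\<^bsub>M\<^esub>b\<in>?A. g b \<odot>\<^bsub>M\<^esub> v b)"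
      using A(2) v sB(3)[OF f] sB(3)[OF g] by (intro M.finsum_addf) auto
    finally show ?thesis using \<phi>[OF f A(1) _ A(2)] \<phi>[OF g A(1) _ A(2)] by auto
  qed
  have smul: "\<phi> (r \<odot>\<^bsub>?F\<^esub> f) = r \<odot>\<^bsub>M\<^esub> \<phi> f" if r: "r \<in> carrier R" and f: "f \<in> carrier ?F" for r f
  proof -
    have rf: "r \<odot>\<^bsub>?F\<^esub> f \<in> carrier ?F" using r f by (rule F.smult_closed)
    have "\<phi> (r \<odot>\<^bsub>?F\<^esub> f) = (\<Oplus>\<^bsub>M\<^esub>b\<in>?s f. (r \<odot>\<^bsub>?F\<^esub> f) b \<odot>\<^bsub>M\<^esub> v b)"
      by (rule \<phi>[OF rf sB(2)[OF f] _ sB(1)[OF f]]) (use r in \<open>auto simp: R.free_module_ops\<close>)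
    also have "\<dots> = (\<Oplus>\<^bsub>M\<^esub>b\<in>?s f. r \<odot>\<^bsub>M\<^esub> (f b \<odot>\<^bsub>M\<^esub> v b))"
      using r sB[OF f] v by (intro M.finsum_cong') (auto simp: R.free_module_ops smult_assoc1 subset_iff)
    also have "\<dots> = r \<odot>\<^bsub>M\<^esub> \<phi> f"
      unfolding \<phi>_def using r sB[OF f] fv[OF f]
      by (intro finsum_smult_ldistr[symmetric]) (auto simp: subset_iff)
    finally show ?thesis .
  qed
  have hom: "restrict \<phi> (carrier ?F) \<in> module_homs R ?F M"
    using cl add smul F.M.a_closed F.smult_closed by (auto simp: module_homs_def)
  have "\<phi> (free_unit R b) = v b" if b: "b \<in> B" for b
  proof -
    have "\<phi> (free_unit R b) = (\<Oplus>\<^bsub>M\<^esub>x\<in>{b}. free_unit R b x \<odot>\<^bsub>M\<^esub> v x)"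
      by (rule \<phi>[OF R.free_unit_closed[OF b]]) (use b in \<open>auto simp: free_unit_def\<close>)
    also have "\<dots> = v b" using v[OF b] by (simp add: free_unit_def)
    finally show ?thesis .
  qed
  then show ?thesis by (intro bexI[OF _ hom]) (simp add: R.free_unit_closed)
qed

end

text \<open>Projectivity of free modules. Asking only that the values of \<open>\<psi>\<close> be
  reached by \<open>\<pi>\<close> makes the lemma fit the differentials of a resolution, which are
  onto a kernel rather than onto \<open>Q\<close>.\<close>

lemma free_module_lift:
  fixes R :: "('r, 'z) ring_scheme" and B :: "'x set"
  assumes "linear_map R P Q \<pi>" "linear_map R (free_module R B) Q \<psi>"
    and im: "\<And>x. x \<in> carrier (free_module R B) \<Longrightarrow> \<psi> x \<in> \<pi> ` carrier P"
  shows "\<exists>\<phi>\<in>module_homs R (free_module R B) P. \<forall>x\<in>carrier (free_module R B). \<pi> (\<phi> x) = \<psi> x"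
proof -
  let ?F = "free_module R B"
  interpret \<pi>: linear_map R P Q \<pi> by fact
  interpret \<psi>: linear_map R ?F Q \<psi> by fact
  have "\<exists>p. p \<in> carrier P \<and> \<pi> p = \<psi> (free_unit R b)" if "b \<in> B" for b
    using im[OF \<pi>.M.R.free_unit_closed[OF that]] by (elim imageE) (metis)
  then obtain v where v: "\<And>b. b \<in> B \<Longrightarrow> v b \<in> carrier P \<and> \<pi> (v b) = \<psi> (free_unit R b)"
    by metis
  have "\<exists>\<phi>\<in>module_homs R ?F P. \<forall>b\<in>B. \<phi> (free_unit R b) = v b"
    by (rule \<pi>.M.free_module_extension) (simp add: v)
  then obtain \<phi> where \<phi>: "\<phi> \<in> module_homs R ?F P" "\<forall>b\<in>B. \<phi> (free_unit R b) = v b"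
    by (rule bexE)
  interpret \<phi>: linear_map R ?F P \<phi>
    by (rule linear_mapI[OF \<psi>.M.module_axioms \<pi>.M.module_axioms \<phi>(1)])
  have comp: "linear_map R ?F Q (\<lambda>x. \<pi> (\<phi> x))"
    by unfold_locales (auto simp: \<phi>.map_add \<phi>.map_smult \<pi>.map_add \<pi>.map_smult)
  have "\<psi> x = \<pi> (\<phi> x)" if "x \<in> carrier ?F" for x
    by (rule eq_on_free_module[OF assms(2) comp _ that]) (simp add: \<phi>(2) v)
  then show ?thesis using \<phi>(1) by auto
qed

lemma hom_module_ops [simp]:
  "carrier (hom_module R F M) = module_homs R F M"
  "\<zero>\<^bsub>hom_module R F M\<^esub> = (\<lambda>x\<in>carrier F. \<zero>\<^bsub>M\<^esub>)"
  "f \<oplus>\<^bsub>hom_module R F M\<^esub> g = (\<lambda>x\<in>carrier F. f x \<oplus>\<^bsub>M\<^esub> g x)"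
  "r \<odot>\<^bsub>hom_module R F M\<^esub> f = (\<lambda>x\<in>carrier F. r \<odot>\<^bsub>M\<^esub> f x)"
  by (auto simp: hom_module_def)

lemma module_homs_extensional: "f \<in> module_homs R F M \<Longrightarrow> f \<in> extensional (carrier F)"
  by (auto simp: module_homs_def PiE_def)

lemma module_hom_module:
  assumes "module R F" "module R M"
  shows "module R (hom_module R F M)"
proof -
  interpret F: rmodule R F using assms(1) by (rule rmoduleI)
  interpret M: rmodule R M using assms(2) by (rule rmoduleI)
  note D = module_homsD module_homs_extensional
  have cl: "(\<lambda>x\<in>carrier F. f x \<oplus>\<^bsub>M\<^esub> g x) \<in> module_homs R F M"
    if "f \<in> module_homs R F M" "g \<in> module_homs R F M" for f g
    using D[OF that(1)] D[OF that(2)] by (auto simp: module_homs_def M.M.a_ac M.smult_r_distr)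
  have cs: "(\<lambda>x\<in>carrier F. r \<odot>\<^bsub>M\<^esub> f x) \<in> module_homs R F M"
    if "f \<in> module_homs R F M" "r \<in> carrier R" for f r
    using D[OF that(1)] that(2)
    by (auto simp: module_homs_def M.smult_r_distr M.smult_assoc1[symmetric] F.R.m_comm)
  have cz: "(\<lambda>x\<in>carrier F. \<zero>\<^bsub>M\<^esub>) \<in> module_homs R F M" by (auto simp: module_homs_def)
  show ?thesis
  proof (rule moduleI)
    show "cring R" by (rule F.R.cring_axioms)
    show "abelian_group (hom_module R F M)"
    proof (rule abelian_groupI)
      fix f assume f: "f \<in> carrier (hom_module R F M)"
      then have "(\<lambda>x\<in>carrier F. (\<ominus>\<^bsub>R\<^esub> \<one>\<^bsub>R\<^esub>) \<odot>\<^bsub>M\<^esub> f x) \<in> module_homs R F M" by (intro cs) auto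
      moreover have "(\<lambda>x\<in>carrier F. (\<ominus>\<^bsub>R\<^esub> \<one>\<^bsub>R\<^esub>) \<odot>\<^bsub>M\<^esub> f x) \<oplus>\<^bsub>hom_module R F M\<^esub> f = \<zero>\<^bsub>hom_module R F M\<^esub>"
        using f D[of f R F M] by (auto simp: M.smult_l_minus M.M.l_neg fun_eq_iff)
      ultimately show "\<exists>g\<in>carrier (hom_module R F M). g \<oplus>\<^bsub>hom_module R F M\<^esub> f = \<zero>\<^bsub>hom_module R F M\<^esub>"
        by (metis hom_module_ops(1))
    next
      fix f assume f: "f \<in> carrier (hom_module R F M)"
      then have f': "f \<in> module_homs R F M" by simp
      show "\<zero>\<^bsub>hom_module R F M\<^esub> \<oplus>\<^bsub>hom_module R F M\<^esub> f = f"
        by (rule extensionalityI[OF _ module_homs_extensional[OF f']])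
          (auto simp: module_homsD(1)[OF f'])
    next
      fix f g h assume "f \<in> carrier (hom_module R F M)" "g \<in> carrier (hom_module R F M)"
        "h \<in> carrier (hom_module R F M)"
      then have "f x \<in> carrier M" "g x \<in> carrier M" "h x \<in> carrier M" if "x \<in> carrier F" for x
        using that by (auto dest: module_homsD(1))
      then show "f \<oplus>\<^bsub>hom_module R F M\<^esub> g \<oplus>\<^bsub>hom_module R F M\<^esub> h =
          f \<oplus>\<^bsub>hom_module R F M\<^esub> (g \<oplus>\<^bsub>hom_module R F M\<^esub> h)"
        "f \<oplus>\<^bsub>hom_module R F M\<^esub> g = g \<oplus>\<^bsub>hom_module R F M\<^esub> f"
        by (auto intro!: restrict_ext simp: M.M.a_assoc) (simp add: M.M.a_comm)
    qed (simp_all add: cl cz)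
  next
    fix f assume f: "f \<in> carrier (hom_module R F M)"
    show "\<one>\<^bsub>R\<^esub> \<odot>\<^bsub>hom_module R F M\<^esub> f = f"
      by (rule extensionalityI[of _ "carrier F"]) (use f in \<open>auto simp: module_homs_extensional dest: module_homsD(1)\<close>)
  next
    fix r f assume r: "r \<in> carrier R" and f: "f \<in> carrier (hom_module R F M)"
    then have fc: "f x \<in> carrier M" if "x \<in> carrier F" for x
      using that by (auto dest: module_homsD(1))
    show "r \<odot>\<^bsub>hom_module R F M\<^esub> f \<in> carrier (hom_module R F M)" using cs r f by simp
    { fix q assume "q \<in> carrier R"
      then show "(r \<oplus>\<^bsub>R\<^esub> q) \<odot>\<^bsub>hom_module R F M\<^esub> f =
          r \<odot>\<^bsub>hom_module R F M\<^esub> f \<oplus>\<^bsub>hom_module R F M\<^esub> q \<odot>\<^bsub>hom_module R F M\<^esub> f"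
        "r \<otimes>\<^bsub>R\<^esub> q \<odot>\<^bsub>hom_module R F M\<^esub> f = r \<odot>\<^bsub>hom_module R F M\<^esub> (q \<odot>\<^bsub>hom_module R F M\<^esub> f)"
        using r fc by (auto intro!: restrict_ext simp: M.smult_l_distr M.smult_assoc1) }
    fix g assume "g \<in> carrier (hom_module R F M)"
    then have "g x \<in> carrier M" if "x \<in> carrier F" for x
      using that by (auto dest: module_homsD(1))
    then show "r \<odot>\<^bsub>hom_module R F M\<^esub> (f \<oplus>\<^bsub>hom_module R F M\<^esub> g) =
        r \<odot>\<^bsub>hom_module R F M\<^esub> f \<oplus>\<^bsub>hom_module R F M\<^esub> r \<odot>\<^bsub>hom_module R F M\<^esub> g"
      using r fc by (auto intro!: restrict_ext simp: M.smult_r_distr)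
  qed
qed

text \<open>\<open>Hom(R ^ B, M)\<close> is a finite power of \<open>M\<close>. Rather than forming
  products, homomorphisms are filtered by the set \<open>A\<close> of basis vectors on which they
  may be nonzero; evaluation at a new \<open>b\<close> has the previous stage as kernel and takes
  values in \<open>M\<close>.\<close>

lemma (in noetherian_rmodule) minimax_hom_of_finite_free:
  fixes B :: "'x set"
  assumes "finite B" and mm: "minimax_submodule R M (carrier M)"
  shows "minimax_submodule R (hom_module R (free_module R B) M) (module_homs R (free_module R B) M)"
proof -
  let ?F = "free_module R B" and ?H = "hom_module R (free_module R B) M"
  note F = R.module_free_module[of B]
  interpret H: rmodule R ?H by (rule rmoduleI[OF module_hom_module[OF F module_axioms]])
  have ev: "linear_map R ?H M (\<lambda>f. f (free_unit R b))" if "b \<in> B" for b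
    using R.free_unit_closed[OF that]
    by unfold_locales (auto simp: module_homsD(1))
  define H where "H A = {f \<in> module_homs R ?F M. \<forall>b\<in>B - A. f (free_unit R b) = \<zero>\<^bsub>M\<^esub>}" for A
  have sub: "submodule (H A) R ?H" for A
    unfolding H_def using H.M.zero_closed H.M.a_closed H.smult_closed
    by (intro H.submoduleI') (auto simp: R.free_unit_closed)
  have "minimax_submodule R ?H (H A)" if "finite A" "A \<subseteq> B" for A
    using that
  proof (induction A)
    case empty
    have "f = \<zero>\<^bsub>?H\<^esub>" if f: "f \<in> H {}" for f
    proof (rule extensionalityI[of _ "carrier ?F"])
      have fh: "f \<in> module_homs R ?F M" using f by (simp add: H_def)
      interpret f: linear_map R ?F M f by (rule linear_mapI[OF F module_axioms fh])
      have zero: "linear_map R ?F M (\<lambda>_. \<zero>\<^bsub>M\<^esub>)" by unfold_locales auto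
      then show "f x = \<zero>\<^bsub>?H\<^esub> x" if "x \<in> carrier ?F" for x
        using eq_on_free_module[OF f.linear_map_axioms zero _ that] f that by (auto simp: H_def)
      show "f \<in> extensional (carrier ?F)" by (rule module_homs_extensional[OF fh])
    qed auto
    then have "H {} \<subseteq> {\<zero>\<^bsub>?H\<^esub>}" by blast
    then have "H {} = {\<zero>\<^bsub>?H\<^esub>}" using H.submodule_zero[OF sub] by blast
    then show ?case unfolding minimax_submodule_def
      by (intro exI[of _ "{}"]) (simp add: H.span_empty dcc_between_refl del: hom_module_ops)
  next
    case (insert b A)
    then have b: "b \<in> B" by simp
    interpret ev: linear_map R ?H M "\<lambda>f. f (free_unit R b)" by (rule ev[OF b])
    show ?case
    proof (rule ev.minimax_submodule_extension[OF sub])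
      have "H (insert b A) \<inter> {f \<in> carrier ?H. f (free_unit R b) = \<zero>\<^bsub>M\<^esub>} = H A"
        using b insert.hyps by (auto simp: H_def)
      then show "minimax_submodule R ?H (H (insert b A) \<inter> {f \<in> carrier ?H. f (free_unit R b) = \<zero>\<^bsub>M\<^esub>})"
        using insert by simp
      show "minimax_submodule R M ((\<lambda>f. f (free_unit R b)) ` H (insert b A))"
        using ev.image_submodule[OF sub]
        by (rule minimax_submodule_subset[OF carrier_is_submodule _ submodule_subset mm]) (rule ev.image_submodule[OF sub])
    qed
  qed
  from this[OF assms(1) order_refl] show ?thesis by (simp add: H_def)
qed

section \<open>Free resolutions and Ext\<close>

lemma linear_map_comp:
  assumes "linear_map R L M f" "linear_map R M N g"
  shows "linear_map R L N (\<lambda>x. g (f x))"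
proof -
  interpret f: linear_map R L M f by fact
  interpret g: linear_map R M N g by fact
  show ?thesis by unfold_locales (auto simp: f.map_add f.map_smult g.map_add g.map_smult)
qed

lemma linear_map_diff:
  assumes "linear_map R M N f" "linear_map R M N g"
  shows "linear_map R M N (\<lambda>x. f x \<ominus>\<^bsub>N\<^esub> g x)"
proof -
  interpret f: linear_map R M N f by fact
  interpret g: linear_map R M N g by fact
  show ?thesis
    by unfold_locales
      (auto simp: f.map_add f.map_smult g.map_add g.map_smult a_minus_def f.N.smult_r_distr
        f.N.smult_r_minus f.N.M.minus_add f.N.M.a_ac)
qed

lemma (in rmodule) eq_of_diff_zero:
  assumes "x \<in> carrier M" "y \<in> carrier M" "x \<ominus>\<^bsub>M\<^esub> y = \<zero>\<^bsub>M\<^esub>"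
  shows "x = y"
proof -
  have "x = (x \<ominus>\<^bsub>M\<^esub> y) \<oplus>\<^bsub>M\<^esub> y"
    using assms(1,2) by (simp add: a_minus_def M.a_assoc M.l_neg)
  then show ?thesis using assms by simp
qed

lemma (in rmodule) linear_map_id: "linear_map R M M (\<lambda>x. x)"
  by unfold_locales auto

lemma compose_module_homs:
  assumes "module R L" "f \<in> module_homs R L M" "g \<in> module_homs R M N"
  shows "compose (carrier L) g f \<in> module_homs R L N"
proof -
  interpret L: rmodule R L using assms(1) by (rule rmoduleI)
  note f = module_homsD[OF assms(2)] and g = module_homsD[OF assms(3)]
  show ?thesis by (auto simp: module_homs_def compose_def f g)
qed

lemma precompose_linear_map:
  assumes "module R L" "module R M" "module R N" "f \<in> module_homs R L M"
  shows "linear_map R (hom_module R M N) (hom_module R L N) (\<lambda>g. compose (carrier L) g f)"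
proof -
  interpret L: rmodule R L using assms(1) by (rule rmoduleI)
  interpret HM: rmodule R "hom_module R M N" using module_hom_module[OF assms(2,3)] by (rule rmoduleI)
  interpret HL: rmodule R "hom_module R L N" using module_hom_module[OF assms(1,3)] by (rule rmoduleI)
  show ?thesis
  proof (unfold_locales)
    fix g assume "g \<in> carrier (hom_module R M N)"
    then show "compose (carrier L) g f \<in> carrier (hom_module R L N)"
      using compose_module_homs[OF assms(1,4)] by simp
  qed (auto simp: compose_def fun_eq_iff module_homsD(1)[OF assms(4)])
qed

lemma (in linear_map) restrict_linear_map:
  assumes "submodule S R M" "submodule T R N" "\<And>x. x \<in> S \<Longrightarrow> f x \<in> T"
  shows "linear_map R (M\<lparr>carrier := S\<rparr>) (N\<lparr>carrier := T\<rparr>) f"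
proof -
  note S = M.submodule_carrier[OF assms(1)]
  show ?thesis
    using module_restrict[OF M.module_axioms assms(1)] module_restrict[OF N.module_axioms assms(2)] S assms(3)
    by (auto simp: linear_map_def linear_map_axioms_def rmodule_def map_add map_smult)
qed

section \<open>Comparison of free resolutions up to homotopy\<close>

locale resolution = N: rmodule R N
  for R :: "('r, 'z) ring_scheme" (structure) and N :: "('r, 'n) module" +
  fixes B :: "nat \<Rightarrow> 'x set" and d :: "nat \<Rightarrow> ('x \<Rightarrow> 'r) \<Rightarrow> 'x \<Rightarrow> 'r" and e :: "('x \<Rightarrow> 'r) \<Rightarrow> 'n"
  assumes free_resolution: "free_resolution R N B d e"
begin

abbreviation F :: "nat \<Rightarrow> ('r, 'x \<Rightarrow> 'r) module" where
  "F i \<equiv> free_module R (B i)"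

lemma module_F: "module R (F i)"
  by (rule N.R.module_free_module)

lemma e_hom: "e \<in> module_homs R (F 0) N"
  and e_surj: "e ` carrier (F 0) = carrier N"
  and d_hom: "d i \<in> module_homs R (F (Suc i)) (F i)"
  using free_resolution by (auto simp: free_resolution_def)

lemma e_linear: "linear_map R (F 0) N e"
  by (rule linear_mapI[OF module_F N.module_axioms e_hom])

lemma d_linear: "linear_map R (F (Suc i)) (F i) (d i)"
  by (rule linear_mapI[OF module_F module_F d_hom])

lemma exact_0: "d 0 ` carrier (F (Suc 0)) = {x \<in> carrier (F 0). e x = \<zero>\<^bsub>N\<^esub>}"
  using free_resolution by (auto simp: free_resolution_def module_ker_def)

lemma exact_Suc:
  "d (Suc i) ` carrier (F (Suc (Suc i))) = {x \<in> carrier (F (Suc i)). d i x = \<zero>\<^bsub>F i\<^esub>}"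
  using free_resolution by (simp add: free_resolution_def module_ker_def)

lemma e_d: "x \<in> carrier (F (Suc 0)) \<Longrightarrow> e (d 0 x) = \<zero>\<^bsub>N\<^esub>"
  using exact_0 by blast

lemma d_d: "x \<in> carrier (F (Suc (Suc i))) \<Longrightarrow> d i (d (Suc i) x) = \<zero>\<^bsub>F i\<^esub>"
  using exact_Suc[of i] by blast

lemma d_closed: "x \<in> carrier (F (Suc i)) \<Longrightarrow> d i x \<in> carrier (F i)"
  by (rule module_homsD(1)[OF d_hom])

end

lemma comparison_map:
  assumes "resolution R N B d e" "resolution R N B' d' e'"
  shows "\<exists>\<alpha>. (\<forall>i. \<alpha> i \<in> module_homs R (free_module R (B i)) (free_module R (B' i))) \<and>
    (\<forall>x\<in>carrier (free_module R (B 0)). e' (\<alpha> 0 x) = e x) \<and>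
    (\<forall>i. \<forall>x\<in>carrier (free_module R (B (Suc i))). d' i (\<alpha> (Suc i) x) = \<alpha> i (d i x))"
proof -
  interpret F: resolution R N B d e by fact
  interpret G: resolution R N B' d' e' by fact
  \<comment> \<open>The last clause of \<open>?P\<close> is what the next choice needs:
    \<open>\<alpha>\<close> after \<open>d i\<close> takes values in the image of
    \<open>d' i\<close>, hence lifts along it.\<close>
  let ?P = "\<lambda>i \<alpha>. \<alpha> \<in> module_homs R (F.F i) (G.F i) \<and>
    (i = 0 \<longrightarrow> (\<forall>x\<in>carrier (F.F 0). e' (\<alpha> x) = e x)) \<and>
    (\<forall>y\<in>carrier (F.F (Suc i)). \<alpha> (d i y) \<in> d' i ` carrier (G.F (Suc i)))"
  let ?Q = "\<lambda>i \<alpha> \<alpha>'. \<forall>x\<in>carrier (F.F (Suc i)). d' i (\<alpha>' x) = \<alpha> (d i x)"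
  have "\<exists>\<alpha>. \<forall>i. ?P i (\<alpha> i) \<and> ?Q i (\<alpha> i) (\<alpha> (Suc i))"
  proof (rule dependent_nat_choice)
    have "\<exists>\<alpha>\<in>module_homs R (F.F 0) (G.F 0). \<forall>x\<in>carrier (F.F 0). e' (\<alpha> x) = e x"
      using module_homsD(1)[OF F.e_hom] G.e_surj by (intro free_module_lift[OF G.e_linear F.e_linear]) simp
    then obtain \<alpha> where \<alpha>: "\<alpha> \<in> module_homs R (F.F 0) (G.F 0)" "\<And>x. x \<in> carrier (F.F 0) \<Longrightarrow> e' (\<alpha> x) = e x"
      by blast
    have "\<alpha> (d 0 y) \<in> d' 0 ` carrier (G.F (Suc 0))" if y: "y \<in> carrier (F.F (Suc 0))" for y
      unfolding G.exact_0 using \<alpha>(2)[OF F.d_closed[OF y]] F.e_d[OF y] module_homsD(1)[OF \<alpha>(1) F.d_closed[OF y]]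
      by simp
    then show "\<exists>\<alpha>. ?P 0 \<alpha>" using \<alpha> by blast
  next
    fix \<alpha> i assume P: "?P i \<alpha>"
    interpret \<alpha>: linear_map R "F.F i" "G.F i" \<alpha>
      by (rule linear_mapI[OF F.module_F G.module_F]) (use P in blast)
    have "\<exists>\<alpha>'\<in>module_homs R (F.F (Suc i)) (G.F (Suc i)).
        \<forall>x\<in>carrier (F.F (Suc i)). d' i (\<alpha>' x) = \<alpha> (d i x)"
      using P by (intro free_module_lift[OF G.d_linear linear_map_comp[OF F.d_linear \<alpha>.linear_map_axioms]]) blast
    then obtain \<alpha>' where \<alpha>': "\<alpha>' \<in> module_homs R (F.F (Suc i)) (G.F (Suc i))" "?Q i \<alpha> \<alpha>'" by blast
    have "\<alpha>' (d (Suc i) y) \<in> d' (Suc i) ` carrier (G.F (Suc (Suc i)))"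
      if y: "y \<in> carrier (F.F (Suc (Suc i)))" for y
    proof -
      have dy: "d (Suc i) y \<in> carrier (F.F (Suc i))" by (rule F.d_closed[OF y])
      have "d' i (\<alpha>' (d (Suc i) y)) = \<alpha> (d i (d (Suc i) y))" using \<alpha>'(2) dy by blast
      also have "\<dots> = \<zero>\<^bsub>G.F i\<^esub>" using F.d_d[OF y] by simp
      finally show ?thesis unfolding G.exact_Suc using module_homsD(1)[OF \<alpha>'(1) dy] by simp
    qed
    then show "\<exists>\<alpha>'. ?P (Suc i) \<alpha>' \<and> ?Q i \<alpha> \<alpha>'" using \<alpha>' by blast
  qed
  then obtain \<alpha> where \<alpha>: "\<forall>i. ?P i (\<alpha> i) \<and> ?Q i (\<alpha> i) (\<alpha> (Suc i))" by (rule exE)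
  have "?P i (\<alpha> i)" "?Q i (\<alpha> i) (\<alpha> (Suc i))" for i 
    by (rule conjunct1[OF spec[OF \<alpha>]], rule conjunct2[OF spec[OF \<alpha>]])
  then show ?thesis by (intro exI[of _ \<alpha>]) simp
qed

text \<open>A chain map over the zero map of \<open>N\<close> satisfies
  \<open>\<rho> = d h + h d\<close>, where the term \<open>h d\<close> is absent in degree
  0.\<close>

lemma (in resolution) null_homotopy:
  assumes \<rho>: "\<And>i. linear_map R (F i) (F i) (\<rho> i)"
    and \<rho>e: "\<And>x. x \<in> carrier (F 0) \<Longrightarrow> e (\<rho> 0 x) = \<zero>\<^bsub>N\<^esub>"
    and \<rho>d: "\<And>i x. x \<in> carrier (F (Suc i)) \<Longrightarrow> d i (\<rho> (Suc i) x) = \<rho> i (d i x)"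
  shows "\<exists>h. (\<forall>i. h i \<in> module_homs R (F i) (F (Suc i))) \<and>
    (\<forall>x\<in>carrier (F 0). d 0 (h 0 x) = \<rho> 0 x) \<and>
    (\<forall>i. \<forall>x\<in>carrier (F (Suc i)). d (Suc i) (h (Suc i) x) = \<rho> (Suc i) x \<ominus>\<^bsub>F (Suc i)\<^esub> h i (d i x))"
proof -
  \<comment> \<open>The last clause, \<open>d h d = \<rho> d\<close>, says that
    \<open>\<rho> - h d\<close> takes values in the kernel of \<open>d i\<close> one degree higher,
    so exactness provides the next lift.\<close>
  let ?P = "\<lambda>i h. h \<in> module_homs R (F i) (F (Suc i)) \<and>
    (i = 0 \<longrightarrow> (\<forall>x\<in>carrier (F 0). d 0 (h x) = \<rho> 0 x)) \<and>
    (\<forall>y\<in>carrier (F (Suc i)). d i (h (d i y)) = \<rho> i (d i y))"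
  let ?Q = "\<lambda>i h h'. \<forall>x\<in>carrier (F (Suc i)). d (Suc i) (h' x) = \<rho> (Suc i) x \<ominus>\<^bsub>F (Suc i)\<^esub> h (d i x)"
  have cl: "\<rho> i x \<in> carrier (F i)" if "x \<in> carrier (F i)" for i x
  proof -
    interpret \<rho>: linear_map R "F i" "F i" "\<rho> i" by (rule \<rho>)
    show ?thesis using that by blast
  qed
  have "\<exists>h. \<forall>i. ?P i (h i) \<and> ?Q i (h i) (h (Suc i))"
  proof (rule dependent_nat_choice)
    have "\<exists>h\<in>module_homs R (F 0) (F (Suc 0)). \<forall>x\<in>carrier (F 0). d 0 (h x) = \<rho> 0 x"
      by (rule free_module_lift[OF d_linear \<rho>]) (use \<rho>e cl in \<open>auto simp: exact_0\<close>)
    then show "\<exists>h. ?P 0 h" using d_closed by blast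
  next
    fix h i assume P: "?P i h"
    have hl: "linear_map R (F i) (F (Suc i)) h"
      by (rule linear_mapI[OF module_F module_F]) (use P in blast)
    interpret h: linear_map R "F i" "F (Suc i)" h by (rule hl)
    interpret d: linear_map R "F (Suc i)" "F i" "d i" by (rule d_linear)
    have "\<exists>h'\<in>module_homs R (F (Suc i)) (F (Suc (Suc i))).
        \<forall>x\<in>carrier (F (Suc i)). d (Suc i) (h' x) = \<rho> (Suc i) x \<ominus>\<^bsub>F (Suc i)\<^esub> h (d i x)"
    proof (rule free_module_lift[OF d_linear linear_map_diff[OF \<rho> linear_map_comp[OF d_linear hl]]])
      fix x assume x: "x \<in> carrier (F (Suc i))"
      have "d i (\<rho> (Suc i) x \<ominus>\<^bsub>F (Suc i)\<^esub> h (d i x)) = \<rho> i (d i x) \<ominus>\<^bsub>F i\<^esub> d i (h (d i x))"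
        using x cl[OF x] \<rho>d by (simp add: d.map_diff)
      also have "\<dots> = \<zero>\<^bsub>F i\<^esub>"
        using P x cl[of "d i x" i] by (simp add: a_minus_def h.M.M.r_neg)
      finally show "\<rho> (Suc i) x \<ominus>\<^bsub>F (Suc i)\<^esub> h (d i x) \<in> d (Suc i) ` carrier (F (Suc (Suc i)))"
        unfolding exact_Suc using x cl[OF x] by simp
    qed
    then obtain h' where h': "h' \<in> module_homs R (F (Suc i)) (F (Suc (Suc i)))" "?Q i h h'" by blast
    have "d (Suc i) (h' (d (Suc i) y)) = \<rho> (Suc i) (d (Suc i) y)" if y: "y \<in> carrier (F (Suc (Suc i)))" for y
    proof -
      have dy: "d (Suc i) y \<in> carrier (F (Suc i))" by (rule d_closed[OF y])
      have "d (Suc i) (h' (d (Suc i) y)) = \<rho> (Suc i) (d (Suc i) y) \<ominus>\<^bsub>F (Suc i)\<^esub> h (d i (d (Suc i) y))"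
        using h'(2) dy by blast
      also have "\<dots> = \<rho> (Suc i) (d (Suc i) y)"
        using d_d[OF y] cl[OF dy] by (simp add: a_minus_def)
      finally show ?thesis .
    qed
    then show "\<exists>h'. ?P (Suc i) h' \<and> ?Q i h h'" using h' by blast
  qed
  then obtain h where h: "\<forall>i. ?P i (h i) \<and> ?Q i (h i) (h (Suc i))" by (rule exE)
  have "?P i (h i)" "?Q i (h i) (h (Suc i))" for i 
    by (rule conjunct1[OF spec[OF h]], rule conjunct2[OF spec[OF h]])
  then show ?thesis by (intro exI[of _ h]) simp
qed

section \<open>Cohomology with coefficients in a module\<close>

locale resolution_coefficients = resolution R N B d e + M: rmodule R M
  for R :: "('r, 'z) ring_scheme" (structure) and N :: "('r, 'n) module"
    and B :: "nat \<Rightarrow> 'x set" and d e and M :: "('r, 'm) module"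
begin

abbreviation H :: "nat \<Rightarrow> ('r, ('x \<Rightarrow> 'r) \<Rightarrow> 'm) module" where
  "H i \<equiv> hom_module R (F i) M"

lemma module_H: "module R (H i)"
  by (rule module_hom_module[OF module_F M.module_axioms])

lemma cocycles_iff:
  "f \<in> hom_cocycles R B d M i \<longleftrightarrow>
    f \<in> module_homs R (F i) M \<and> (\<forall>x\<in>carrier (F (Suc i)). f (d i x) = \<zero>\<^bsub>M\<^esub>)"
  by (auto simp: hom_cocycles_def compose_def restrict_def fun_eq_iff)

lemma cocycles_submodule: "submodule (hom_cocycles R B d M i) R (H i)"
proof -
  interpret H: rmodule R "H i" by (rule rmoduleI[OF module_H])
  show ?thesis
    using H.M.zero_closed H.M.a_closed H.smult_closed d_closed
    by (intro H.submoduleI') (auto simp: cocycles_iff)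
qed

abbreviation Z :: "nat \<Rightarrow> ('r, ('x \<Rightarrow> 'r) \<Rightarrow> 'm) module" where
  "Z i \<equiv> (H i)\<lparr>carrier := hom_cocycles R B d M i\<rparr>"

lemma module_Z: "module R (Z i)"
  by (rule module_restrict[OF module_H cocycles_submodule])

lemma coboundaries_submodule: "submodule (hom_coboundaries R B d M i) R (Z i)"
proof (cases i)
  case 0
  interpret Z: rmodule R "Z i" by (rule rmoduleI[OF module_Z])
  show ?thesis using Z.zero_submodule by (simp add: 0)
next
  case (Suc j)
  have "submodule (hom_coboundaries R B d M i) R (H i)"
    using linear_map.image_submodule[OF precompose_linear_map[OF module_F module_F M.module_axioms d_hom]
        module.carrier_is_submodule[OF module_H]]
    by (simp add: Suc)
  moreover have "hom_coboundaries R B d M i \<subseteq> hom_cocycles R B d M i"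
  proof
    fix f assume "f \<in> hom_coboundaries R B d M i"
    then obtain g where g: "g \<in> module_homs R (F j) M" "f = compose (carrier (F (Suc j))) g (d j)"
      by (auto simp: Suc)
    interpret g: linear_map R "F j" M g by (rule linear_mapI[OF module_F M.module_axioms g(1)])
    have "f \<in> module_homs R (F i) M" unfolding g(2) Suc by (rule compose_module_homs[OF module_F d_hom g(1)])
    moreover have "f (d i x) = \<zero>\<^bsub>M\<^esub>" if "x \<in> carrier (F (Suc i))" for x
      using that d_closed[of x i] d_d[of x j] by (simp add: g(2) Suc compose_def)
    ultimately show "f \<in> hom_cocycles R B d M i" by (simp add: cocycles_iff)
  qed
  ultimately show ?thesis by (simp add: submodule_restrict_iff[OF module_H cocycles_submodule])
qed

lemma cohomology_projection:
  shows "linear_map R (Z i) (hom_cohomology R B d M i)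
      (\<lambda>f. hom_coboundaries R B d M i +>\<^bsub>Z i\<^esub> f)"
    and "{f \<in> hom_cocycles R B d M i. hom_coboundaries R B d M i +>\<^bsub>Z i\<^esub> f = \<zero>\<^bsub>hom_cohomology R B d M i\<^esub>} =
      hom_coboundaries R B d M i"
    and "(\<lambda>f. hom_coboundaries R B d M i +>\<^bsub>Z i\<^esub> f) ` hom_cocycles R B d M i =
      carrier (hom_cohomology R B d M i)"
proof -
  interpret Z: rmodule R "Z i" by (rule rmoduleI[OF module_Z])
  note q = Z.quot_module_linear_map[OF coboundaries_submodule]
  show "linear_map R (Z i) (hom_cohomology R B d M i) (\<lambda>f. hom_coboundaries R B d M i +>\<^bsub>Z i\<^esub> f)"
    using q(1) unfolding hom_cohomology_def .
  show "{f \<in> hom_cocycles R B d M i. hom_coboundaries R B d M i +>\<^bsub>Z i\<^esub> f = \<zero>\<^bsub>hom_cohomology R B d M i\<^esub>} =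
      hom_coboundaries R B d M i"
    using q(2) unfolding hom_cohomology_def module_ker_def by simp
  show "(\<lambda>f. hom_coboundaries R B d M i +>\<^bsub>Z i\<^esub> f) ` hom_cocycles R B d M i =
      carrier (hom_cohomology R B d M i)"
    using q(3) unfolding hom_cohomology_def by simp
qed

end

text \<open>With \<open>\<alpha> : F \<rightarrow> G\<close> and \<open>\<beta> : G \<rightarrow> F\<close> lifting the identity of \<open>N\<close>, every cocycle \<open>z\<close> on \<open>F\<close>
  is cohomologous to \<open>z \<circ> \<beta> \<circ> \<alpha>\<close>, so the cohomology of \<open>F\<close> is an image of the cocycles on \<open>G\<close>.\<close>

lemma minimax_cohomology:
  assumes res: "resolution R N B d e" "resolution R N B' d' e'" and fin: "\<And>i. finite (B' i)"
    and M: "noetherian_rmodule R M" and mm: "minimax_module R M"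
  shows "minimax_module R (hom_cohomology R B d M i)"
proof -
  interpret M: noetherian_rmodule R M by (rule M)
  interpret F: resolution_coefficients R N B d e M
    using res(1) M.rmodule_axioms by (simp add: resolution_coefficients_def)
  interpret G: resolution_coefficients R N B' d' e' M
    using res(2) M.rmodule_axioms by (simp add: resolution_coefficients_def)
  obtain \<alpha> where \<alpha>: "\<And>i. \<alpha> i \<in> module_homs R (F.F i) (G.F i)"
    "\<And>x. x \<in> carrier (F.F 0) \<Longrightarrow> e' (\<alpha> 0 x) = e x"
    "\<And>i x. x \<in> carrier (F.F (Suc i)) \<Longrightarrow> d' i (\<alpha> (Suc i) x) = \<alpha> i (d i x)"
    using comparison_map[OF res] by blast
  obtain \<beta> where \<beta>: "\<And>i. \<beta> i \<in> module_homs R (G.F i) (F.F i)"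
    "\<And>x. x \<in> carrier (G.F 0) \<Longrightarrow> e (\<beta> 0 x) = e' x"
    "\<And>i x. x \<in> carrier (G.F (Suc i)) \<Longrightarrow> d i (\<beta> (Suc i) x) = \<beta> i (d' i x)"
    using comparison_map[OF res(2,1)] by blast
  note \<alpha>c = module_homsD(1)[OF \<alpha>(1)] and \<beta>c = module_homsD(1)[OF \<beta>(1)]
  \<comment> \<open>The defect \<open>id - \<beta> \<alpha>\<close>: both \<open>\<alpha>\<close>
    and \<open>\<beta>\<close> lift the identity of \<open>N\<close>, so \<open>\<rho>\<close> lifts
    zero and is null-homotopic.\<close>
  define \<rho> where "\<rho> i x = x \<ominus>\<^bsub>F.F i\<^esub> \<beta> i (\<alpha> i x)" for i x
  note mF = F.module_F[THEN rmoduleI]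
  have \<rho>: "linear_map R (F.F i) (F.F i) (\<rho> i)" for i
    unfolding \<rho>_def
    by (rule linear_map_diff[OF rmodule.linear_map_id[OF mF]
          linear_map_comp[OF linear_mapI[OF F.module_F G.module_F \<alpha>(1)]
            linear_mapI[OF G.module_F F.module_F \<beta>(1)]]])
  have "\<exists>h. (\<forall>i. h i \<in> module_homs R (F.F i) (F.F (Suc i))) \<and>
    (\<forall>x\<in>carrier (F.F 0). d 0 (h 0 x) = \<rho> 0 x) \<and>
    (\<forall>i. \<forall>x\<in>carrier (F.F (Suc i)). d (Suc i) (h (Suc i) x) = \<rho> (Suc i) x \<ominus>\<^bsub>F.F (Suc i)\<^esub> h i (d i x))"
  proof (rule F.null_homotopy[OF \<rho>])
    fix x assume x: "x \<in> carrier (F.F 0)"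
    interpret e: linear_map R "F.F 0" N e by (rule F.e_linear)
    have "e (\<rho> 0 x) = e x \<ominus>\<^bsub>N\<^esub> e (\<beta> 0 (\<alpha> 0 x))"
      unfolding \<rho>_def using x \<alpha>c \<beta>c by (simp add: e.map_diff)
    then show "e (\<rho> 0 x) = \<zero>\<^bsub>N\<^esub>"
      using x \<alpha>c \<beta>(2) \<alpha>(2) by (simp add: a_minus_def F.N.M.r_neg)
  next
    fix i x assume x: "x \<in> carrier (F.F (Suc i))"
    interpret d: linear_map R "F.F (Suc i)" "F.F i" "d i" by (rule F.d_linear)
    show "d i (\<rho> (Suc i) x) = \<rho> i (d i x)"
      unfolding \<rho>_def using x \<alpha>c \<beta>c \<beta>(3) \<alpha>(3) by (simp add: d.map_diff)
  qed
  then obtain h where h: "\<And>i. h i \<in> module_homs R (F.F i) (F.F (Suc i))"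
    "\<And>x. x \<in> carrier (F.F 0) \<Longrightarrow> d 0 (h 0 x) = \<rho> 0 x"
    "\<And>i x. x \<in> carrier (F.F (Suc i)) \<Longrightarrow>
      d (Suc i) (h (Suc i) x) = \<rho> (Suc i) x \<ominus>\<^bsub>F.F (Suc i)\<^esub> h i (d i x)"
    by blast
  let ?ZF = "hom_cocycles R B d M" and ?ZG = "hom_cocycles R B' d' M"
  let ?c = "\<lambda>f. compose (carrier (F.F i)) f (\<alpha> i)"
  let ?D = "hom_coboundaries R B d M i"
  let ?p = "\<lambda>f. ?D +>\<^bsub>F.Z i\<^esub> f"
  have c: "linear_map R (G.H i) (F.H i) ?c"
    by (rule precompose_linear_map[OF F.module_F G.module_F M.module_axioms \<alpha>(1)])
  have cZ: "?c f \<in> ?ZF i" if "f \<in> ?ZG i" for f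
  proof -
    have f: "f \<in> module_homs R (G.F i) M" "\<And>y. y \<in> carrier (G.F (Suc i)) \<Longrightarrow> f (d' i y) = \<zero>\<^bsub>M\<^esub>"
      using that by (auto simp: G.cocycles_iff)
    show ?thesis
      using compose_module_homs[OF F.module_F \<alpha>(1) f(1)] f(2) F.d_closed \<alpha>(3)[symmetric] \<alpha>c
      by (simp add: F.cocycles_iff compose_def)
  qed
  interpret cZ: linear_map R "G.Z i" "F.Z i" ?c
    by (rule linear_map.restrict_linear_map[OF c G.cocycles_submodule F.cocycles_submodule cZ])
  interpret p: linear_map R "F.Z i" "hom_cohomology R B d M i" ?p by (rule F.cohomology_projection(1))
  interpret pc: linear_map R "G.Z i" "hom_cohomology R B d M i" "\<lambda>f. ?p (?c f)"
    by (rule linear_map_comp[OF cZ.linear_map_axioms p.linear_map_axioms])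
  have surj: "(\<lambda>f. ?p (?c f)) ` ?ZG i = carrier (hom_cohomology R B d M i)"
  proof
    show "(\<lambda>f. ?p (?c f)) ` ?ZG i \<subseteq> carrier (hom_cohomology R B d M i)" using pc.map_closed by auto
    show "carrier (hom_cohomology R B d M i) \<subseteq> (\<lambda>f. ?p (?c f)) ` ?ZG i"
      unfolding F.cohomology_projection(3)[symmetric]
    proof
      fix X assume "X \<in> ?p ` ?ZF i"
      then obtain z where z: "z \<in> ?ZF i" "X = ?p z" by blast
      have zh: "z \<in> module_homs R (F.F i) M" and zd: "\<And>y. y \<in> carrier (F.F (Suc i)) \<Longrightarrow> z (d i y) = \<zero>\<^bsub>M\<^esub>"
        using z(1) by (auto simp: F.cocycles_iff)
      interpret z: linear_map R "F.F i" M z by (rule linear_mapI[OF F.module_F M.module_axioms zh])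
      let ?f = "compose (carrier (G.F i)) z (\<beta> i)"
      have f: "?f \<in> ?ZG i"
        using compose_module_homs[OF G.module_F \<beta>(1) zh] zd G.d_closed \<beta>(3)[symmetric] \<beta>c
        by (simp add: G.cocycles_iff compose_def)
      \<comment> \<open>The difference between \<open>z\<close> and its transport through
        \<open>G\<close>, to be recognized as a coboundary.\<close>
      let ?w = "\<lambda>x\<in>carrier (F.F i). z (\<rho> i x)"
      have w: "?w \<in> ?D"
      proof (cases i)
        case 0
        \<comment> \<open>In degree 0 the homotopy identity is \<open>\<rho> = d h\<close>, so
          \<open>z \<rho> = z d h\<close> vanishes for the cocycle \<open>z\<close>.\<close>
        then have "?w = \<zero>\<^bsub>F.H 0\<^esub>"
          using h(2) zd module_homsD(1)[OF h(1)[of 0]] by (auto simp: fun_eq_iff h(2)[symmetric])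
        then show ?thesis by (simp add: 0)
      next
        case (Suc j)
        \<comment> \<open>Since \<open>z d = 0\<close>, the identity
          \<open>\<rho> = d h + h d\<close> becomes \<open>z \<rho> = (z h) d\<close>, which
          exhibits the primitive \<open>z h\<close>.\<close>
        let ?g = "compose (carrier (F.F j)) z (h j)"
        have g: "?g \<in> module_homs R (F.F j) M"
          using compose_module_homs[OF F.module_F h(1)[of j]] zh by (simp add: Suc)
        have "z (\<rho> i x) = z (h j (d j x))" if x: "x \<in> carrier (F.F i)" for x
        proof -
          interpret \<rho>: linear_map R "F.F i" "F.F i" "\<rho> i" by (rule \<rho>)
          have hx: "h i x \<in> carrier (F.F (Suc i))" "h j (d j x) \<in> carrier (F.F i)"
            using module_homsD(1)[OF h(1)] x F.d_closed[of x j] by (auto simp: Suc)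
          have "d i (h i x) = \<rho> i x \<ominus>\<^bsub>F.F i\<^esub> h j (d j x)" using h(3)[of x j] x by (simp add: Suc)
          then have "z (\<rho> i x) \<ominus>\<^bsub>M\<^esub> z (h j (d j x)) = \<zero>\<^bsub>M\<^esub>"
            using zd[OF hx(1)] x hx(2) by (simp add: z.map_diff)
          moreover have "z (\<rho> i x) \<in> carrier M" "z (h j (d j x)) \<in> carrier M" using x hx(2) by auto
          ultimately show ?thesis by (rule M.eq_of_diff_zero[rotated 2])
        qed
        then have "?w = compose (carrier (F.F i)) ?g (d j)"
          using F.d_closed[of _ j] by (auto simp: fun_eq_iff compose_def Suc)
        then show ?thesis using g by (auto simp: Suc)
      qed
      then have wZ: "?w \<in> ?ZF i" using cZ.N.submodule_subset[OF F.coboundaries_submodule] by auto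
      have pw: "?p ?w = \<zero>\<^bsub>hom_cohomology R B d M i\<^esub>" using w F.cohomology_projection(2) by blast
      have "z = ?c ?f \<oplus>\<^bsub>F.Z i\<^esub> ?w"
      proof (rule extensionalityI[OF module_homs_extensional[OF zh]])
        fix x assume x: "x \<in> carrier (F.F i)"
        have ba: "\<beta> i (\<alpha> i x) \<in> carrier (F.F i)" using x \<alpha>c \<beta>c by simp
        have "z (\<rho> i x) = z x \<ominus>\<^bsub>M\<^esub> z (\<beta> i (\<alpha> i x))" unfolding \<rho>_def using x ba by (simp add: z.map_diff)
        then have "z x = z (\<beta> i (\<alpha> i x)) \<oplus>\<^bsub>M\<^esub> z (\<rho> i x)"
          using x ba by (simp add: a_minus_def M.M.a_lcomm[of _ "z x"] M.M.r_neg)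
        then show "z x = (?c ?f \<oplus>\<^bsub>F.Z i\<^esub> ?w) x" using x \<alpha>c by (simp add: compose_def)
      qed (simp add: restrict_extensional)
      then have "?p z = ?p (?c ?f) \<oplus>\<^bsub>hom_cohomology R B d M i\<^esub> ?p ?w"
        using p.map_add[of "?c ?f" ?w] cZ[OF f] wZ by simp
      then have "?p z = ?p (?c ?f)" using pw p.map_closed[of "?c ?f"] cZ[OF f] by simp
      then show "X \<in> (\<lambda>f. ?p (?c f)) ` ?ZG i" using z(2) f by blast
    qed
  qed
  interpret HG: noetherian_rmodule R "G.H i"
    by (rule noetherian_rmodule.intro[OF rmoduleI[OF G.module_H] M.noetherian_cring_axioms])
  have "minimax_submodule R (G.H i) (module_homs R (G.F i) M)"
    by (rule M.minimax_hom_of_finite_free[OF fin]) (use mm M.minimax_module_iff in simp)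
  then have "minimax_submodule R (G.H i) (?ZG i)"
    using HG.minimax_submodule_subset[OF HG.carrier_is_submodule G.cocycles_submodule
        HG.submodule_subset[OF G.cocycles_submodule]] by simp
  then have "minimax_submodule R (G.Z i) (?ZG i)"
    by (simp add: minimax_submodule_restrict[OF G.module_H G.cocycles_submodule])
  then have "minimax_submodule R (hom_cohomology R B d M i) ((\<lambda>f. ?p (?c f)) ` ?ZG i)"
    using pc.minimax_submodule_image[OF cZ.M.carrier_is_submodule] by simp
  then show ?thesis unfolding surj p.N.minimax_module_iff .
qed

text \<open>The basis must be a set over the prescribed type \<open>'x\<close>; infinity of that
  type provides one with as many elements as \<open>S\<close>.\<close>

lemma (in rmodule) finite_free_cover:
  assumes "finite S" "S \<subseteq> carrier M" and inf: "infinite (UNIV :: 'x set)"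
  shows "\<exists>(B :: 'x set) \<phi>. finite B \<and> \<phi> \<in> module_homs R (free_module R B) M \<and>
    \<phi> ` carrier (free_module R B) = submodule_span R M S"
proof -
  obtain B :: "'x set" where B: "finite B" "card B = card S"
    using infinite_arbitrarily_large[OF inf] by blast
  then obtain g where g: "bij_betw g B S" using finite_same_card_bij[OF B(1) assms(1)] by auto
  then have gS: "g ` B = S" by (simp add: bij_betw_def)
  let ?F = "free_module R B"
  have "\<exists>\<phi>\<in>module_homs R ?F M. \<forall>b\<in>B. \<phi> (free_unit R b) = g b"
    by (rule free_module_extension) (use gS assms(2) in blast)
  then obtain \<phi> where \<phi>: "\<phi> \<in> module_homs R ?F M" "\<And>b. b \<in> B \<Longrightarrow> \<phi> (free_unit R b) = g b" by blast
  interpret \<phi>: linear_map R ?F M \<phi>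
    by (rule linear_mapI[OF R.module_free_module module_axioms \<phi>(1)])
  let ?S = "submodule_span R M S"
  have "g b \<in> ?S" if "b \<in> B" for b using that gS span_superset[of S] by blast
  then have "carrier ?F \<subseteq> {x \<in> carrier ?F. \<phi> x \<in> ?S}"
    by (intro R.free_module_generated \<phi>.vimage_submodule span_submodule assms(2))
      (simp add: R.free_unit_closed \<phi>(2))
  moreover have "S \<subseteq> \<phi> ` carrier ?F"
  proof
    fix s assume "s \<in> S"
    then obtain b where "b \<in> B" "s = g b" using gS by blast
    then show "s \<in> \<phi> ` carrier ?F"
      using \<phi>(2)[of b] imageI[OF R.free_unit_closed[of b B], of \<phi>] by simp
  qed
  then have "?S \<subseteq> \<phi> ` carrier ?F" by (intro span_least \<phi>.image_submodule \<phi>.M.carrier_is_submodule)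
  ultimately have "\<phi> ` carrier ?F = ?S" by blast
  then show ?thesis using B(1) \<phi>(1) by blast
qed

text \<open>The kernel lies in a finitely generated module over a Noetherian ring, so it has
  finitely many generators and again a finite free cover.\<close>

lemma (in noetherian_cring) finite_free_cover_of_kernel:
  fixes B :: "'x set" and \<phi> :: "('x \<Rightarrow> 'r) \<Rightarrow> 'n"
  assumes B: "finite B" and inf: "infinite (UNIV :: 'x set)"
    and N: "module R N" and \<phi>: "\<phi> \<in> module_homs R (free_module R B) N"
  shows "\<exists>(B' :: 'x set) \<phi>'. finite B' \<and> \<phi>' \<in> module_homs R (free_module R B') (free_module R B) \<and>
    \<phi>' ` carrier (free_module R B') = module_ker (free_module R B) N \<phi>"
proof -
  let ?F = "free_module R B"
  interpret F: noetherian_rmodule R ?F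
    by (rule noetherian_rmodule.intro[OF rmoduleI[OF module_free_module] noetherian_cring_axioms])
  interpret \<phi>: linear_map R ?F N \<phi> by (rule linear_mapI[OF module_free_module N \<phi>])
  let ?U = "free_unit R ` B"
  have U: "?U \<subseteq> carrier ?F" by (auto simp: free_unit_closed)
  have "carrier ?F \<subseteq> submodule_span R ?F ?U"
    using F.span_superset[of ?U] by (intro free_module_generated F.span_submodule U) auto
  then have "{x \<in> carrier ?F. \<phi> x = \<zero>\<^bsub>N\<^esub>} \<subseteq> submodule_span R ?F ?U" by blast
  from F.submodule_of_span[OF finite_imageI[OF B] U \<phi>.kernel_submodule this]
  obtain S where S: "finite S" "S \<subseteq> carrier ?F"
    "submodule_span R ?F S = {x \<in> carrier ?F. \<phi> x = \<zero>\<^bsub>N\<^esub>}" by (elim exE conjE)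
  show ?thesis using F.finite_free_cover[OF S(1,2) inf] S(3) by (simp add: module_ker_def)
qed

lemma (in noetherian_rmodule) exists_finite_free_resolution:
  assumes S: "finite S" "S \<subseteq> carrier M" "submodule_span R M S = carrier M"
    and inf: "infinite (UNIV :: 'x set)"
  shows "\<exists>(B :: nat \<Rightarrow> 'x set) d e. (\<forall>i. finite (B i)) \<and> free_resolution R M B d e"
proof -
  obtain B0 :: "'x set" and e where B0: "finite B0" "e \<in> module_homs R (free_module R B0) M"
    "e ` carrier (free_module R B0) = carrier M"
    using finite_free_cover[OF S(1,2) inf] unfolding S(3) by blast
  obtain B1 :: "'x set" and d0 where B1: "finite B1" "d0 \<in> module_homs R (free_module R B1) (free_module R B0)"
    "d0 ` carrier (free_module R B1) = module_ker (free_module R B0) M e"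
    using finite_free_cover_of_kernel[OF B0(1) inf module_axioms B0(2)] by blast
  \<comment> \<open>A state of the recursion is a differential \<open>f\<close> with the bases
    \<open>A\<close> of its target and \<open>C\<close> of its source. The clause for
    \<open>i = 0\<close> pins the first differential to the one covering the kernel of the
    augmentation.\<close>
  let ?P = "\<lambda>i (A :: 'x set, C :: 'x set, f). finite A \<and> finite C \<and>
    f \<in> module_homs R (free_module R C) (free_module R A) \<and> (i = (0::nat) \<longrightarrow> (A, C, f) = (B0, B1, d0))"
  let ?Q = "\<lambda>(i::nat) (A :: 'x set, C :: 'x set, f) (A', C' :: 'x set, f').
    A' = C \<and> f' ` carrier (free_module R C') = module_ker (free_module R C) (free_module R A) f"
  have "\<exists>s. \<forall>i. ?P i (s i) \<and> ?Q i (s i) (s (Suc i))"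
  proof (rule dependent_nat_choice)
    show "\<exists>s. ?P 0 s" using B0 B1 by auto
    fix s i assume P: "?P i s"
    obtain A C f where s: "s = (A, C, f)" by (cases s) auto
    have "finite C" "f \<in> module_homs R (free_module R C) (free_module R A)" using P s by auto
    from finite_free_cover_of_kernel[OF this(1) inf R.module_free_module this(2)]
    obtain C' :: "'x set" and f' where "finite C'" "f' \<in> module_homs R (free_module R C') (free_module R C)"
      "f' ` carrier (free_module R C') = module_ker (free_module R C) (free_module R A) f" by blast
    then show "\<exists>s'. ?P (Suc i) s' \<and> ?Q i s s'" using P s by (intro exI[of _ "(C, C', f')"]) auto
  qed
  then obtain s where s: "\<forall>i. ?P i (s i) \<and> ?Q i (s i) (s (Suc i))" by (rule exE)
  define B where "B i = fst (s i)" for i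
  define d where "d i = snd (snd (s i))" for i
  have s_eq: "s i = (B i, B (Suc i), d i)" for i
    using spec[OF s, of i] by (auto simp: B_def d_def split: prod.splits)
  have P: "finite (B i)" "d i \<in> module_homs R (free_module R (B (Suc i))) (free_module R (B i))"
    "d (Suc i) ` carrier (free_module R (B (Suc (Suc i)))) =
      module_ker (free_module R (B (Suc i))) (free_module R (B i)) (d i)" for i
    using spec[OF s, of i] unfolding s_eq by auto
  have "B 0 = B0" "B (Suc 0) = B1" "d 0 = d0" using spec[OF s, of 0] unfolding s_eq by auto
  then have "free_resolution R M B d e"
    unfolding free_resolution_def using P B0 B1 by auto
  then show ?thesis using P(1) by blast
qed

lemma (in cring) module_regular_module: "module R (regular_module R)"
  by (intro moduleI abelian_groupI cring_axioms)
    (auto simp: regular_module_def a_ac l_distr r_distr m_assoc intro: bexI[of _ "\<ominus> _"] l_neg)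

context noetherian_cring
begin

lemma regular_module_simps [simp]:
  "carrier (regular_module R) = carrier R" "\<zero>\<^bsub>regular_module R\<^esub> = \<zero>"
  "x \<oplus>\<^bsub>regular_module R\<^esub> y = x \<oplus> y" "x \<odot>\<^bsub>regular_module R\<^esub> y = x \<otimes> y"
  by (simp_all add: regular_module_def)

lemma ideal_submodule_regular: "ideal a R \<Longrightarrow> submodule a R (regular_module R)"
proof -
  assume "ideal a R"
  then interpret a: ideal a R .
  interpret L: rmodule R "regular_module R" by (rule rmoduleI[OF module_regular_module])
  show ?thesis by (rule L.submoduleI') (auto simp: a.I_l_closed)
qed

lemma quotient_ring_projection:
  assumes a: "ideal a R"
  obtains p where "linear_map R (regular_module R) (quot_module (regular_module R) a) p"
    "{r \<in> carrier R. p r = \<zero>\<^bsub>quot_module (regular_module R) a\<^esub>} = a"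
    "p ` carrier R = carrier (quot_module (regular_module R) a)"
proof -
  interpret L: rmodule R "regular_module R" by (rule rmoduleI[OF module_regular_module])
  show thesis
    using L.quot_module_linear_map[OF ideal_submodule_regular[OF a]]
    by (intro that) (simp_all add: module_ker_def)
qed

text \<open>\<open>B\<close> belongs to the resolution selected by \<open>SOME\<close> in
  \<open>Ext_module\<close> and may be infinite; \<open>B'\<close> is finite in each degree. The
  second resolution also witnesses that the selection has something to choose from.\<close>

lemma Ext_module_quotient_ring:
  fixes M :: "('r, 'm) module"
  assumes a: "ideal a R" and M: "module R M"
  shows "\<exists>(B :: nat \<Rightarrow> ('r \<times> 'r set) list set) d e B' d' e'.
    free_resolution R (quot_module (regular_module R) a) B d e \<and>
    free_resolution R (quot_module (regular_module R) a) (B' :: nat \<Rightarrow> ('r \<times> 'r set) list set) d' e' \<and>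
    (\<forall>i. finite (B' i)) \<and>
    (\<forall>i. Ext_module R i (quot_module (regular_module R) a) M = hom_cohomology R B d M i)"
proof -
  let ?N = "quot_module (regular_module R) a"
  obtain p where p: "linear_map R (regular_module R) ?N p" "p ` carrier R = carrier ?N"
    by (rule quotient_ring_projection[OF a])
  interpret p: linear_map R "regular_module R" ?N p by (rule p(1))
  interpret N: noetherian_rmodule R ?N
    by (rule noetherian_rmodule.intro[OF p.N.rmodule_axioms noetherian_cring_axioms])
  have p1: "p \<one> \<in> carrier ?N" by auto
  then have S: "submodule (submodule_span R ?N {p \<one>}) R ?N" by (intro p.N.span_submodule) simp
  have "p r \<in> submodule_span R ?N {p \<one>}" if "r \<in> carrier R" for r
  proof -
    have "p \<one> \<in> submodule_span R ?N {p \<one>}" using p.N.span_superset[of "{p \<one>}"] by blast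
    from p.N.submoduleE(4)[OF S that this] show ?thesis using p.map_smult[of r \<one>] that by simp
  qed
  then have "p ` carrier R \<subseteq> submodule_span R ?N {p \<one>}" by (rule image_subsetI)
  then have span: "submodule_span R ?N {p \<one>} = carrier ?N"
    using p.N.submodule_subset[OF S] unfolding p(2) by (rule equalityI[rotated])
  have "\<exists>(B :: nat \<Rightarrow> ('r \<times> 'r set) list set) d e. (\<forall>i. finite (B i)) \<and> free_resolution R ?N B d e"
    by (rule N.exists_finite_free_resolution[OF _ _ span]) (use p1 infinite_UNIV_listI in auto)
  then obtain B' :: "nat \<Rightarrow> ('r \<times> 'r set) list set" and d' e'
    where B': "\<forall>i. finite (B' i)" "free_resolution R ?N B' d' e'" by blast
  obtain B :: "nat \<Rightarrow> ('r \<times> 'r set) list set" and d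
    where Bd: "(B, d) = (SOME (B, d). \<exists>e. free_resolution R ?N B d e)" by (metis surj_pair)
  have "case (B, d) of (B, d) \<Rightarrow> \<exists>e. free_resolution R ?N B d e"
    unfolding Bd by (rule someI[of _ "(B', d')"]) (use B' in auto)
  then obtain e where "free_resolution R ?N B d e" by auto
  moreover have "\<forall>i. Ext_module R i ?N M = hom_cohomology R B d M i"
    unfolding Ext_module_def Bd[symmetric] by simp
  ultimately show ?thesis using B' by blast
qed

end

text \<open>The embedding sends \<open>m\<close> to the cocycle \<open>x \<mapsto> \<epsilon> x m\<close>, where \<open>\<epsilon>\<close> lifts the augmentation along
  \<open>R \<rightarrow> R / a\<close>.\<close>

lemma minimax_annihilated_of_cohomology_0:
  fixes M :: "('r, 'm) module"
  assumes R: "noetherian_cring R" and M: "module R M" and a: "ideal a R"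
    and res: "free_resolution R (quot_module (regular_module R) a) B d e"
    and mm: "minimax_module R (hom_cohomology R B d M 0)"
  shows "minimax_submodule R M (annihilated_by M a)"
proof -
  interpret R: noetherian_cring R by (rule R)
  interpret a: ideal a R by (rule a)
  let ?N = "quot_module (regular_module R) a" and ?Q = "hom_cohomology R B d M 0"
  let ?T = "annihilated_by M a"
  obtain p where p: "linear_map R (regular_module R) ?N p"
    "{r \<in> carrier R. p r = \<zero>\<^bsub>?N\<^esub>} = a" "p ` carrier R = carrier ?N"
    by (rule R.quotient_ring_projection[OF a])
  interpret p: linear_map R "regular_module R" ?N p by (rule p(1))
  interpret M: rmodule R M by (rule rmoduleI[OF M])
  interpret F: resolution_coefficients R ?N B d e M
    using res by unfold_locales
  have "\<exists>\<epsilon>\<in>module_homs R (F.F 0) (regular_module R). \<forall>x\<in>carrier (F.F 0). p (\<epsilon> x) = e x"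
    by (rule free_module_lift[OF p(1) F.e_linear]) (use p(3) module_homsD(1)[OF F.e_hom] in auto)
  then obtain \<epsilon> where \<epsilon>: "\<epsilon> \<in> module_homs R (F.F 0) (regular_module R)"
    "\<And>x. x \<in> carrier (F.F 0) \<Longrightarrow> p (\<epsilon> x) = e x" by blast
  interpret \<epsilon>: linear_map R "F.F 0" "regular_module R" \<epsilon>
    by (rule linear_mapI[OF F.module_F R.module_regular_module \<epsilon>(1)])
  have \<epsilon>c: "\<epsilon> x \<in> carrier R" if "x \<in> carrier (F.F 0)" for x using \<epsilon>.map_closed[OF that] by simp
  have T: "submodule ?T R M" by (rule M.annihilated_by_submodule[OF a.a_subset])
  have Tc: "m \<in> carrier M" if "m \<in> ?T" for m using that by (simp add: annihilated_by_def)
  interpret MT: rmodule R "M\<lparr>carrier := ?T\<rparr>" by (rule rmoduleI[OF module_restrict[OF M T]])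
  interpret Z: rmodule R "F.Z 0" by (rule rmoduleI[OF F.module_Z])
  let ?\<Phi> = "\<lambda>m. \<lambda>x\<in>carrier (F.F 0). \<epsilon> x \<odot>\<^bsub>M\<^esub> m"
  have \<Phi>Z: "?\<Phi> m \<in> hom_cocycles R B d M 0" if m: "m \<in> ?T" for m
  proof -
    have "?\<Phi> m \<in> module_homs R (F.F 0) M"
      using \<epsilon>c Tc[OF m] \<epsilon>.map_add \<epsilon>.map_smult
      by (auto simp: module_homs_def M.smult_l_distr M.smult_assoc1)
    moreover have "?\<Phi> m (d 0 x) = \<zero>\<^bsub>M\<^esub>" if x: "x \<in> carrier (F.F (Suc 0))" for x
    proof -
      have dx: "d 0 x \<in> carrier (F.F 0)" by (rule F.d_closed[OF x])
      \<comment> \<open>\<open>p\<close> maps \<open>\<epsilon> (d 0 x)\<close> to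
        \<open>e (d 0 x) = 0\<close>, so it lies in the kernel \<open>a\<close> of \<open>p\<close>
        and kills \<open>m\<close>.\<close>
      then have "\<epsilon> (d 0 x) \<in> a" using p(2) \<epsilon>(2)[OF dx] F.e_d[OF x] \<epsilon>c by blast
      then show ?thesis using dx m by (simp add: annihilated_by_def)
    qed
    ultimately show ?thesis by (simp add: F.cocycles_iff)
  qed
  have \<Phi>: "linear_map R (M\<lparr>carrier := ?T\<rparr>) (F.Z 0) ?\<Phi>"
    by unfold_locales
      (use \<Phi>Z in \<open>auto simp: fun_eq_iff M.smult_r_distr M.smult_assoc1[symmetric] R.m_comm \<epsilon>c Tc\<close>)
  interpret q: linear_map R "M\<lparr>carrier := ?T\<rparr>" ?Q "\<lambda>m. hom_coboundaries R B d M 0 +>\<^bsub>F.Z 0\<^esub> ?\<Phi> m"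
    by (rule linear_map_comp[OF \<Phi> F.cohomology_projection(1)])
  interpret Q: noetherian_rmodule R ?Q
    by (rule noetherian_rmodule.intro[OF q.N.rmodule_axioms R])
  have inj: "m = \<zero>\<^bsub>M\<^esub>" if m: "m \<in> ?T" "hom_coboundaries R B d M 0 +>\<^bsub>F.Z 0\<^esub> ?\<Phi> m = \<zero>\<^bsub>?Q\<^esub>" for m
  proof -
    \<comment> \<open>The only coboundary in degree 0 is zero, so a vanishing class means that the
      cocycle itself vanishes.\<close>
    have "?\<Phi> m \<in> hom_coboundaries R B d M 0" using m(2) \<Phi>Z[OF m(1)] F.cohomology_projection(2)[of 0] by blast
    then have z: "\<epsilon> x \<odot>\<^bsub>M\<^esub> m = \<zero>\<^bsub>M\<^esub>" if "x \<in> carrier (F.F 0)" for x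
      using that by (auto simp: fun_eq_iff restrict_def split: if_splits)
    \<comment> \<open>For this \<open>x\<close> the element \<open>\<epsilon> x\<close> is congruent
      to 1 modulo \<open>a\<close>, so the value of the cocycle at \<open>x\<close> is
      \<open>m\<close>.\<close>
    obtain x where x: "x \<in> carrier (F.F 0)" "e x = p \<one>\<^bsub>R\<^esub>"
    proof -
      have "p \<one>\<^bsub>R\<^esub> \<in> e ` carrier (F.F 0)" unfolding F.e_surj by simp
      then show thesis using that by (metis imageE)
    qed
    have "p (\<epsilon> x \<ominus>\<^bsub>regular_module R\<^esub> \<one>\<^bsub>R\<^esub>) = \<zero>\<^bsub>?N\<^esub>"
      using \<epsilon>(2)[OF x(1)] x \<epsilon>c p.map_closed[of "\<one>\<^bsub>R\<^esub>"]
      by (simp add: p.map_diff a_minus_def[of ?N] p.N.M.r_neg)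
    then have da: "\<epsilon> x \<ominus>\<^bsub>regular_module R\<^esub> \<one>\<^bsub>R\<^esub> \<in> a" (is "?d \<in> a")
      using p(2) p.M.M.minus_closed[of "\<epsilon> x" "\<one>\<^bsub>R\<^esub>"] \<epsilon>c[OF x(1)] by auto
    have eq: "\<epsilon> x = ?d \<oplus>\<^bsub>R\<^esub> \<one>\<^bsub>R\<^esub>"
      using \<epsilon>c[OF x(1)] p.M.M.a_inv_closed[of "\<one>\<^bsub>R\<^esub>"] p.M.M.l_neg[of "\<one>\<^bsub>R\<^esub>"]
      by (simp add: a_minus_def R.a_assoc)
    have "\<epsilon> x \<odot>\<^bsub>M\<^esub> m = (?d \<oplus>\<^bsub>R\<^esub> \<one>\<^bsub>R\<^esub>) \<odot>\<^bsub>M\<^esub> m"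
      by (rule arg_cong[OF eq])
    also have "\<dots> = ?d \<odot>\<^bsub>M\<^esub> m \<oplus>\<^bsub>M\<^esub> m"
      using da Tc[OF m(1)] a.a_Hcarr by (simp add: M.smult_l_distr)
    finally have "\<epsilon> x \<odot>\<^bsub>M\<^esub> m = ?d \<odot>\<^bsub>M\<^esub> m \<oplus>\<^bsub>M\<^esub> m" .
    moreover have "?d \<odot>\<^bsub>M\<^esub> m = \<zero>\<^bsub>M\<^esub>" using da m(1) by (simp add: annihilated_by_def)
    ultimately show ?thesis using z[OF x(1)] Tc[OF m(1)] by simp
  qed
  let ?q = "\<lambda>m. hom_coboundaries R B d M 0 +>\<^bsub>F.Z 0\<^esub> ?\<Phi> m"
  have "minimax_submodule R (M\<lparr>carrier := ?T\<rparr>) (carrier (M\<lparr>carrier := ?T\<rparr>))"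
  proof (rule q.minimax_submodule_extension[OF MT.carrier_is_submodule])
    have "carrier (M\<lparr>carrier := ?T\<rparr>) \<inter> {x \<in> carrier (M\<lparr>carrier := ?T\<rparr>). ?q x = \<zero>\<^bsub>?Q\<^esub>} =
        {\<zero>\<^bsub>M\<lparr>carrier := ?T\<rparr>\<^esub>}"
      using inj q.map_zero MT.M.zero_closed by auto
    then show "minimax_submodule R (M\<lparr>carrier := ?T\<rparr>)
        (carrier (M\<lparr>carrier := ?T\<rparr>) \<inter> {x \<in> carrier (M\<lparr>carrier := ?T\<rparr>). ?q x = \<zero>\<^bsub>?Q\<^esub>})"
      unfolding minimax_submodule_def
      by (intro exI[of _ "{}"]) (simp only: MT.span_empty dcc_between_refl finite.emptyI empty_subsetI simp_thms)
    note im = q.image_submodule[OF MT.carrier_is_submodule]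
    show "minimax_submodule R ?Q (?q ` carrier (M\<lparr>carrier := ?T\<rparr>))"
      using mm unfolding q.N.minimax_module_iff
      by (rule Q.minimax_submodule_subset[OF q.N.carrier_is_submodule im q.N.submodule_subset[OF im]])
  qed
  then show ?thesis using minimax_submodule_restrict[OF M T] by simp
qed

text \<open>With this criterion the Serre property no longer involves Ext: it follows from closure
  properties of minimax modules and of supports.\<close>

lemma cominimax_module_iff:
  fixes M :: "('r, 'm) module"
  assumes R: "noetherian_cring R" and dim: "krull_dim R \<le> 1" and a: "ideal a R" and M: "module R M"
  shows "cominimax_module R a M \<longleftrightarrow> module_supp R M \<subseteq> prime_locus R a \<and> minimax_module R M"
proof -
  interpret R: noetherian_cring R by (rule R)
  interpret M: noetherian_rmodule R M by (rule noetherian_rmodule.intro[OF rmoduleI[OF M] R])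
  let ?N = "quot_module (regular_module R) a"
  obtain p where "linear_map R (regular_module R) ?N p" by (rule R.quotient_ring_projection[OF a])
  then interpret p: linear_map R "regular_module R" ?N p .
  obtain B :: "nat \<Rightarrow> ('r \<times> 'r set) list set" and d e and B' :: "nat \<Rightarrow> ('r \<times> 'r set) list set" and d' e'
    where res: "free_resolution R ?N B d e" "free_resolution R ?N B' d' e'"
      and fin: "\<And>i. finite (B' i)" and Ext: "\<And>i. Ext_module R i ?N M = hom_cohomology R B d M i"
    using R.Ext_module_quotient_ring[OF a M] by blast
  have res': "resolution R ?N B d e" "resolution R ?N B' d' e'"
    using res by (auto intro!: resolution.intro resolution_axioms.intro p.N.rmodule_axioms)
  have "minimax_module R M" if "module_supp R M \<subseteq> prime_locus R a" "minimax_module R (hom_cohomology R B d M 0)"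
    by (rule M.minimax_of_annihilated_minimax[OF dim a that(1)
          minimax_annihilated_of_cohomology_0[OF R M a res(1) that(2)]])
  moreover have "minimax_module R (hom_cohomology R B d M i)" if "minimax_module R M" for i
    by (rule minimax_cohomology[OF res' fin M.noetherian_rmodule_axioms that])
  ultimately show ?thesis unfolding cominimax_module_def Ext by blast
qed

theorem proposition1p1:
  fixes R :: "('r, 'z) ring_scheme" and a :: "'r set"
  assumes "cring R" and "noetherian_ring R" and "\<one>\<^bsub>R\<^esub> \<noteq> \<zero>\<^bsub>R\<^esub>"
    and "krull_dim R \<le> 1"
    and "ideal a R"
  shows "(\<forall>M :: ('r, 'm) module.
      module R M \<and> module_supp R M \<subseteq> prime_locus R a \<and>
      minimax_module R (M\<lparr>carrier := annihilated_by M a\<rparr>)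
      \<longrightarrow> minimax_module R M) \<and>
    serre_subcategory R
      (cominimax_module R a :: ('r, 'l) module \<Rightarrow> bool)
      (cominimax_module R a :: ('r, 'm) module \<Rightarrow> bool)
      (cominimax_module R a :: ('r, 'n) module \<Rightarrow> bool)"
proof (intro conjI allI impI)
  have R: "noetherian_cring R" using assms(1,2) by (simp add: noetherian_cring_def)
  note a = assms(5) and dim = assms(4)
  have aR: "a \<subseteq> carrier R" using ideal.axioms(1)[OF a] by (rule additive_subgroup.a_subset)
  note iff = cominimax_module_iff[OF R dim a]
  { fix M :: "('r, 'm) module"
    assume M: "module R M \<and> module_supp R M \<subseteq> prime_locus R a \<and>
      minimax_module R (M\<lparr>carrier := annihilated_by M a\<rparr>)"
    interpret M: noetherian_rmodule R M
      by (rule noetherian_rmodule.intro[OF rmoduleI R]) (use M in blast)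
    show "minimax_module R M"
      using M M.minimax_module_restrict_iff[OF M.annihilated_by_submodule[OF aR]]
      by (intro M.minimax_of_annihilated_minimax[OF dim a]) auto }
  \<comment> \<open>Minimaxity of the image of \<open>f\<close> is inherited from \<open>M\<close>;
    the extension lemma carries it back to \<open>L\<close> because the kernel of \<open>f\<close>
    is zero.\<close>
  have sub: "cominimax_module R a L"
    if "linear_map R L M f" "inj_on f (carrier L)" "cominimax_module R a M"
    for L :: "('r, 'l) module" and M :: "('r, 'm) module" and f
  proof -
    interpret f: linear_map R L M f by (rule that(1))
    interpret M: noetherian_rmodule R M by (rule noetherian_rmodule.intro[OF f.N.rmodule_axioms R])
    note im = f.image_submodule[OF f.M.carrier_is_submodule]
    have M: "module_supp R M \<subseteq> prime_locus R a" "minimax_submodule R M (carrier M)"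
      using that(3) iff[OF f.N.module_axioms] f.N.minimax_module_iff by auto
    have "minimax_submodule R L (carrier L)"
    proof (rule f.minimax_submodule_extension[OF f.M.carrier_is_submodule])
      show "minimax_submodule R M (f ` carrier L)"
        by (rule M.minimax_submodule_subset[OF f.N.carrier_is_submodule im f.N.submodule_subset[OF im] M(2)])
      have "x = \<zero>\<^bsub>L\<^esub>" if "x \<in> carrier L" "f x = \<zero>\<^bsub>M\<^esub>" for x
        using inj_onD[OF \<open>inj_on f (carrier L)\<close>, of x "\<zero>\<^bsub>L\<^esub>"] that by simp
      then have "carrier L \<inter> {x \<in> carrier L. f x = \<zero>\<^bsub>M\<^esub>} = {\<zero>\<^bsub>L\<^esub>}" by auto
      then show "minimax_submodule R L (carrier L \<inter> {x \<in> carrier L. f x = \<zero>\<^bsub>M\<^esub>})"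
        unfolding minimax_submodule_def
        by (intro exI[of _ "{}"]) (simp add: f.M.span_empty dcc_between_refl)
    qed
    then show ?thesis
      using f.supp_of_injective[OF that(2)] M(1) iff[OF f.M.module_axioms] f.M.minimax_module_iff by auto
  qed
  have quot: "cominimax_module R a N"
    if "linear_map R M N g" "g ` carrier M = carrier N" "cominimax_module R a M"
    for M :: "('r, 'm) module" and N :: "('r, 'n) module" and g
  proof -
    interpret g: linear_map R M N g by (rule that(1))
    show ?thesis
      using that(3) g.supp_of_surjective[OF that(2)] g.minimax_submodule_image[OF g.M.carrier_is_submodule] that(2)
      unfolding iff[OF g.M.module_axioms] iff[OF g.N.module_axioms] g.M.minimax_module_iff g.N.minimax_module_iff
      by auto
  qed
  have ext: "cominimax_module R a M"
    if fg: "linear_map R L M f" "linear_map R M N g" "g ` carrier M = carrier N"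
      "f ` carrier L = module_ker M N g" and LN: "cominimax_module R a L" "cominimax_module R a N"
    for L :: "('r, 'l) module" and M :: "('r, 'm) module" and N :: "('r, 'n) module" and f g
  proof -
    interpret f: linear_map R L M f by (rule fg(1))
    interpret g: linear_map R M N g by (rule fg(2))
    have L: "module_supp R L \<subseteq> prime_locus R a" "minimax_submodule R L (carrier L)"
      and N: "module_supp R N \<subseteq> prime_locus R a" "minimax_submodule R N (carrier N)"
      using LN iff[OF f.M.module_axioms] iff[OF g.N.module_axioms] f.M.minimax_module_iff g.N.minimax_module_iff
      by auto
    \<comment> \<open>Exactness turns the kernel condition of the extension lemma into minimaxity of
      the image of \<open>L\<close>.\<close>
    have "carrier M \<inter> {x \<in> carrier M. g x = \<zero>\<^bsub>N\<^esub>} = f ` carrier L"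
      using fg(4) by (auto simp: module_ker_def)
    then have "minimax_submodule R M (carrier M)"
      using f.minimax_submodule_image[OF f.M.carrier_is_submodule L(2)] N(2) fg(3)
      by (intro g.minimax_submodule_extension[OF f.N.carrier_is_submodule]) auto
    then show ?thesis
      using supp_of_extension[OF fg(1,2,4)] L(1) N(1) iff[OF f.N.module_axioms] f.N.minimax_module_iff by blast
  qed
  show "serre_subcategory R
      (cominimax_module R a :: ('r, 'l) module \<Rightarrow> bool)
      (cominimax_module R a :: ('r, 'm) module \<Rightarrow> bool)
      (cominimax_module R a :: ('r, 'n) module \<Rightarrow> bool)"
    unfolding serre_subcategory_def
  proof (intro conjI allI impI; elim conjE)
    fix L :: "('r, 'l) module" and M :: "('r, 'm) module" and f
    assume "module R L" "module R M" "f \<in> module_homs R L M" "inj_on f (carrier L)" "cominimax_module R a M"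
    then show "cominimax_module R a L" by (intro sub[OF linear_mapI])
  next
    fix M :: "('r, 'm) module" and N :: "('r, 'n) module" and g
    assume "module R M" "module R N" "g \<in> module_homs R M N" "g ` carrier M = carrier N" "cominimax_module R a M"
    then show "cominimax_module R a N" by (intro quot[OF linear_mapI])
  next
    fix L :: "('r, 'l) module" and M :: "('r, 'm) module" and N :: "('r, 'n) module" and f g
    assume "module R L" "module R M" "module R N" "f \<in> module_homs R L M" "g \<in> module_homs R M N"
      "g ` carrier M = carrier N" "f ` carrier L = module_ker M N g"
      "cominimax_module R a L" "cominimax_module R a N"
    then show "cominimax_module R a M" by (intro ext[OF linear_mapI linear_mapI])
  qed
qed

end
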